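(* Let $X^{(0)}$ be a flexible real affine algebraic variety. Suppose that the smooth locus $X^{(0)}_{\mathrm{reg}}$ is connected and that the special automorphism group $\mathrm{SAut}(X^{(0)})$ acts $m$-transitively on $X^{(0)}_{\mathrm{reg}}$ for every $m\in\mathbb{N}$. Consider the iterated suspensions $X^{(i)}=\mathrm{Susp}(X^{(i-1)},f_i)$, where the functions $f_i\in\mathbb{R}[X^{(i-1)}]$ satisfy $f_i(X^{(i-1)}_{\mathrm{reg}})=\mathbb{R}$, $i=1,\dots,l$. Then for every $i=1,\dots,l$ the variety $X^{(i)}$ is flexible and the special automorphism group $\mathrm{SAut}(X^{(i)})$ acts $m$-transitively on $X^{(i)}_{\mathrm{reg}}$ for every $m\in\mathbb{N}$.
   Context: Varieties are reduced and irreducible, the ground field is $\mathbb{R}$, and points are real points; $X_{\mathrm{reg}}$ is the set of smooth (real) points, viewed as a real manifold with its Euclidean topology (this is the sense of "connected"). For an affine variety $Y$ and a non-constant $f\in\mathbb{R}[Y]$, $\mathrm{Susp}(Y,f)=\{f(y)-uv=0\}\subseteq Y\times\mathbb{A}^2$, where $\mathbb{A}^2=\mathrm{Spec}\,\mathbb{R}[u,v]$. A one-parameter unipotent subgroup of $\mathrm{Aut}(X)$ is the subgroup determined by an effective algebraic action of the additive group $\mathbb{G}_a(\mathbb{R})$ on $X$. $\mathrm{SAut}(X)$ is the subgroup of $\mathrm{Aut}(X)$ generated by all one-parameter unipotent subgroups. A point $x\in X$ is flexible if $T_xX$ is spanned by the tangent vectors at $x$ to the orbits $H.x$ of one-parameter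 unipotent subgroups $H\subseteq\mathrm{Aut}(X)$. $X$ is flexible if every point of $X_{\mathrm{reg}}$ is flexible. An action of a group $G$ on a set $A$ is $m$-transitive if for any two $m$-tuples $(a_1,\dots,a_m)$, $(b_1,\dots,b_m)$ of pairwise distinct points of $A$ there is $g\in G$ with $g(a_j)=b_j$ for all $j$. *)

theory Defs
  imports "HOL-Analysis.Analysis" "HOL-Library.Function_Algebras"
    "HOL-Algebra.Ideal" "HOL-Algebra.Generated_Groups"
begin

text \<open>
  The real vector space structure on functions (pointwise), so that \<^const>\<open>span\<close> and
  \<^const>\<open>dim\<close> are available for vectors of type \<^typ>\<open>nat \<Rightarrow> real\<close>.
\<close>

instantiation "fun" :: (type, real_vector) real_vector
begin

definition scaleR_fun :: "real \<Rightarrow> ('a \<Rightarrow> 'b) \<Rightarrow> 'a \<Rightarrow> 'b"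
  where "scaleR_fun c f = (\<lambda>x. c *\<^sub>R f x)"

instance
  by standard
    (simp_all add: scaleR_fun_def plus_fun_def scaleR_add_right scaleR_add_left)

end


section \<open>Polynomials\<close>

text \<open>
  Real \<open>n\<close>-space, as sequences vanishing from index \<open>n\<close> on; one type thus houses the spaces
  of all dimensions. The topology of \<^typ>\<open>nat \<Rightarrow> real\<close> (pointwise convergence) induces
  the Euclidean topology on it.
\<close>

type_synonym point = "nat \<Rightarrow> real"

definition affine_space :: "nat \<Rightarrow> point set"
  where "affine_space n = {x. \<forall>i\<ge>n. x i = 0}"

text \<open>
  The polynomial ring in the \<open>n\<close> variables \<open>x 0, \<dots>, x (n - 1)\<close>. Since the reals are infinite,
  polynomials are the same as polynomial functions. They are taken as functions on all of
  \<^typ>\<open>point\<close>, so that \<open>polys m \<subseteq> polys n\<close> whenever \<open>m \<le> n\<close>.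
\<close>

inductive_set polys :: "nat \<Rightarrow> (point \<Rightarrow> real) set" for n :: nat where
  const: "(\<lambda>x. c) \<in> polys n"
| var: "i < n \<Longrightarrow> (\<lambda>x. x i) \<in> polys n"
| add: "p \<in> polys n \<Longrightarrow> q \<in> polys n \<Longrightarrow> p + q \<in> polys n"
| mult: "p \<in> polys n \<Longrightarrow> q \<in> polys n \<Longrightarrow> p * q \<in> polys n"

definition poly_ring :: "nat \<Rightarrow> (point \<Rightarrow> real) ring"
  where "poly_ring n =
    \<lparr>carrier = polys n, monoid.mult = (*), one = 1, zero = 0, add = (+)\<rparr>"


section \<open>Affine varieties\<close>

text \<open>
  A reduced and irreducible affine variety over the reals, with a closed embedding into affine
  \<open>n\<close>-space, is a prime ideal of the polynomial ring in \<open>n\<close> variables. Its coordinate ring is the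
  quotient by this ideal; regular functions and morphisms are represented by polynomials, and two
  representatives are identified if they are congruent modulo the ideal.
\<close>

record variety =
  nvars :: nat
  vanishing :: "(point \<Rightarrow> real) set"

definition affine_variety :: "variety \<Rightarrow> bool"
  where "affine_variety X \<longleftrightarrow> primeideal (vanishing X) (poly_ring (nvars X))"

definition points :: "variety \<Rightarrow> point set"
  where "points X = {x \<in> affine_space (nvars X). \<forall>p\<in>vanishing X. p x = 0}"

text \<open>
  The dimension is the transcendence degree over the reals of the coordinate ring, i.e. the
  largest number of regular functions (represented by \<open>g 0, \<dots>, g (k - 1)\<close>) that satisfy
  no nontrivial polynomial relation.
\<close>

definition alg_independent :: "variety \<Rightarrow> nat \<Rightarrow> (nat \<Rightarrow> point \<Rightarrow> real) \<Rightarrow> bool"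
  where "alg_independent X k g \<longleftrightarrow>
    (\<forall>j<k. g j \<in> polys (nvars X)) \<and>
    (\<forall>P\<in>polys k. (\<lambda>x. P (\<lambda>j. g j x)) \<in> vanishing X \<longrightarrow> P = 0)"

definition variety_dim :: "variety \<Rightarrow> nat"
  where "variety_dim X = (GREATEST k. \<exists>g. alg_independent X k g)"

text \<open>
  The Zariski tangent space at a real point: the common kernel of the differentials of the
  elements of the ideal, the differential being expressed by directional derivatives.
\<close>

definition tangent_space :: "variety \<Rightarrow> point \<Rightarrow> (nat \<Rightarrow> real) set"
  where "tangent_space X x = {v \<in> affine_space (nvars X).
    \<forall>p\<in>vanishing X. ((\<lambda>s. p (x + s *\<^sub>R v)) has_real_derivative 0) (at 0)}"

definition reg :: "variety \<Rightarrow> point set"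
  where "reg X = {x \<in> points X. dim (tangent_space X x) = variety_dim X}"


section \<open>Automorphisms\<close>

definition endos :: "variety \<Rightarrow> (point \<Rightarrow> point) set"
  where "endos X = {\<phi>.
    (\<forall>i<nvars X. (\<lambda>x. \<phi> x i) \<in> polys (nvars X)) \<and>
    (\<forall>x. \<phi> x \<in> affine_space (nvars X)) \<and>
    (\<forall>p\<in>vanishing X. p \<circ> \<phi> \<in> vanishing X)}"

definition same_morphism :: "variety \<Rightarrow> (point \<Rightarrow> point) \<Rightarrow> (point \<Rightarrow> point) \<Rightarrow> bool"
  where "same_morphism X \<phi> \<psi> \<longleftrightarrow> (\<forall>i<nvars X. (\<lambda>x. \<phi> x i - \<psi> x i) \<in> vanishing X)"

definition morphism_class :: "variety \<Rightarrow> (point \<Rightarrow> point) \<Rightarrow> (point \<Rightarrow> point) set"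
  where "morphism_class X \<phi> = {\<psi> \<in> endos X. same_morphism X \<psi> \<phi>}"

definition autos :: "variety \<Rightarrow> (point \<Rightarrow> point) set"
  where "autos X = {\<phi> \<in> endos X. \<exists>\<psi>\<in>endos X.
    same_morphism X (\<phi> \<circ> \<psi>) id \<and> same_morphism X (\<psi> \<circ> \<phi>) id}"

text \<open>
  The group of automorphisms; an automorphism is the class of all polynomial maps representing it.
  Note that \<^const>\<open>id\<close> itself need not be in \<open>endos X\<close>, as it does not truncate to
  \<open>affine_space (nvars X)\<close>; its class consists of the truncating representatives.
\<close>

definition Aut :: "variety \<Rightarrow> (point \<Rightarrow> point) set monoid"
  where "Aut X = \<lparr>carrier = morphism_class X ` autos X,
    monoid.mult = (\<lambda>F G. {\<theta> \<in> endos X. \<exists>\<phi>\<in>F. \<exists>\<psi>\<in>G. same_morphism X \<theta> (\<phi> \<circ> \<psi>)}),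
    one = morphism_class X id\<rparr>"

text \<open>On \<open>points X\<close>, the value does not depend on the representative.\<close>

definition act :: "(point \<Rightarrow> point) set \<Rightarrow> point \<Rightarrow> point"
  where "act F x = (THE y. \<exists>\<phi>\<in>F. y = \<phi> x)"

text \<open>
  Effective algebraic actions of the additive group: \<open>\<phi> t x\<close> is jointly polynomial in \<open>x\<close> and \<open>t\<close>,
  where \<open>t\<close> is put in as the additional variable with index \<open>nvars X\<close>. As the reals are infinite,
  congruence modulo the ideal for all real \<open>t\<close> is the same as congruence with \<open>t\<close> an indeterminate,
  so this is a morphism from the product of the affine line and \<open>X\<close> to \<open>X\<close>.
\<close>

definition Ga_action :: "variety \<Rightarrow> (real \<Rightarrow> point \<Rightarrow> point) \<Rightarrow> bool"
  where "Ga_action X \<phi> \<longleftrightarrow>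
    (\<forall>i<nvars X. \<exists>P\<in>polys (nvars X + 1). \<forall>t x. \<phi> t x i = P (x(nvars X := t))) \<and>
    (\<forall>t. \<phi> t \<in> endos X) \<and>
    same_morphism X (\<phi> 0) id \<and>
    (\<forall>s t. same_morphism X (\<phi> (s + t)) (\<phi> s \<circ> \<phi> t))"

definition effective_Ga_action :: "variety \<Rightarrow> (real \<Rightarrow> point \<Rightarrow> point) \<Rightarrow> bool"
  where "effective_Ga_action X \<phi> \<longleftrightarrow>
    Ga_action X \<phi> \<and> (\<forall>t. same_morphism X (\<phi> t) id \<longrightarrow> t = 0)"

definition one_param_unipotent_subgroups :: "variety \<Rightarrow> (point \<Rightarrow> point) set set set"
  where "one_param_unipotent_subgroups X =
    {range (\<lambda>t. morphism_class X (\<phi> t)) | \<phi>. effective_Ga_action X \<phi>}"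

definition SAut :: "variety \<Rightarrow> (point \<Rightarrow> point) set set"
  where "SAut X = generate (Aut X) (\<Union>(one_param_unipotent_subgroups X))"


section \<open>Flexibility, multiple transitivity, suspensions\<close>

text \<open>
  The velocity vectors at time 0 of the orbits through \<open>x\<close>. The parametrization of a
  one-parameter unipotent subgroup is unique up to scaling of time, so for each subgroup these
  are nonzero tangent vectors to its orbit, or all are 0 if \<open>x\<close> is a fixed point.
\<close>

definition orbit_tangents :: "variety \<Rightarrow> point \<Rightarrow> (nat \<Rightarrow> real) set"
  where "orbit_tangents X x = {v. \<exists>\<phi>. effective_Ga_action X \<phi> \<and>
    (\<forall>i. ((\<lambda>t. \<phi> t x i) has_real_derivative v i) (at 0))}"

definition flexible_point :: "variety \<Rightarrow> point \<Rightarrow> bool"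
  where "flexible_point X x \<longleftrightarrow> span (orbit_tangents X x) = tangent_space X x"

definition flexible :: "variety \<Rightarrow> bool"
  where "flexible X \<longleftrightarrow> (\<forall>x\<in>reg X. flexible_point X x)"

definition multiply_transitive ::
    "nat \<Rightarrow> 'g set \<Rightarrow> ('g \<Rightarrow> 'a \<Rightarrow> 'a) \<Rightarrow> 'a set \<Rightarrow> bool"
  where "multiply_transitive m G \<alpha> A \<longleftrightarrow>
    (\<forall>a b. a ` {..<m} \<subseteq> A \<and> inj_on a {..<m} \<and> b ` {..<m} \<subseteq> A \<and> inj_on b {..<m} \<longrightarrow>
      (\<exists>g\<in>G. \<forall>j<m. \<alpha> g (a j) = b j))"

text \<open>
  The suspension over \<open>Y\<close> with \<open>f\<close>; the coordinates \<open>u\<close> and \<open>v\<close> are the variables with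
  indices \<open>nvars Y\<close> and \<open>nvars Y + 1\<close>. It depends only on the class of \<open>f\<close> in the coordinate ring.
\<close>

definition Susp :: "variety \<Rightarrow> (point \<Rightarrow> real) \<Rightarrow> variety"
  where "Susp Y f = \<lparr>nvars = nvars Y + 2,
    vanishing = genideal (poly_ring (nvars Y + 2))
      (vanishing Y \<union> {\<lambda>x. f x - x (nvars Y) * x (nvars Y + 1)})\<rparr>"

end

theory Submission
  imports Defs "Jordan_Normal_Form.Determinant"
begin

text \<open>
  By induction it suffices that a single suspension \<open>S = {f = uv}\<close> over an affine variety \<open>Y\<close> that is
  flexible and multiply transitive inherits these properties if \<open>f\<close> maps the regular points of \<open>Y\<close>
  onto the reals (\<open>suspension_preserves\<close>).

  An action of the additive group on \<open>Y\<close> lifts to \<open>S\<close>: keep \<open>u\<close>, move the base point at speed \<open>u r(u)\<close>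
  for some polynomial \<open>r\<close>, and adapt \<open>v\<close> (\<open>Ga_action_lift\<close>). Exchanging \<open>u\<close> and \<open>v\<close> gives further actions,
  which keep \<open>v\<close>. By interpolation, \<open>r\<close> can be chosen such that only the points on one level of \<open>u\<close> among
  finitely many given ones move, and on this level \<open>u = c \<noteq> 0\<close> every flow of \<open>Y\<close> is realized
  (\<open>level_flow\<close>).

  For transitivity, finitely many distinct regular points of \<open>S\<close> are first moved to distinct nonzero
  levels of \<open>u\<close>. It is enough to do so for one point, or for two points, at a time, because open conditions
  that can be achieved separately can be achieved jointly (\<open>generic_flow\<close>). On distinct levels the base
  points can be moved independently, and since \<open>f\<close> is surjective, \<open>v = f / u\<close> can be given any
  value. So the points are brought to prescribed distinct levels of \<open>v\<close>, and moving inside these they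
  reach a standard position (\<open>move_to_standard\<close>). For flexibility, flows transport orbit velocities, so by
  transitivity one point of \<open>S\<close> is enough, and at a point where \<open>u\<close> and the differential of \<open>f\<close> are nonzero
  the velocities of the lifted actions span the tangent space (\<open>flexible_S\<close>).

  All this presupposes a description of \<open>S\<close>: its ideal, its dimension, and its regular points. Composing
  actions whose velocities at a regular point form a basis of the tangent space gives a polynomial map
  from real \<open>d\<close>-space to the regular points of \<open>Y\<close> that is dominant, where \<open>d\<close> is the dimension
  (\<open>flexible_dominated\<close>). Thus the coordinate ring of \<open>Y\<close> embeds into a polynomial ring, the ideal is the
  ideal of the real points, and regular points are dense, whence the tangent dimension is at least \<open>d\<close>
  everywhere (\<open>tangent_dim_ge\<close>). A normal form modulo \<open>f - uv\<close> shows that the coordinate ring of \<open>S\<close>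
  embeds into the polynomials in \<open>d + 1\<close> variables with \<open>u\<close> inverted (\<open>vanishing_S_iff\<close>). Hence \<open>S\<close> is
  a variety, and a count of dimensions (\<open>algebraic_dependence\<close>) gives it dimension \<open>d + 1\<close>. Its regular
  points are those over regular points of \<open>Y\<close> at which \<open>f - uv\<close> has nonzero differential (\<open>reg_S\<close>).
\<close>

section \<open>Polynomial functions\<close>

lemma polys_add: "p \<in> polys n \<Longrightarrow> q \<in> polys n \<Longrightarrow> (\<lambda>x. p x + q x) \<in> polys n"
  using polys.add[of p n q] by (simp add: plus_fun_def)

lemma polys_mult: "p \<in> polys n \<Longrightarrow> q \<in> polys n \<Longrightarrow> (\<lambda>x. p x * q x) \<in> polys n"
  using polys.mult[of p n q] by (simp add: times_fun_def)

lemma polys_uminus: "p \<in> polys n \<Longrightarrow> (\<lambda>x. - p x) \<in> polys n"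
  using polys_mult[OF polys.const[of "-1"], of p n] by simp

lemma polys_diff: "p \<in> polys n \<Longrightarrow> q \<in> polys n \<Longrightarrow> (\<lambda>x. p x - q x) \<in> polys n"
  using polys_add[OF _ polys_uminus, of p n q] by simp

lemma polys_power: "p \<in> polys n \<Longrightarrow> (\<lambda>x. p x ^ k) \<in> polys n"
  by (induction k) (auto intro: polys.const polys_mult)

lemma polys_sum: "(\<And>i. i \<in> A \<Longrightarrow> p i \<in> polys n) \<Longrightarrow> (\<lambda>x. \<Sum>i\<in>A. p i x) \<in> polys n"
  by (induction A rule: infinite_finite_induct) (auto intro: polys.const polys_add)

lemma polys_prod: "(\<And>i. i \<in> A \<Longrightarrow> p i \<in> polys n) \<Longrightarrow> (\<lambda>x. \<Prod>i\<in>A. p i x) \<in> polys n"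
  by (induction A rule: infinite_finite_induct) (auto intro: polys.const polys_mult)

lemmas polys_intros = polys.const polys.var polys_add polys_mult polys_uminus polys_diff
  polys_power polys_sum polys_prod

lemma polys_cong: "p \<in> polys n \<Longrightarrow> (\<And>i. i < n \<Longrightarrow> x i = y i) \<Longrightarrow> p x = p y"
  by (induction rule: polys.induct) auto

lemma polys_subst:
  "p \<in> polys k \<Longrightarrow> (\<And>j. j < k \<Longrightarrow> (\<lambda>x. g x j) \<in> polys n) \<Longrightarrow> (\<lambda>x. p (g x)) \<in> polys n"
  by (induction rule: polys.induct) (auto intro: polys_intros)

lemma polys_mono: "p \<in> polys m \<Longrightarrow> m \<le> n \<Longrightarrow> p \<in> polys n"
  by (rule polys_subst[where g = "\<lambda>x. x"]) (auto intro: polys.var)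

text \<open>Genericity arguments below are carried out along curves: a polynomial evaluated along a
  polynomial curve is a polynomial in the curve parameter, hence zero everywhere or at finitely
  many parameters only.\<close>

definition upoly :: "(real \<Rightarrow> real) \<Rightarrow> bool"
  where "upoly h \<longleftrightarrow> (\<exists>P. \<forall>s. h s = poly P s)"

lemma upoly_const: "upoly (\<lambda>s. c)"
  unfolding upoly_def by (rule exI[of _ "[:c:]"]) simp

lemma upoly_id: "upoly (\<lambda>s. s)"
  unfolding upoly_def by (rule exI[of _ "[:0, 1:]"]) simp

lemma upoly_add: "upoly g \<Longrightarrow> upoly h \<Longrightarrow> upoly (\<lambda>s. g s + h s)"
  unfolding upoly_def by (metis poly_add)

lemma upoly_diff: "upoly g \<Longrightarrow> upoly h \<Longrightarrow> upoly (\<lambda>s. g s - h s)"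
  unfolding upoly_def by (metis poly_diff)

lemma upoly_mult: "upoly g \<Longrightarrow> upoly h \<Longrightarrow> upoly (\<lambda>s. g s * h s)"
  unfolding upoly_def by (metis poly_mult)

lemma upoly_prod: "(\<And>i. i \<in> A \<Longrightarrow> upoly (p i)) \<Longrightarrow> upoly (\<lambda>s. \<Prod>i\<in>A. p i s)"
  by (induction A rule: infinite_finite_induct) (auto intro: upoly_const upoly_mult)

lemma upoly_polys:
  "p \<in> polys n \<Longrightarrow> (\<And>i. i < n \<Longrightarrow> upoly (\<lambda>s. c s i)) \<Longrightarrow> upoly (\<lambda>s. p (c s))"
  by (induction rule: polys.induct) (auto intro: upoly_const upoly_add upoly_mult)

lemma upoly_finite_zeros:
  assumes "upoly h" "h s0 \<noteq> 0" shows "finite {s. h s = 0}"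
proof -
  obtain P where P: "\<And>s. h s = poly P s" using assms(1) unfolding upoly_def by blast
  have "P \<noteq> 0" using assms(2) P by auto
  then show ?thesis using poly_roots_finite[of P] by (simp add: P)
qed

lemma upoly_zero:
  assumes "upoly h" "infinite A" "\<And>s. s \<in> A \<Longrightarrow> h s = 0" shows "h s = 0"
  using upoly_finite_zeros[OF assms(1), of s] assms(2,3) finite_subset[of A "{s. h s = 0}"] by blast

lemma infinite_nonzero_reals: "infinite {s::real. s \<noteq> 0}"
proof -
  have "{s::real. s \<noteq> 0} = UNIV - {0}" by auto
  then show ?thesis by (simp add: infinite_UNIV_char_0)
qed

lemma upoly_sum_powers_zero:
  fixes c :: "nat \<Rightarrow> real"
  assumes "infinite A" "\<And>s. s \<in> A \<Longrightarrow> (\<Sum>k<N. c k * s ^ k) = 0" "k < N"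
  shows "c k = 0"
proof (rule ccontr)
  assume "c k \<noteq> 0"
  moreover have N: "{..N - 1} = {..<N}" using assms(3) by auto
  ultimately have "finite {s. (\<Sum>i\<le>N - 1. c i * s ^ i) = 0}"
    using polyfun_finite_roots[of c "N - 1"] N assms(3) by auto
  moreover have "A \<subseteq> {s. (\<Sum>i\<le>N - 1. c i * s ^ i) = 0}" using assms(2) N by auto
  ultimately show False using assms(1) finite_subset by blast
qed

text \<open>Restriction to a line reduces this to one variable: on the line through a point where \<open>p\<close> is
  nonzero and a point where \<open>q\<close> is nonzero, each of them has only finitely many zeros.\<close>

lemma polys_integral:
  assumes p: "p \<in> polys n" and q: "q \<in> polys n" and pq: "\<And>x. p x * q x = 0"
  shows "(\<forall>x. p x = 0) \<or> (\<forall>x. q x = 0)"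
proof (rule ccontr)
  assume "\<not> ?thesis"
  then obtain a b where a: "p a \<noteq> 0" and b: "q b \<noteq> 0" by auto
  define c where "c s = (\<lambda>i. a i + s * (b i - a i))" for s :: real
  have c: "upoly (\<lambda>s. c s i)" for i
    unfolding c_def by (intro upoly_add upoly_mult upoly_const upoly_id)
  have "c 0 = a" "c 1 = b" by (auto simp: c_def)
  then have "finite {s. p (c s) = 0}" "finite {s. q (c s) = 0}"
    using upoly_finite_zeros[OF upoly_polys[OF p c], of 0] a
      upoly_finite_zeros[OF upoly_polys[OF q c], of 1] b by auto
  then have "finite ({s. p (c s) = 0} \<union> {s. q (c s) = 0})" by blast
  moreover have "{s. p (c s) = 0} \<union> {s. q (c s) = 0} = UNIV" using pq by auto
  ultimately show False using infinite_UNIV_char_0[where ?'a = real] by metis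
qed

lemma polys_zero_off_hyperplane:
  assumes p: "p \<in> polys n" and i: "i < n" and z: "\<And>x. x i \<noteq> 0 \<Longrightarrow> p x = 0"
  shows "p x = 0"
proof -
  have "(\<forall>x. p x = 0) \<or> (\<forall>x :: point. x i = 0)"
    by (rule polys_integral[OF p polys.var[OF i]]) (use z in auto)
  then show ?thesis
  proof
    assume "\<forall>x :: point. x i = 0"
    from spec[OF this, of "\<lambda>_. 1"] show ?thesis by simp
  qed simp
qed

lemma polys_tendsto:
  "p \<in> polys n \<Longrightarrow> (\<And>i. i < n \<Longrightarrow> ((\<lambda>s. c s i) \<longlongrightarrow> w i) F) \<Longrightarrow> ((\<lambda>s. p (c s)) \<longlongrightarrow> p w) F"
  by (induction rule: polys.induct) (auto intro: tendsto_intros)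


section \<open>Gradients\<close>

text \<open>The chain rule is stated along arbitrary curves because velocities of orbits are given as
  derivatives along curves; by induction on polynomials this needs no multivariate calculus.\<close>

lemma polys_has_gradient:
  "p \<in> polys n \<Longrightarrow> \<exists>d. (\<forall>i<n. d i \<in> polys n) \<and>
    (\<forall>c w s0. (\<forall>i<n. ((\<lambda>s. c s i) has_real_derivative w i) (at s0)) \<longrightarrow>
      ((\<lambda>s. p (c s)) has_real_derivative (\<Sum>i<n. w i * d i (c s0))) (at s0))"
proof (induction rule: polys.induct)
  case (const c)
  show ?case by (rule exI[of _ "\<lambda>i x. 0"]) (auto intro: polys_intros)
next
  case (var j)
  show ?case
    by (rule exI[of _ "\<lambda>i x. if i = j then 1 else 0"])
      (use var in \<open>auto intro: polys_intros simp: if_distrib cong: if_cong\<close>)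
next
  case (add p q)
  then obtain d e where de: "\<forall>i<n. d i \<in> polys n" "\<forall>i<n. e i \<in> polys n" and
    d: "\<And>c w s0. (\<forall>i<n. ((\<lambda>s. c s i) has_real_derivative w i) (at s0)) \<Longrightarrow>
      ((\<lambda>s. p (c s)) has_real_derivative (\<Sum>i<n. w i * d i (c s0))) (at s0)" and
    e: "\<And>c w s0. (\<forall>i<n. ((\<lambda>s. c s i) has_real_derivative w i) (at s0)) \<Longrightarrow>
      ((\<lambda>s. q (c s)) has_real_derivative (\<Sum>i<n. w i * e i (c s0))) (at s0)"
    by blast
  show ?case
  proof (intro exI[of _ "\<lambda>i x. d i x + e i x"] conjI allI impI)
    show "(\<lambda>x. d i x + e i x) \<in> polys n" if "i < n" for i using de that by (simp add: polys_add)
  next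
    fix c :: "real \<Rightarrow> point" and w s0
    assume "\<forall>i<n. ((\<lambda>s. c s i) has_real_derivative w i) (at s0)"
    from DERIV_add[OF d[OF this] e[OF this]]
    show "((\<lambda>s. (p + q) (c s)) has_real_derivative (\<Sum>i<n. w i * (d i (c s0) + e i (c s0)))) (at s0)"
      by (simp add: sum.distrib distrib_left)
  qed
next
  case (mult p q)
  then obtain d e where de: "\<forall>i<n. d i \<in> polys n" "\<forall>i<n. e i \<in> polys n" and
    d: "\<And>c w s0. (\<forall>i<n. ((\<lambda>s. c s i) has_real_derivative w i) (at s0)) \<Longrightarrow>
      ((\<lambda>s. p (c s)) has_real_derivative (\<Sum>i<n. w i * d i (c s0))) (at s0)" and
    e: "\<And>c w s0. (\<forall>i<n. ((\<lambda>s. c s i) has_real_derivative w i) (at s0)) \<Longrightarrow>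
      ((\<lambda>s. q (c s)) has_real_derivative (\<Sum>i<n. w i * e i (c s0))) (at s0)"
    by blast
  show ?case
  proof (intro exI[of _ "\<lambda>i x. d i x * q x + e i x * p x"] conjI allI impI)
    show "(\<lambda>x. d i x * q x + e i x * p x) \<in> polys n" if "i < n" for i
      using de that mult.hyps by (simp add: polys_add polys_mult)
  next
    fix c :: "real \<Rightarrow> point" and w s0
    assume "\<forall>i<n. ((\<lambda>s. c s i) has_real_derivative w i) (at s0)"
    from DERIV_mult[OF d[OF this] e[OF this]]
    show "((\<lambda>s. (p * q) (c s)) has_real_derivative
        (\<Sum>i<n. w i * (d i (c s0) * q (c s0) + e i (c s0) * p (c s0)))) (at s0)"
      by (simp add: sum.distrib distrib_left sum_distrib_right mult.assoc)
  qed
qed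

definition grad :: "nat \<Rightarrow> (point \<Rightarrow> real) \<Rightarrow> nat \<Rightarrow> point \<Rightarrow> real"
  where "grad n p = (SOME d. (\<forall>i<n. d i \<in> polys n) \<and>
    (\<forall>c w s0. (\<forall>i<n. ((\<lambda>s. c s i) has_real_derivative w i) (at s0)) \<longrightarrow>
      ((\<lambda>s. p (c s)) has_real_derivative (\<Sum>i<n. w i * d i (c s0))) (at s0)))"

lemma grad_polys: "p \<in> polys n \<Longrightarrow> i < n \<Longrightarrow> grad n p i \<in> polys n"
  using someI_ex[OF polys_has_gradient] unfolding grad_def by blast

lemma grad_chain:
  assumes "p \<in> polys n" "\<And>i. i < n \<Longrightarrow> ((\<lambda>s. c s i) has_real_derivative w i) (at s0)"
  shows "((\<lambda>s. p (c s)) has_real_derivative (\<Sum>i<n. w i * grad n p i (c s0))) (at s0)"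
  using someI_ex[OF polys_has_gradient[OF assms(1)]] assms(2) unfolding grad_def by blast

text \<open>The differential of \<open>p\<close> at \<open>x\<close>, applied to \<open>w\<close>; only the first \<open>n\<close> coordinates of \<open>w\<close> matter.\<close>

definition dpoly :: "nat \<Rightarrow> (point \<Rightarrow> real) \<Rightarrow> point \<Rightarrow> point \<Rightarrow> real"
  where "dpoly n p x w = (\<Sum>i<n. w i * grad n p i x)"

lemma dpoly_chain:
  assumes "p \<in> polys n" "\<And>i. i < n \<Longrightarrow> ((\<lambda>s. c s i) has_real_derivative w i) (at s0)"
  shows "((\<lambda>s. p (c s)) has_real_derivative dpoly n p (c s0) w) (at s0)"
  unfolding dpoly_def by (rule grad_chain) (use assms in auto)

lemma dpoly_line:
  assumes "p \<in> polys n"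
  shows "((\<lambda>s. p (x + s *\<^sub>R w)) has_real_derivative dpoly n p x w) (at 0)"
proof -
  have "((\<lambda>s. (x + s *\<^sub>R w) i) has_real_derivative w i) (at 0)" for i
    by (auto simp: scaleR_fun_def intro!: derivative_eq_intros)
  then show ?thesis using dpoly_chain[OF assms, of "\<lambda>s. x + s *\<^sub>R w" w 0] by simp
qed

lemma dpoly_line_unique:
  assumes "p \<in> polys n" "((\<lambda>s. p (x + s *\<^sub>R w)) has_real_derivative D) (at 0)"
  shows "dpoly n p x w = D"
  using DERIV_unique[OF dpoly_line[OF assms(1)] assms(2)] .

lemma dpoly_add_poly:
  assumes "p \<in> polys n" "q \<in> polys n"
  shows "dpoly n (\<lambda>x. p x + q x) x w = dpoly n p x w + dpoly n q x w"
  by (rule dpoly_line_unique) (auto intro!: assms polys_intros derivative_eq_intros dpoly_line)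

lemma dpoly_mult_poly:
  assumes "p \<in> polys n" "q \<in> polys n"
  shows "dpoly n (\<lambda>x. p x * q x) x w = dpoly n p x w * q x + p x * dpoly n q x w"
  by (rule dpoly_line_unique)
    (use assms in \<open>auto intro!: polys_intros derivative_eq_intros dpoly_line\<close>)

lemma dpoly_const: "dpoly n (\<lambda>x. c) x w = 0"
  by (rule dpoly_line_unique) (auto intro: polys_intros)

lemma dpoly_var: "i < n \<Longrightarrow> dpoly n (\<lambda>x. x i) x w = w i"
  by (rule dpoly_line_unique)
    (auto intro!: polys_intros derivative_eq_intros simp: scaleR_fun_def)

lemma dpoly_diff_poly:
  assumes "p \<in> polys n" "q \<in> polys n"
  shows "dpoly n (\<lambda>x. p x - q x) x w = dpoly n p x w - dpoly n q x w"
  by (rule dpoly_line_unique) (auto intro!: assms polys_intros derivative_eq_intros dpoly_line)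

lemma dpoly_lin:
  "dpoly n p x (v + w) = dpoly n p x v + dpoly n p x w"
  "dpoly n p x (c *\<^sub>R v) = c * dpoly n p x v"
  "dpoly n p x 0 = 0"
  by (simp_all add: dpoly_def scaleR_fun_def distrib_right sum.distrib sum_distrib_left mult.assoc)

lemma dpoly_cong: "(\<And>i. i < n \<Longrightarrow> v i = w i) \<Longrightarrow> dpoly n p x v = dpoly n p x w"
  by (simp add: dpoly_def)

lemma dpoly_mono:
  assumes "p \<in> polys m" "m \<le> n"
  shows "dpoly n p x w = dpoly m p x w"
  by (rule dpoly_line_unique) (use assms in \<open>auto intro: polys_mono dpoly_line\<close>)

lemma dpoly_base_cong:
  assumes "p \<in> polys n" "\<And>i. i < n \<Longrightarrow> x i = y i"
  shows "dpoly n p x w = dpoly n p y w"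
proof (rule dpoly_line_unique[OF assms(1)])
  have "p (x + s *\<^sub>R w) = p (y + s *\<^sub>R w)" for s
    by (rule polys_cong[OF assms(1)]) (simp add: assms(2) scaleR_fun_def)
  then show "((\<lambda>s. p (x + s *\<^sub>R w)) has_real_derivative dpoly n p y w) (at 0)"
    using dpoly_line[OF assms(1), of y w] by simp
qed

lemma dpoly_subst:
  assumes p: "p \<in> polys k" and g: "\<And>j. j < k \<Longrightarrow> (\<lambda>x. g x j) \<in> polys n"
  shows "dpoly n (\<lambda>x. p (g x)) x w = dpoly k p (g x) (\<lambda>j. dpoly n (\<lambda>x. g x j) x w)"
proof (rule dpoly_line_unique[OF polys_subst[OF p g]])
  have "((\<lambda>s. g (x + s *\<^sub>R w) j) has_real_derivative dpoly n (\<lambda>x. g x j) x w) (at 0)" if "j < k" for j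
    by (rule dpoly_line[OF g[OF that]])
  then show "((\<lambda>s. p (g (x + s *\<^sub>R w))) has_real_derivative
      dpoly k p (g x) (\<lambda>j. dpoly n (\<lambda>x. g x j) x w)) (at 0)"
    using dpoly_chain[OF p, of "\<lambda>s. g (x + s *\<^sub>R w)" "\<lambda>j. dpoly n (\<lambda>x. g x j) x w" 0] by simp
qed


section \<open>Expansions of polynomials\<close>

text \<open>Multiplication by a polynomial preserves the functions that are polynomials in the last
  variable with coefficients in the others; applied to the function \<open>1\<close> this gives the expansion.
  In this form the product case of the induction is just associativity.\<close>

lemma polys_expand_last_aux:
  assumes "p \<in> polys (Suc n)"
  shows "(\<And>k. a k \<in> polys n) \<Longrightarrow> \<exists>N c. (\<forall>k. c k \<in> polys n) \<and>
    (\<forall>x. p x * (\<Sum>k<M. a k x * x n ^ k) = (\<Sum>k<(N::nat). c k x * x n ^ k))"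
  using assms
proof (induction arbitrary: a M rule: polys.induct)
  case (const c)
  show ?case
    by (rule exI[of _ M], rule exI[of _ "\<lambda>k x. c * a k x"])
      (auto intro!: polys_intros const simp: sum_distrib_left ac_simps)
next
  case (var i)
  show ?case
  proof (cases "i = n")
    case True
    show ?thesis
      by (rule exI[of _ "Suc M"], rule exI[of _ "\<lambda>k. case k of 0 \<Rightarrow> (\<lambda>x. 0) | Suc k \<Rightarrow> a k"])
        (use True var in \<open>auto intro!: polys_intros split: nat.split
          simp: sum_distrib_left ac_simps sum.lessThan_Suc_shift simp del: sum.lessThan_Suc\<close>)
  next
    case False
    show ?thesis
      by (rule exI[of _ M], rule exI[of _ "\<lambda>k x. x i * a k x"])
        (use False var in \<open>auto intro!: polys_intros simp: sum_distrib_left ac_simps\<close>)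
  qed
next
  case (add p q)
  obtain N c N' c' where 1: "\<forall>k. c k \<in> polys n" "\<forall>k. c' k \<in> polys n"
    "\<forall>x. p x * (\<Sum>k<M. a k x * x n ^ k) = (\<Sum>k<(N::nat). c k x * x n ^ k)"
    "\<forall>x. q x * (\<Sum>k<M. a k x * x n ^ k) = (\<Sum>k<(N'::nat). c' k x * x n ^ k)"
    using add.IH(1)[of a M, OF add.prems] add.IH(2)[of a M, OF add.prems] by blast
  define b b' where "b k = (if k < N then c k else (\<lambda>x. 0))" and
    "b' k = (if k < N' then c' k else (\<lambda>x. 0))" for k
  have "(\<Sum>k<N. c k x * x n ^ k) = (\<Sum>k<max N N'. b k x * x n ^ k)"
    "(\<Sum>k<N'. c' k x * x n ^ k) = (\<Sum>k<max N N'. b' k x * x n ^ k)" for x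
    by (rule sum.mono_neutral_cong_left; auto simp: b_def b'_def)+
  then show ?case using 1
    by (intro exI[of _ "max N N'"] exI[of _ "\<lambda>k x. b k x + b' k x"])
      (auto intro!: polys_intros simp: b_def b'_def sum.distrib distrib_right)
next
  case (mult p q)
  obtain N c where 1: "\<And>k. c k \<in> polys n"
    "\<And>x. q x * (\<Sum>k<M. a k x * x n ^ k) = (\<Sum>k<(N::nat). c k x * x n ^ k)"
    using mult.IH(2)[of a M, OF mult.prems] by metis
  show ?case using mult.IH(1)[of c N, OF 1(1)] by (simp add: mult.assoc 1(2))
qed

lemma polys_expand_last:
  assumes "p \<in> polys (Suc n)"
  shows "\<exists>N c. (\<forall>k. c k \<in> polys n) \<and> (\<forall>x. p x = (\<Sum>k<(N::nat). c k x * x n ^ k))"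
  using polys_expand_last_aux[OF assms, of "\<lambda>k x. 1" 1] polys.const[of 1 n] by simp

text \<open>The homogeneous parts are the coefficients of the scaling parameter, taken as an additional
  variable.\<close>

lemma polys_homogeneous_parts:
  "p \<in> polys n \<Longrightarrow> \<exists>N c. (\<forall>k. c k \<in> polys n) \<and>
    (\<forall>x s. p (\<lambda>i. s * x i) = (\<Sum>k<(N::nat). c k x * s ^ k))"
proof -
  assume p: "p \<in> polys n"
  have "(\<lambda>x. p (\<lambda>i. x n * x i)) \<in> polys (Suc n)"
    by (rule polys_subst[OF p]) (intro polys_mult polys.var, auto)
  from polys_expand_last[OF this] obtain N c where c: "\<And>k. c k \<in> polys n"
    "\<And>x. p (\<lambda>i. x n * x i) = (\<Sum>k<(N::nat). c k x * x n ^ k)" by metis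
  have "p (\<lambda>i. s * x i) = (\<Sum>k<N. c k x * s ^ k)" for x s
  proof -
    have "p (\<lambda>i. s * x i) = p (\<lambda>i. (x(n := s)) n * (x(n := s)) i)"
      by (rule polys_cong[OF p]) auto
    also have "\<dots> = (\<Sum>k<N. c k (x(n := s)) * s ^ k)" by (simp add: c(2) del: fun_upd_apply) simp
    also have "\<dots> = (\<Sum>k<N. c k x * s ^ k)"
      by (intro sum.cong refl arg_cong2[of _ _ _ _ "(*)"] polys_cong[OF c(1)]) auto
    finally show ?thesis .
  qed
  with c(1) show ?thesis by blast
qed

lemma lowest_nonzero_coefficient:
  fixes c :: "nat \<Rightarrow> 'a \<Rightarrow> real"
  assumes "\<exists>k<N. \<exists>x. c k x \<noteq> 0"
  shows "\<exists>e<N. (\<exists>x. c e x \<noteq> 0) \<and> (\<forall>k<e. \<forall>x. c k x = 0)"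
proof -
  define e where "e = (LEAST k. \<exists>x. c k x \<noteq> 0)"
  obtain k where k: "k < N" "\<exists>x. c k x \<noteq> 0" using assms by blast
  have "\<exists>x. c e x \<noteq> 0" unfolding e_def by (rule LeastI[of _ k]) (rule k)
  moreover have "e \<le> k" unfolding e_def by (rule Least_le) (rule k)
  moreover have "\<forall>x. c k x = 0" if "k < e" for k using not_less_Least[OF that[unfolded e_def]] by blast
  ultimately show ?thesis using k(1) by (intro exI[of _ e]) simp
qed

text \<open>A polynomial relation between functions with independent first order terms is trivial:
  its homogeneous part of lowest degree would be the leading term along every line.\<close>

lemma no_relation_first_order:
  assumes P: "P \<in> polys d"
    and G: "\<And>t i. i < d \<Longrightarrow> ((\<lambda>s. G t s i / s) \<longlongrightarrow> t i) (at (0::real))"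
    and z: "\<And>t s. P (G t s) = 0"
  shows "P x = 0"
proof (rule ccontr)
  assume nz: "P x \<noteq> 0"
  obtain N c where c: "\<And>k. c k \<in> polys d" "\<And>x s. P (\<lambda>i. s * x i) = (\<Sum>k<(N::nat). c k x * s ^ k)"
    using polys_homogeneous_parts[OF P] by blast
  have "\<exists>k<N. \<exists>x. c k x \<noteq> 0"
  proof (rule ccontr)
    assume "\<not> ?thesis"
    then have "P x = 0" using c(2)[of 1 x] by simp
    with nz show False by blast
  qed
  then obtain e where e: "e < N" "\<exists>x. c e x \<noteq> 0" and below: "\<And>k x. k < e \<Longrightarrow> c k x = 0"
    using lowest_nonzero_coefficient[of N c] by blast
  have "c e t = 0" for t
  proof -
    \<comment> \<open>Divide the relation by \<open>s\<^sup>e\<close>; in the limit \<open>s \<rightarrow> 0\<close> only the part of degree \<open>e\<close> is left,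
      evaluated at the first order terms.\<close>
    have "(\<Sum>k\<in>{e..<N}. c k (\<lambda>i. G t s i / s) * s ^ (k - e)) = 0" if "s \<noteq> 0" for s
    proof -
      have "(\<lambda>i. s * (G t s i / s)) = G t s" using that by auto
      then have "0 = (\<Sum>k<N. c k (\<lambda>i. G t s i / s) * s ^ k)" using c(2)[of s "\<lambda>i. G t s i / s"] z by simp
      also have "\<dots> = (\<Sum>k\<in>{e..<N}. c k (\<lambda>i. G t s i / s) * s ^ k)"
        by (rule sum.mono_neutral_right) (auto simp: below)
      also have "\<dots> = s ^ e * (\<Sum>k\<in>{e..<N}. c k (\<lambda>i. G t s i / s) * s ^ (k - e))"
        by (auto simp: sum_distrib_left power_add[symmetric] intro!: sum.cong)
      finally show ?thesis using that by simp
    qed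
    then have "\<forall>\<^sub>F s in at 0. (\<Sum>k\<in>{e..<N}. c k (\<lambda>i. G t s i / s) * s ^ (k - e)) = 0"
      by (auto simp: eventually_at_filter)
    then have "((\<lambda>s. \<Sum>k\<in>{e..<N}. c k (\<lambda>i. G t s i / s) * s ^ (k - e)) \<longlongrightarrow> 0) (at 0)"
      by (simp add: tendsto_eventually)
    moreover have "((\<lambda>s. \<Sum>k\<in>{e..<N}. c k (\<lambda>i. G t s i / s) * s ^ (k - e))
        \<longlongrightarrow> (\<Sum>k\<in>{e..<N}. c k t * 0 ^ (k - e))) (at 0)"
      by (intro tendsto_intros polys_tendsto[OF c(1)] G)
    ultimately have "(\<Sum>k\<in>{e..<N}. c k t * 0 ^ (k - e)) = 0"
      by (intro tendsto_unique[of "at (0::real)"]) auto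
    moreover have "(\<Sum>k\<in>{e..<N}. c k t * 0 ^ (k - e)) = (\<Sum>k\<in>{e}. c k t * 0 ^ (k - e))"
      by (rule sum.mono_neutral_right) (use e in auto)
    ultimately show ?thesis by simp
  qed
  with e show False by blast
qed

section \<open>Algebraic dependence of many polynomials in few variables\<close>

definition monomials :: "nat \<Rightarrow> nat \<Rightarrow> (point \<Rightarrow> real) set"
  where "monomials n M = (\<lambda>\<beta> x. \<Prod>i<n. x i ^ \<beta> i) ` ({..<n} \<rightarrow>\<^sub>E {..M})"

lemma finite_monomials: "finite (monomials n M)"
  unfolding monomials_def by (intro finite_imageI finite_PiE) auto

lemma card_monomials: "card (monomials n M) \<le> (M + 1) ^ n"
proof -
  have "card (monomials n M) \<le> card ({..<n} \<rightarrow>\<^sub>E {..M})"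
    unfolding monomials_def by (intro card_image_le finite_PiE) auto
  then show ?thesis by (simp add: card_PiE)
qed

lemma monomials_mono: "M \<le> M' \<Longrightarrow> monomials n M \<subseteq> monomials n M'"
  unfolding monomials_def by (intro image_mono PiE_mono) auto

lemma monomialsI:
  assumes "\<And>i. i < n \<Longrightarrow> \<beta> i \<le> M" "\<And>x. p x = (\<Prod>i<n. x i ^ \<beta> i)"
  shows "p \<in> monomials n M"
proof -
  have "p = (\<lambda>\<beta> x. \<Prod>i<n. x i ^ \<beta> i) (restrict \<beta> {..<n})" by (auto simp: assms(2))
  moreover have "restrict \<beta> {..<n} \<in> {..<n} \<rightarrow>\<^sub>E {..M}" using assms(1) by auto
  ultimately show ?thesis unfolding monomials_def by blast
qed

lemma monomials_mult:
  assumes "p \<in> monomials n a" "q \<in> monomials n b" shows "(\<lambda>x. p x * q x) \<in> monomials n (a + b)"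
proof -
  obtain \<beta> \<gamma> where 1: "\<beta> \<in> {..<n} \<rightarrow>\<^sub>E {..a}" "\<gamma> \<in> {..<n} \<rightarrow>\<^sub>E {..b}"
    "p = (\<lambda>x. \<Prod>i<n. x i ^ \<beta> i)" "q = (\<lambda>x. \<Prod>i<n. x i ^ \<gamma> i)"
    using assms unfolding monomials_def by blast
  then have "\<beta> i + \<gamma> i \<le> a + b" if "i < n" for i
    using that PiE_mem[OF 1(1), of i] PiE_mem[OF 1(2), of i] by auto
  then show ?thesis
    by (rule monomialsI[of n "\<lambda>i. \<beta> i + \<gamma> i"]) (auto simp: 1 power_add prod.distrib)
qed

lemma subspace_multiplier:
  assumes "subspace U" shows "subspace {q :: 'a \<Rightarrow> real. (\<lambda>x. p x * q x) \<in> U}"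
  unfolding subspace_def
proof (intro conjI allI ballI; unfold mem_Collect_eq)
  show "(\<lambda>x. p x * 0 x) \<in> U" using subspace_0[OF assms] by (simp add: zero_fun_def)
next
  fix q r assume "(\<lambda>x. p x * q x) \<in> U" "(\<lambda>x. p x * r x) \<in> U"
  from subspace_add[OF assms this] show "(\<lambda>x. p x * (q + r) x) \<in> U"
    by (simp add: plus_fun_def distrib_left)
next
  fix c q assume "(\<lambda>x. p x * q x) \<in> U"
  from subspace_scale[OF assms this, of c] show "(\<lambda>x. p x * (c *\<^sub>R q) x) \<in> U"
    by (simp add: scaleR_fun_def ac_simps)
qed

lemma span_monomials_mult:
  assumes p: "p \<in> span (monomials n a)" and q: "q \<in> span (monomials n b)"
  shows "(\<lambda>x. p x * q x) \<in> span (monomials n (a + b))"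
proof -
  have "(\<lambda>x. m x * q x) \<in> span (monomials n (a + b))" if "m \<in> monomials n a" for m
    using span_induct[OF q subspace_multiplier[OF subspace_span]] monomials_mult[OF that] span_base by blast
  then have "(\<lambda>x. q x * p x) \<in> span (monomials n (a + b))"
    using span_induct[OF p subspace_multiplier[OF subspace_span], of q] by (simp add: mult.commute)
  then show ?thesis by (simp add: mult.commute)
qed

lemma span_monomials_mono: "p \<in> span (monomials n M) \<Longrightarrow> M \<le> M' \<Longrightarrow> p \<in> span (monomials n M')"
  using span_mono[OF monomials_mono] by blast

lemma span_monomials_const: "(\<lambda>x. c) \<in> span (monomials n M)"
proof -
  have "(\<lambda>x. 1) \<in> monomials n M" by (rule monomialsI[of n "\<lambda>i. 0"]) auto
  then have "c *\<^sub>R (\<lambda>x. 1) \<in> span (monomials n M)" by (intro span_scale span_base)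
  then show ?thesis by (simp add: scaleR_fun_def)
qed

lemma polys_span_monomials: "p \<in> polys n \<Longrightarrow> \<exists>M. p \<in> span (monomials n M)"
proof (induction rule: polys.induct)
  case (const c)
  then show ?case using span_monomials_const by blast
next
  case (var i)
  have "(\<lambda>x. x i) \<in> monomials n 1"
    by (rule monomialsI[of n "\<lambda>j. if j = i then 1 else 0"])
      (use var in \<open>auto simp: if_distrib cong: if_cong\<close>)
  then show ?case using span_base by blast
next
  case (add p q)
  then obtain M M' where "p \<in> span (monomials n M)" "q \<in> span (monomials n M')" by blast
  then have "p + q \<in> span (monomials n (max M M'))"
    by (intro span_add) (auto elim: span_monomials_mono)
  then show ?case by blast
next
  case (mult p q)
  then obtain M M' where "p \<in> span (monomials n M)" "q \<in> span (monomials n M')" by blast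
  from span_monomials_mult[OF this] show ?case by (auto simp: times_fun_def)
qed

lemma span_monomials_diff_scale:
  assumes "p \<in> span (monomials n M)" "q \<in> span (monomials n M)"
  shows "(\<lambda>x. p x - c * q x) \<in> span (monomials n M)"
proof -
  have "p - c *\<^sub>R q \<in> span (monomials n M)" by (intro span_diff span_scale assms)
  then show ?thesis by (simp add: scaleR_fun_def fun_diff_def)
qed

lemma span_monomials_prod:
  assumes "finite A" "\<And>i. i \<in> A \<Longrightarrow> p i \<in> span (monomials n e)"
  shows "(\<lambda>x. \<Prod>i\<in>A. p i x) \<in> span (monomials n (card A * e))"
  using assms
proof (induction rule: finite_induct)
  case empty
  then show ?case using span_monomials_const by simp
next
  case (insert i A)
  then have "(\<lambda>x. p i x * (\<Prod>i\<in>A. p i x)) \<in> span (monomials n (e + card A * e))"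
    by (intro span_monomials_mult) auto
  then show ?case using insert by simp
qed

lemma nontrivial_relation:
  fixes W :: "'a \<Rightarrow> 'b :: real_vector"
  assumes "finite A" "finite S" "card S < card A" "\<And>a. a \<in> A \<Longrightarrow> W a \<in> span S"
  shows "\<exists>c. (\<exists>a\<in>A. c a \<noteq> 0) \<and> (\<Sum>a\<in>A. c a *\<^sub>R W a) = 0"
proof (cases "inj_on W A")
  case True
  have "dependent (W ` A)"
  proof (rule ccontr)
    assume "\<not> dependent (W ` A)"
    then have "card (W ` A) \<le> card S"
      using independent_span_bound[OF assms(2), of "W ` A"] assms(4) by auto
    then show False using True assms(3) by (simp add: card_image)
  qed
  then obtain u where u: "\<exists>v\<in>W ` A. u v \<noteq> 0" "(\<Sum>v\<in>W ` A. u v *\<^sub>R v) = 0"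
    using dependent_finite[of "W ` A"] assms(1) by auto
  then show ?thesis
    by (intro exI[of _ "u \<circ> W"]) (auto simp: sum.reindex[OF True])
next
  case False
  then obtain a b where ab: "a \<in> A" "b \<in> A" "a \<noteq> b" "W a = W b" by (auto simp: inj_on_def)
  define c where "c = (\<lambda>x. if x = a then 1 else if x = b then - 1 else (0::real))"
  have "(\<Sum>x\<in>A. c x *\<^sub>R W x) = (\<Sum>x\<in>{a, b}. c x *\<^sub>R W x)"
    by (rule sum.mono_neutral_right) (use assms(1) ab in \<open>auto simp: c_def\<close>)
  also have "\<dots> = 0" using ab by (simp add: c_def)
  finally show ?thesis using ab by (intro exI[of _ c]) (auto simp: c_def)
qed

text \<open>A dimension count: on the grid \<open>{0..m}\<^sup>k\<close> there are \<open>(m + 1)\<^sup>k\<close> independent Lagrange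
  polynomials, while their compositions with \<open>k\<close> rational functions in \<open>n\<close> variables, cleared of
  denominators, live in a space of dimension \<open>O(m\<^sup>n)\<close>.\<close>

lemma algebraic_dependence:
  assumes kn: "n < k" and G: "\<And>j. j < k \<Longrightarrow> G j \<in> polys n" and q: "q \<in> polys n"
  obtains P where "P \<in> polys k" "\<exists>x. P x \<noteq> 0" "\<And>x. q x \<noteq> 0 \<Longrightarrow> P (\<lambda>j. G j x / q x) = 0"
proof -
  have "\<exists>e. q \<in> span (monomials n e) \<and> (\<forall>j<k. G j \<in> span (monomials n e))"
  proof -
    have "\<forall>j. \<exists>M. j < k \<longrightarrow> G j \<in> span (monomials n M)" using polys_span_monomials[OF G] by blast
    then obtain E where E: "\<And>j. j < k \<Longrightarrow> G j \<in> span (monomials n (E j))" by metis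
    obtain E' where "q \<in> span (monomials n E')" using polys_span_monomials[OF q] by blast
    moreover have "E j \<le> (\<Sum>j<k. E j)" if "j < k" for j
      using that by (intro member_le_sum) auto
    ultimately show ?thesis
      by (intro exI[of _ "E' + (\<Sum>j<k. E j)"]) (auto intro: span_monomials_mono E trans_le_add2)
  qed
  then obtain e where e: "q \<in> span (monomials n e)" "\<And>j. j < k \<Longrightarrow> G j \<in> span (monomials n e)" by blast
  \<comment> \<open>With \<open>m\<close> this large, \<open>(m + 1)\<^sup>k\<close> exceeds \<open>(kme + 1)\<^sup>n\<close>.\<close>
  define m where "m = (k * e + 1) ^ n"
  define A where "A = ({..<k} \<rightarrow>\<^sub>E {..m})"
  have finA: "finite A" unfolding A_def by (intro finite_PiE) auto
  define W where "W a x = (\<Prod>i<k. \<Prod>j\<in>{..m} - {a i}. G i x - real j * q x)" for a x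
  define L :: "(nat \<Rightarrow> nat) \<Rightarrow> point \<Rightarrow> real" where "L a x = (\<Prod>i<k. \<Prod>j\<in>{..m} - {a i}. x i - real j)" for a x
  have cm: "card ({..m} - {a i}) = m" if "a \<in> A" "i < k" for a i
    using PiE_mem[OF that(1)[unfolded A_def], of i] that(2) by simp
  have W: "W a \<in> span (monomials n (k * (m * e)))" if "a \<in> A" for a
  proof -
    have "(\<lambda>x. \<Prod>i<k. \<Prod>j\<in>{..m} - {a i}. G i x - real j * q x) \<in> span (monomials n (card {..<k} * (m * e)))"
    proof (rule span_monomials_prod)
      fix i assume "i \<in> {..<k}"
      then have i: "i < k" by simp
      have "(\<lambda>x. \<Prod>j\<in>{..m} - {a i}. G i x - real j * q x) \<in> span (monomials n (card ({..m} - {a i}) * e))"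
        by (rule span_monomials_prod) (auto intro: span_monomials_diff_scale e i)
      then show "(\<lambda>x. \<Prod>j\<in>{..m} - {a i}. G i x - real j * q x) \<in> span (monomials n (m * e))"
        by (simp only: cm[OF that i])
    qed auto
    then show ?thesis by (simp add: W_def[abs_def])
  qed
  have "card (monomials n (k * (m * e))) < card A"
  proof -
    have "card (monomials n (k * (m * e))) \<le> (k * (m * e) + 1) ^ n" by (rule card_monomials)
    also have "\<dots> \<le> ((k * e + 1) * (m + 1)) ^ n" by (intro power_mono) (auto simp: algebra_simps)
    also have "\<dots> = m * (m + 1) ^ n" by (simp only: power_mult_distrib m_def[symmetric])
    also have "\<dots> < (m + 1) ^ Suc n" by simp
    also have "\<dots> \<le> (m + 1) ^ k" by (rule power_increasing) (use kn in auto)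
    also have "\<dots> = card A" by (simp add: A_def card_PiE)
    finally show ?thesis .
  qed
  then have "\<exists>c. (\<exists>a\<in>A. c a \<noteq> 0) \<and> (\<Sum>a\<in>A. c a *\<^sub>R W a) = 0"
    by (rule nontrivial_relation[OF finA finite_monomials]) (rule W)
  then obtain c b where
    b: "b \<in> A" "c b \<noteq> 0" and c: "(\<Sum>a\<in>A. c a *\<^sub>R W a) = 0" by blast
  define P where "P x = (\<Sum>a\<in>A. c a * L a x)" for x
  have sum_apply: "(\<Sum>a\<in>B. c a *\<^sub>R W a) x = (\<Sum>a\<in>B. c a * W a x)" for B x
    by (induction B rule: infinite_finite_induct) (auto simp: scaleR_fun_def)
  show ?thesis
  proof (rule that[of P])
    show "P \<in> polys k" unfolding P_def[abs_def] L_def by (intro polys_intros) auto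
  next
    have "L a (\<lambda>i. real (b i)) = 0" if a: "a \<in> A" and ab: "a \<noteq> b" for a
    proof -
      obtain i where i: "i < k" "a i \<noteq> b i" using PiE_ext[of a "{..<k}" "\<lambda>_. {..m}" b] a b ab
        unfolding A_def by auto
      moreover have "b i \<le> m" using PiE_mem[OF b(1)[unfolded A_def], of i] i by simp
      ultimately have "(\<Prod>j\<in>{..m} - {a i}. real (b i) - real j) = 0"
        by (intro prod_zero bexI[of _ "b i"]) auto
      then show ?thesis unfolding L_def using i(1)
        by - (rule prod_zero[OF _ bexI[of _ i]], simp_all)
    qed
    then have "P (\<lambda>i. real (b i)) = (\<Sum>a\<in>{b}. c a * L a (\<lambda>i. real (b i)))"
      unfolding P_def by (intro sum.mono_neutral_right) (use finA b in auto)
    also have "\<dots> \<noteq> 0" using b(2) by (auto simp: L_def)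
    finally show "\<exists>x. P x \<noteq> 0" by blast
  next
    fix x assume qx: "q x \<noteq> 0"
    have L: "L a (\<lambda>j. G j x / q x) = W a x / (q x ^ m) ^ k" if "a \<in> A" for a
    proof -
      have "L a (\<lambda>j. G j x / q x) = (\<Prod>i<k. \<Prod>j\<in>{..m} - {a i}. (G i x - real j * q x) / q x)"
        unfolding L_def using qx by (intro prod.cong refl) (simp add: field_simps)
      also have "\<dots> = (\<Prod>i<k. (\<Prod>j\<in>{..m} - {a i}. G i x - real j * q x) / q x ^ m)"
        by (intro prod.cong refl) (simp add: prod_dividef cm[OF that] del: card_Diff_insert)
      also have "\<dots> = W a x / (q x ^ m) ^ k" by (simp add: prod_dividef W_def)
      finally show ?thesis .
    qed
    have "P (\<lambda>j. G j x / q x) = (\<Sum>a\<in>A. c a * W a x) / (q x ^ m) ^ k"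
      unfolding P_def sum_divide_distrib by (intro sum.cong) (auto simp: L)
    also have "\<dots> = 0" using sum_apply[of A x] c by simp
    finally show "P (\<lambda>j. G j x / q x) = 0" .
  qed
qed

section \<open>Ideals, tangent spaces and morphisms\<close>

lemma poly_ring_simps [simp]:
  "carrier (poly_ring n) = polys n" "\<one>\<^bsub>poly_ring n\<^esub> = 1" "\<zero>\<^bsub>poly_ring n\<^esub> = 0"
  "p \<otimes>\<^bsub>poly_ring n\<^esub> q = p * q" "p \<oplus>\<^bsub>poly_ring n\<^esub> q = p + q"
  by (simp_all add: poly_ring_def)

lemma cring_poly_ring: "cring (poly_ring n)"
proof (rule cringI)
  show "abelian_group (poly_ring n)"
  proof (rule abelian_groupI)
    fix p assume "p \<in> carrier (poly_ring n)"
    then show "\<exists>q\<in>carrier (poly_ring n). q \<oplus>\<^bsub>poly_ring n\<^esub> p = \<zero>\<^bsub>poly_ring n\<^esub>"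
      by (intro bexI[of _ "\<lambda>x. - p x"]) (auto intro: polys_uminus)
  qed (auto intro: polys.add polys.const simp: zero_fun_def ac_simps fun_eq_iff)
  show "comm_monoid (poly_ring n)"
    by (rule comm_monoidI) (auto intro: polys.mult polys.const simp: one_fun_def ac_simps fun_eq_iff)
qed (auto simp: fun_eq_iff algebra_simps)

lemma polys_ideal_facts:
  assumes "ideal I (poly_ring n)"
  shows "p \<in> I \<Longrightarrow> p \<in> polys n"
    and "(\<lambda>x. 0) \<in> I"
    and "p \<in> I \<Longrightarrow> q \<in> I \<Longrightarrow> (\<lambda>x. p x + q x) \<in> I"
    and "p \<in> I \<Longrightarrow> q \<in> polys n \<Longrightarrow> (\<lambda>x. p x * q x) \<in> I"
    and "p \<in> I \<Longrightarrow> q \<in> polys n \<Longrightarrow> (\<lambda>x. q x * p x) \<in> I"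
    and "p \<in> I \<Longrightarrow> q \<in> I \<Longrightarrow> (\<lambda>x. p x - q x) \<in> I"
    and "(\<And>j. j \<in> A \<Longrightarrow> r j \<in> I) \<Longrightarrow> (\<lambda>x. \<Sum>j\<in>A. r j x) \<in> I"
proof -
  interpret ideal I "poly_ring n" by fact
  show 1: "p \<in> I \<Longrightarrow> p \<in> polys n" for p using a_subset by auto
  show z: "(\<lambda>x. 0) \<in> I" using additive_subgroup.zero_closed[OF is_additive_subgroup]
    by (simp add: zero_fun_def)
  show a: "p \<in> I \<Longrightarrow> q \<in> I \<Longrightarrow> (\<lambda>x. p x + q x) \<in> I" for p q
    using additive_subgroup.a_closed[OF is_additive_subgroup, of p q] by (simp add: plus_fun_def)
  show m: "p \<in> I \<Longrightarrow> q \<in> polys n \<Longrightarrow> (\<lambda>x. p x * q x) \<in> I" for p q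
    using I_r_closed[of p q] by (simp add: times_fun_def)
  show "p \<in> I \<Longrightarrow> q \<in> polys n \<Longrightarrow> (\<lambda>x. q x * p x) \<in> I" for p q
    using I_l_closed[of p q] by (simp add: times_fun_def)
  show "p \<in> I \<Longrightarrow> q \<in> I \<Longrightarrow> (\<lambda>x. p x - q x) \<in> I" for p q
    using a[OF _ m[OF _ polys.const[of "-1"]], of p q] by simp
  show "(\<And>j. j \<in> A \<Longrightarrow> r j \<in> I) \<Longrightarrow> (\<lambda>x. \<Sum>j\<in>A. r j x) \<in> I" for A and r :: "'a \<Rightarrow> point \<Rightarrow> real"
    by (induction A rule: infinite_finite_induct) (auto intro: z a)
qed

lemma affine_variety_ideal: "affine_variety X \<Longrightarrow> ideal (vanishing X) (poly_ring (nvars X))"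
  unfolding affine_variety_def by (rule primeideal.axioms(1))

lemma affine_variety_prime:
  assumes "affine_variety X" "p \<in> polys (nvars X)" "q \<in> polys (nvars X)" "(\<lambda>x. p x * q x) \<in> vanishing X"
  shows "p \<in> vanishing X \<or> q \<in> vanishing X"
  using primeideal.I_prime[OF assms(1)[unfolded affine_variety_def], of p q] assms
  by (simp add: times_fun_def)

lemma affine_variety_proper:
  assumes "affine_variety X" "c \<noteq> 0" shows "(\<lambda>x. c) \<notin> vanishing X"
proof
  assume "(\<lambda>x. c) \<in> vanishing X"
  from polys_ideal_facts(5)[OF affine_variety_ideal[OF assms(1)] this polys_mult[OF polys.const[of "1/c"]]]
  have "p \<in> vanishing X" if "p \<in> polys (nvars X)" for p using that assms(2) by auto
  then have "polys (nvars X) = vanishing X"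
    using polys_ideal_facts(1)[OF affine_variety_ideal[OF assms(1)]] by auto
  then show False using primeideal.I_notcarr[OF assms(1)[unfolded affine_variety_def]] by simp
qed

lemma affine_variety_prime_power:
  assumes "affine_variety X" "p \<in> polys (nvars X)" "(\<lambda>x. p x ^ k) \<in> vanishing X"
  shows "p \<in> vanishing X"
  using assms(3)
proof (induction k)
  case 0 then show ?case using affine_variety_proper[OF assms(1), of 1] by simp
next
  case (Suc k)
  then have "(\<lambda>x. p x * p x ^ k) \<in> vanishing X" by simp
  from affine_variety_prime[OF assms(1,2) polys_power[OF assms(2)] this] Suc.IH show ?case by blast
qed

lemma affine_space_subspace: "subspace (affine_space n)"
  by (auto simp: subspace_def affine_space_def scaleR_fun_def)

lemma points_affine_space: "x \<in> points X \<Longrightarrow> x \<in> affine_space (nvars X)"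
  by (simp add: points_def)

lemma points_vanish: "x \<in> points X \<Longrightarrow> p \<in> vanishing X \<Longrightarrow> p x = 0"
  by (simp add: points_def)

lemma affine_space_eqI:
  "x \<in> affine_space n \<Longrightarrow> y \<in> affine_space n \<Longrightarrow> (\<And>i. i < n \<Longrightarrow> x i = y i) \<Longrightarrow> x = y"
  unfolding affine_space_def fun_eq_iff mem_Collect_eq by (metis not_le)

lemma tangent_space_eq:
  assumes "vanishing X \<subseteq> polys (nvars X)"
  shows "tangent_space X x = {v \<in> affine_space (nvars X). \<forall>p\<in>vanishing X. dpoly (nvars X) p x v = 0}"
proof -
  have "((\<lambda>s. p (x + s *\<^sub>R v)) has_real_derivative 0) (at 0) \<longleftrightarrow> dpoly (nvars X) p x v = 0"
    if "p \<in> vanishing X" for p v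
  proof -
    have p: "p \<in> polys (nvars X)" using that assms by blast
    show ?thesis using dpoly_line[OF p, of x v] dpoly_line_unique[OF p, of x v 0] by auto
  qed
  then show ?thesis unfolding tangent_space_def by blast
qed

lemma tangent_space_subspace:
  assumes "vanishing X \<subseteq> polys (nvars X)"
  shows "subspace (tangent_space X x)"
  unfolding tangent_space_eq[OF assms]
  using affine_space_subspace[of "nvars X"] by (auto simp: subspace_def dpoly_lin)

lemma tangent_space_affine: "v \<in> tangent_space X x \<Longrightarrow> v \<in> affine_space (nvars X)"
  by (simp add: tangent_space_def)

subsection \<open>Dimension of subspaces of real n-space\<close>

definition unit_point :: "nat \<Rightarrow> point" where "unit_point i = (\<lambda>j. if j = i then 1 else 0)"

lemma sum_scaleR_apply: "(\<Sum>a\<in>B. c a *\<^sub>R (W a :: 'a \<Rightarrow> real)) x = (\<Sum>a\<in>B. c a * W a x)"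
  by (induction B rule: infinite_finite_induct) (auto simp: scaleR_fun_def)

text \<open>The type of points is infinite-dimensional, but all tangent vectors lie in \<open>affine_space n\<close>, which
  is spanned by finitely many vectors; this bounds independent sets and makes \<^const>\<open>dim\<close> meaningful.\<close>

lemma affine_space_expand:
  assumes "x \<in> affine_space n" shows "x = (\<Sum>i<n. x i *\<^sub>R unit_point i)"
proof
  fix j show "x j = (\<Sum>i<n. x i *\<^sub>R unit_point i) j"
    using assms by (auto simp: sum_scaleR_apply unit_point_def affine_space_def if_distrib cong: if_cong)
qed

lemma affine_space_span: "affine_space n \<subseteq> span (unit_point ` {..<n})"
proof
  fix x assume "x \<in> affine_space n"
  then have "x = (\<Sum>i<n. x i *\<^sub>R unit_point i)" by (rule affine_space_expand)
  moreover have "(\<Sum>i<n. x i *\<^sub>R unit_point i) \<in> span (unit_point ` {..<n})"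
    by (intro span_sum span_scale span_base) auto
  ultimately show "x \<in> span (unit_point ` {..<n})" by simp
qed

lemma independent_affine_space_finite:
  assumes "independent B" "B \<subseteq> affine_space n" shows "finite B"
  using independent_span_bound[of "unit_point ` {..<n}" B] assms affine_space_span[of n] by auto

lemma affine_subspace_basis:
  assumes "subspace S" "S \<subseteq> affine_space n"
  obtains B where "B \<subseteq> S" "independent B" "span B = S" "finite B" "card B = dim S"
proof -
  obtain B where B: "B \<subseteq> S" "independent B" "S \<subseteq> span B" "card B = dim S"
    using basis_exists[of S] by blast
  moreover have "span B = S" using B assms(1) span_minimal[of B S] by auto
  moreover have "finite B" using independent_affine_space_finite[OF B(2)] B(1) assms(2) by auto
  ultimately show ?thesis using that by blast
qed

lemma dim_le_of_inj:
  assumes "subspace S" "S \<subseteq> affine_space m" "linear L" "inj_on L S" "L ` S \<subseteq> T" "subspace T" "T \<subseteq> affine_space n"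
  shows "dim S \<le> dim T"
proof -
  obtain B where B: "B \<subseteq> S" "independent B" "span B = S" "finite B" "card B = dim S"
    by (rule affine_subspace_basis[OF assms(1,2)])
  obtain C where C: "C \<subseteq> T" "independent C" "span C = T" "finite C" "card C = dim T"
    by (rule affine_subspace_basis[OF assms(6,7)])
  have "independent (L ` B)"
    by (rule linear_independent_injective_image[OF assms(3) B(2)]) (use B assms(4) in simp)
  then have "card (L ` B) \<le> card C"
    using independent_span_bound[OF C(4), of "L ` B"] B(1) assms(5) C(3) by auto
  moreover have "card (L ` B) = card B"
    by (rule card_image) (use B(1) assms(4) inj_on_subset in blast)
  ultimately show ?thesis using B C by simp
qed

lemma dim_eqI_basis:
  assumes "independent B" "span B = S" shows "dim S = card B"
  using assms dim_span_eq_card_independent by blast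

subsection \<open>Morphisms on points\<close>

lemma endos_poly: "\<phi> \<in> endos X \<Longrightarrow> i < nvars X \<Longrightarrow> (\<lambda>x. \<phi> x i) \<in> polys (nvars X)"
  by (simp add: endos_def)

lemma endos_affine: "\<phi> \<in> endos X \<Longrightarrow> \<phi> x \<in> affine_space (nvars X)"
  by (simp add: endos_def)

lemma endos_points: "\<phi> \<in> endos X \<Longrightarrow> x \<in> points X \<Longrightarrow> \<phi> x \<in> points X"
  unfolding endos_def points_def mem_Collect_eq comp_def
  by (metis (mono_tags, lifting))

lemma same_morphism_points:
  assumes "same_morphism X \<phi> \<psi>" "x \<in> points X" "\<phi> x \<in> affine_space (nvars X)" "\<psi> x \<in> affine_space (nvars X)"
  shows "\<phi> x = \<psi> x"
proof (rule affine_space_eqI[OF assms(3,4)])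
  fix i assume "i < nvars X"
  then show "\<phi> x i = \<psi> x i" using points_vanish[OF assms(2), of "\<lambda>x. \<phi> x i - \<psi> x i"] assms(1)
    by (simp add: same_morphism_def)
qed

lemma Ga_endos: "Ga_action X \<phi> \<Longrightarrow> \<phi> t \<in> endos X"
  by (simp add: Ga_action_def)

lemma Ga_points: "Ga_action X \<phi> \<Longrightarrow> x \<in> points X \<Longrightarrow> \<phi> t x \<in> points X"
  using Ga_endos endos_points by blast

lemma Ga_zero: "Ga_action X \<phi> \<Longrightarrow> x \<in> points X \<Longrightarrow> \<phi> 0 x = x"
  using same_morphism_points[of X "\<phi> 0" id x] endos_affine[OF Ga_endos] points_affine_space
  by (simp add: Ga_action_def)

lemma Ga_add: "Ga_action X \<phi> \<Longrightarrow> x \<in> points X \<Longrightarrow> \<phi> (s + t) x = \<phi> s (\<phi> t x)"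
  using same_morphism_points[of X "\<phi> (s + t)" "\<phi> s \<circ> \<phi> t" x] endos_affine[OF Ga_endos]
  by (simp add: Ga_action_def)

lemma Ga_inverse: "Ga_action X \<phi> \<Longrightarrow> x \<in> points X \<Longrightarrow> \<phi> (- t) (\<phi> t x) = x"
  using Ga_add[of X \<phi> x "- t" t] Ga_zero[of X \<phi> x] by simp

lemma Ga_inverse': "Ga_action X \<phi> \<Longrightarrow> x \<in> points X \<Longrightarrow> \<phi> t (\<phi> (- t) x) = x"
  using Ga_inverse[of X \<phi> x "- t"] by simp

lemma Ga_poly:
  assumes "Ga_action X \<phi>" "i < nvars X"
  obtains P where "P \<in> polys (Suc (nvars X))" "\<And>t x. \<phi> t x i = P (x(nvars X := t))"
  using assms unfolding Ga_action_def by auto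

lemma Ga_upoly:
  assumes "Ga_action X \<phi>" "upoly a" "\<And>i. i < nvars X \<Longrightarrow> upoly (\<lambda>s. c s i)"
  shows "upoly (\<lambda>s. \<phi> (a s) (c s) i)"
proof (cases "i < nvars X")
  case True
  from Ga_poly[OF assms(1) this] obtain P where P: "P \<in> polys (Suc (nvars X))"
    "\<And>t x. \<phi> t x i = P (x(nvars X := t))" by metis
  have "upoly (\<lambda>s. P ((c s)(nvars X := a s)))"
    by (rule upoly_polys[OF P(1)]) (use assms in \<open>auto simp: less_Suc_eq\<close>)
  then show ?thesis by (simp add: P(2))
next
  case False
  then have "\<phi> (a s) (c s) i = 0" for s
    using endos_affine[OF Ga_endos[OF assms(1)], of "a s" "c s"] by (simp add: affine_space_def)
  then show ?thesis by (simp add: upoly_const)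
qed

text \<open>The differential of a polynomial self-map of real \<open>n\<close>-space.\<close>

definition dmap :: "nat \<Rightarrow> (point \<Rightarrow> point) \<Rightarrow> point \<Rightarrow> point \<Rightarrow> point"
  where "dmap n \<phi> x w = (\<lambda>i. if i < n then dpoly n (\<lambda>x. \<phi> x i) x w else 0)"

lemma scaleR_fun_apply: "(c *\<^sub>R f) x = c *\<^sub>R f x"
  by (simp add: scaleR_fun_def)

lemma linear_dmap: "linear (dmap n \<phi> x)"
  by (rule linearI) (simp_all add: dmap_def dpoly_lin fun_eq_iff scaleR_fun_apply)

lemma dpoly_endo:
  assumes "\<phi> \<in> endos X" "p \<in> polys (nvars X)"
  shows "dpoly (nvars X) (p \<circ> \<phi>) x w = dpoly (nvars X) p (\<phi> x) (dmap (nvars X) \<phi> x w)"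
proof -
  have "dpoly (nvars X) (\<lambda>x. p (\<phi> x)) x w
      = dpoly (nvars X) p (\<phi> x) (\<lambda>j. dpoly (nvars X) (\<lambda>x. \<phi> x j) x w)"
    by (rule dpoly_subst[OF assms(2) endos_poly[OF assms(1)]])
  then show ?thesis unfolding comp_def by (simp add: dpoly_def dmap_def)
qed

lemma dmap_tangent:
  assumes "vanishing X \<subseteq> polys (nvars X)" "\<phi> \<in> endos X" "w \<in> tangent_space X x"
  shows "dmap (nvars X) \<phi> x w \<in> tangent_space X (\<phi> x)"
  unfolding tangent_space_eq[OF assms(1)]
proof (intro CollectI conjI ballI)
  show "dmap (nvars X) \<phi> x w \<in> affine_space (nvars X)" by (simp add: affine_space_def dmap_def)
next
  fix p assume p: "p \<in> vanishing X"
  then have "p \<circ> \<phi> \<in> vanishing X" using assms(2) by (simp add: endos_def)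
  then have "dpoly (nvars X) (p \<circ> \<phi>) x w = 0"
    using assms(3) unfolding tangent_space_eq[OF assms(1)] by blast
  then show "dpoly (nvars X) p (\<phi> x) (dmap (nvars X) \<phi> x w) = 0"
    using dpoly_endo[OF assms(2), of p x w] p assms(1) by auto
qed

lemma dmap_same_morphism_id:
  assumes I: "vanishing X \<subseteq> polys (nvars X)" and \<phi>: "\<phi> \<in> endos X" and s: "same_morphism X \<phi> id"
    and w: "w \<in> tangent_space X x"
  shows "dmap (nvars X) \<phi> x w = w"
proof (rule affine_space_eqI[of _ "nvars X"])
  fix i assume i: "i < nvars X"
  have "(\<lambda>x. \<phi> x i - x i) \<in> vanishing X" using s i by (simp add: same_morphism_def)
  then have "dpoly (nvars X) (\<lambda>x. \<phi> x i - x i) x w = 0"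
    using w unfolding tangent_space_eq[OF I] by blast
  then show "dmap (nvars X) \<phi> x w i = w i"
    using dpoly_diff_poly[OF endos_poly[OF \<phi> i] polys.var[OF i]] i by (simp add: dpoly_var dmap_def)
qed (use w tangent_space_affine in \<open>auto simp: affine_space_def dmap_def\<close>)

lemma endos_compose:
  assumes "vanishing X \<subseteq> polys (nvars X)" "\<phi> \<in> endos X" "\<psi> \<in> endos X" shows "\<phi> \<circ> \<psi> \<in> endos X"
proof -
  have "(\<lambda>x. \<phi> (\<psi> x) i) \<in> polys (nvars X)" if "i < nvars X" for i
    by (rule polys_subst[OF endos_poly[OF assms(2) that] endos_poly[OF assms(3)]])
  moreover have "p \<circ> (\<phi> \<circ> \<psi>) \<in> vanishing X" if "p \<in> vanishing X" for p
    using assms(2,3) that unfolding endos_def comp_assoc[symmetric] by blast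
  ultimately show ?thesis using endos_affine[OF assms(2)] by (auto simp: endos_def)
qed

text \<open>The differential of a left inverse is a left inverse of the differential on tangent spaces.\<close>

lemma dim_tangent_le:
  assumes I: "vanishing X \<subseteq> polys (nvars X)" and \<phi>: "\<phi> \<in> endos X" and \<psi>: "\<psi> \<in> endos X"
    and s: "same_morphism X (\<psi> \<circ> \<phi>) id"
  shows "dim (tangent_space X x) \<le> dim (tangent_space X (\<phi> x))"
proof (rule dim_le_of_inj[OF _ _ linear_dmap, of _ "nvars X" "nvars X" \<phi> x])
  show "inj_on (dmap (nvars X) \<phi> x) (tangent_space X x)"
  proof (rule inj_on_inverseI)
    fix w assume w: "w \<in> tangent_space X x"
    have "dmap (nvars X) (\<psi> \<circ> \<phi>) x w = w"
      by (rule dmap_same_morphism_id[OF I endos_compose[OF I \<psi> \<phi>] s w])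
    moreover have "dmap (nvars X) (\<psi> \<circ> \<phi>) x w = dmap (nvars X) \<psi> (\<phi> x) (dmap (nvars X) \<phi> x w)"
      using dpoly_endo[OF \<phi> endos_poly[OF \<psi>], of _ x w] by (auto simp: dmap_def comp_def)
    ultimately show "dmap (nvars X) \<psi> (\<phi> x) (dmap (nvars X) \<phi> x w) = w" by simp
  qed
qed (use I dmap_tangent[OF I \<phi>] tangent_space_subspace[OF I] tangent_space_affine in auto)

text \<open>An automorphism of the variety maps tangent spaces isomorphically onto tangent spaces, and \<open>\<phi> (- t)\<close>
  is inverse to \<open>\<phi> t\<close> modulo the ideal.\<close>

lemma Ga_reg:
  assumes ideal: "ideal (vanishing X) (poly_ring (nvars X))" and a: "Ga_action X \<phi>" and x: "x \<in> reg X"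
  shows "\<phi> t x \<in> reg X"
proof -
  have I: "vanishing X \<subseteq> polys (nvars X)" using polys_ideal_facts(1)[OF ideal] by blast
  have X: "x \<in> points X" using x by (simp add: reg_def)
  have s: "same_morphism X (\<phi> s \<circ> \<phi> (- s)) id" for s
  proof -
    have 1: "same_morphism X (\<phi> 0) (\<phi> s \<circ> \<phi> (- s))" "same_morphism X (\<phi> 0) id"
      using a unfolding Ga_action_def by (metis add.right_inverse, blast)
    show ?thesis unfolding same_morphism_def
    proof (intro allI impI)
      fix i assume i: "i < nvars X"
      have "(\<lambda>x. (\<phi> 0 x i - id x i) - (\<phi> 0 x i - (\<phi> s \<circ> \<phi> (- s)) x i)) \<in> vanishing X"
        by (rule polys_ideal_facts(6)[OF ideal]) (use 1 i in \<open>auto simp: same_morphism_def\<close>)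
      then show "(\<lambda>x. (\<phi> s \<circ> \<phi> (- s)) x i - id x i) \<in> vanishing X" by simp
    qed
  qed
  have "dim (tangent_space X x) \<le> dim (tangent_space X (\<phi> t x))"
    by (rule dim_tangent_le[OF I Ga_endos[OF a] Ga_endos[OF a]]) (use s[of "- t"] in simp)
  moreover have "dim (tangent_space X (\<phi> t x)) \<le> dim (tangent_space X (\<phi> (- t) (\<phi> t x)))"
    by (rule dim_tangent_le[OF I Ga_endos[OF a] Ga_endos[OF a]]) (use s[of t] in simp)
  ultimately show ?thesis using x Ga_points[OF a X] Ga_inverse[OF a X] by (simp add: reg_def)
qed

section \<open>Flexible varieties are dominated by real n-space\<close>

text \<open>Algebraically independent functions are at most as many as the variables, so the greatest number
  in the definition of the dimension exists.\<close>

lemma alg_independent_bound: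
  assumes X: "affine_variety X" and g: "alg_independent X k g" shows "k \<le> nvars X"
proof (rule ccontr)
  assume "\<not> ?thesis"
  then have k: "nvars X < k" by simp
  have g': "\<And>j. j < k \<Longrightarrow> g j \<in> polys (nvars X)" using g by (simp add: alg_independent_def)
  obtain P where P: "P \<in> polys k" "\<exists>x. P x \<noteq> 0"
    "\<And>x. (1::real) \<noteq> 0 \<Longrightarrow> P (\<lambda>j. g j x / 1) = 0"
    by (rule algebraic_dependence[of "nvars X" k g "\<lambda>x. 1", OF k g' polys.const]) blast+
  have "(\<lambda>x. P (\<lambda>j. g j x)) = (\<lambda>x. 0)" using P(3) by auto
  then have "(\<lambda>x. P (\<lambda>j. g j x)) \<in> vanishing X"
    using polys_ideal_facts(2)[OF affine_variety_ideal[OF X]] by simp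
  then have "P = 0" using g P(1) by (auto simp: alg_independent_def)
  then show False using P(2) by simp
qed

lemma alg_independent_le_dim:
  assumes X: "affine_variety X" and g: "alg_independent X k g" shows "k \<le> variety_dim X"
  unfolding variety_dim_def
  by (rule Greatest_le_nat[of _ _ "nvars X"]) (use g alg_independent_bound[OF X] in auto)

lemma alg_independent_dim_ex:
  assumes X: "affine_variety X" obtains g where "alg_independent X (variety_dim X) g"
proof -
  have "alg_independent X 0 (\<lambda>j x. 0)" unfolding alg_independent_def
  proof (intro conjI ballI impI allI)
    fix P assume P: "P \<in> polys 0" and v: "(\<lambda>x. P (\<lambda>j. 0)) \<in> vanishing X"
    have "P x = P (\<lambda>j. 0)" for x by (rule polys_cong[OF P]) simp
    moreover have "P (\<lambda>j. 0) = 0" using affine_variety_proper[OF X, of "P (\<lambda>j. 0)"] v by auto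
    ultimately show "P = 0" by auto
  qed simp
  then have "\<exists>g. alg_independent X (variety_dim X) g" unfolding variety_dim_def
    by (intro GreatestI_nat[of "\<lambda>k. \<exists>g. alg_independent X k g" 0 "nvars X"])
      (use alg_independent_bound[OF X] in auto)
  then show ?thesis using that by blast
qed

text \<open>Elements of the ideal vanish along orbits.\<close>

lemma Ga_velocity_tangent:
  assumes I: "vanishing X \<subseteq> polys (nvars X)" and a: "Ga_action X \<phi>" and x: "x \<in> points X"
    and v: "\<And>i. ((\<lambda>t. \<phi> t x i) has_real_derivative v i) (at 0)"
  shows "v \<in> tangent_space X x"
  unfolding tangent_space_eq[OF I]
proof (intro CollectI conjI ballI)
  have "v i = 0" if "i \<ge> nvars X" for i
  proof -
    have "(\<lambda>t. \<phi> t x i) = (\<lambda>t. 0)"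
      using endos_affine[OF Ga_endos[OF a]] that by (auto simp: affine_space_def)
    then show ?thesis using v[of i] DERIV_const DERIV_unique by metis
  qed
  then show "v \<in> affine_space (nvars X)" by (simp add: affine_space_def)
next
  fix p assume p: "p \<in> vanishing X"
  have "((\<lambda>t. p (\<phi> t x)) has_real_derivative dpoly (nvars X) p (\<phi> 0 x) v) (at 0)"
    by (rule dpoly_chain) (use I p v in auto)
  moreover have "(\<lambda>t. p (\<phi> t x)) = (\<lambda>t. 0)" using points_vanish[OF Ga_points[OF a x] p] by auto
  ultimately show "dpoly (nvars X) p x v = 0"
    using Ga_zero[OF a x] DERIV_const DERIV_unique by metis
qed

text \<open>The derivative splits into a part along the curve, where \<open>\<phi> 0\<close> acts as the identity modulo the
  ideal (and hence on tangent vectors, though not off the variety), and the velocity of the orbit.\<close>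

lemma Ga_curve_derivative:
  assumes I: "vanishing X \<subseteq> polys (nvars X)" and a: "Ga_action X \<phi>" and x: "x \<in> points X"
    and v: "\<And>i. ((\<lambda>t. \<phi> t x i) has_real_derivative v i) (at 0)"
    and w: "w \<in> tangent_space X x"
    and c: "\<And>i. ((\<lambda>s. c s i) has_real_derivative w i) (at 0)" "c 0 = x"
  shows "((\<lambda>s. \<phi> (s * r) (c s) i) has_real_derivative w i + r * v i) (at 0)"
proof (cases "i < nvars X")
  case False
  have "(\<lambda>s. \<phi> (s * r) (c s) i) = (\<lambda>s. 0)"
    using endos_affine[OF Ga_endos[OF a]] False by (auto simp: affine_space_def)
  moreover have "v i = 0" "w i = 0"
    using tangent_space_affine[OF w] tangent_space_affine[OF Ga_velocity_tangent[OF I a x v]] False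
    by (auto simp: affine_space_def)
  ultimately show ?thesis by simp
next
  case True
  let ?n = "nvars X"
  obtain P where P: "P \<in> polys (Suc ?n)" "\<And>t x. \<phi> t x i = P (x(?n := t))"
    using Ga_poly[OF a True] by metis
  have e: "(c s)(?n := s * r) = (\<lambda>j. if j = ?n then s * r else c s j)" for s by auto
  have 1: "((\<lambda>s. P ((c s)(?n := s * r))) has_real_derivative
      dpoly (Suc ?n) P ((c 0)(?n := 0 * r)) (w(?n := r))) (at 0)"
    by (rule dpoly_chain[OF P(1)]) (auto simp: c intro!: derivative_eq_intros)
  have "w(?n := r) = w(?n := 0) + r *\<^sub>R unit_point ?n"
    by (auto simp: fun_eq_iff unit_point_def scaleR_fun_def)
  then have 2: "dpoly (Suc ?n) P (x(?n := 0)) (w(?n := r)) =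
      dpoly (Suc ?n) P (x(?n := 0)) (w(?n := 0)) + r * dpoly (Suc ?n) P (x(?n := 0)) (unit_point ?n)"
    by (simp add: dpoly_lin)
  have "((\<lambda>s. P ((x + s *\<^sub>R w)(?n := 0))) has_real_derivative
      dpoly (Suc ?n) P ((x + 0 *\<^sub>R w)(?n := 0)) (w(?n := 0))) (at 0)"
    by (rule dpoly_chain[OF P(1)]) (auto simp: scaleR_fun_def intro!: derivative_eq_intros)
  then have "dpoly ?n (\<lambda>x. \<phi> 0 x i) x w = dpoly (Suc ?n) P (x(?n := 0)) (w(?n := 0))"
    using dpoly_line_unique[OF endos_poly[OF Ga_endos[OF a] True], of 0 x w] by (simp add: P(2))
  moreover have "dmap ?n (\<phi> 0) x w i = w i"
    using dmap_same_morphism_id[OF I Ga_endos[OF a] _ w] a by (simp add: Ga_action_def)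
  ultimately have 3: "dpoly (Suc ?n) P (x(?n := 0)) (w(?n := 0)) = w i" using True by (simp add: dmap_def)
  have "((\<lambda>s. P (x(?n := s))) has_real_derivative
      dpoly (Suc ?n) P (x(?n := 0)) (unit_point ?n)) (at 0)"
    by (rule dpoly_chain[OF P(1)]) (auto simp: unit_point_def intro!: derivative_eq_intros)
  then have 4: "dpoly (Suc ?n) P (x(?n := 0)) (unit_point ?n) = v i"
    using DERIV_unique[OF _ v[of i]] by (simp add: P(2))
  show ?thesis using 1 unfolding P(2) by (simp add: c(2) 2 3 4)
qed

text \<open>Applying \<open>d\<close> actions one after the other with independent times gives a polynomial map from real
  \<open>d\<close>-space to the regular points whose differential at the origin has the velocities as columns.\<close>

lemma orbit_map:
  assumes ideal: "ideal (vanishing X) (poly_ring (nvars X))" and x: "x \<in> reg X"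
    and a: "\<And>j. j < d \<Longrightarrow> Ga_action X (\<phi> j)"
    and v: "\<And>j i. j < d \<Longrightarrow> ((\<lambda>t. \<phi> j t x i) has_real_derivative v j i) (at 0)"
  shows "\<exists>\<Phi>. (\<forall>i<nvars X. (\<lambda>t. \<Phi> t i) \<in> polys d) \<and> (\<forall>t. \<Phi> t \<in> reg X) \<and> \<Phi> (\<lambda>j. 0) = x \<and>
    (\<forall>t i. ((\<lambda>s. \<Phi> (\<lambda>j. s * t j) i) has_real_derivative (\<Sum>j<d. t j * v j i)) (at 0))"
  using a v
proof (induction d)
  case 0
  show ?case by (rule exI[of _ "\<lambda>t. x"]) (auto intro: polys.const simp: x)
next
  case (Suc d)
  have I: "vanishing X \<subseteq> polys (nvars X)" using polys_ideal_facts(1)[OF ideal] by blast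
  have xp: "x \<in> points X" using x by (simp add: reg_def)
  have "\<exists>\<Phi>. (\<forall>i<nvars X. (\<lambda>t. \<Phi> t i) \<in> polys d) \<and> (\<forall>t. \<Phi> t \<in> reg X) \<and> \<Phi> (\<lambda>j. 0) = x \<and>
    (\<forall>t i. ((\<lambda>s. \<Phi> (\<lambda>j. s * t j) i) has_real_derivative (\<Sum>j<d. t j * v j i)) (at 0))"
    by (rule Suc.IH) (use Suc.prems in auto)
  then obtain \<Phi> where \<Phi>: "\<And>i. i < nvars X \<Longrightarrow> (\<lambda>t. \<Phi> t i) \<in> polys d" "\<And>t. \<Phi> t \<in> reg X" "\<Phi> (\<lambda>j. 0) = x"
    "\<And>t i. ((\<lambda>s. \<Phi> (\<lambda>j. s * t j) i) has_real_derivative (\<Sum>j<d. t j * v j i)) (at 0)" by blast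
  have ad: "Ga_action X (\<phi> d)" using Suc.prems by simp
  have vj: "v j \<in> tangent_space X x" if "j < Suc d" for j
    using Ga_velocity_tangent[OF I Suc.prems(1)[OF that] xp Suc.prems(2)[OF that]] .
  have w: "(\<lambda>i. \<Sum>j<d. t j * v j i) \<in> tangent_space X x" for t
  proof -
    have "(\<Sum>j<d. t j *\<^sub>R v j) \<in> tangent_space X x"
      by (intro subspace_sum subspace_scale tangent_space_subspace[OF I]) (use vj in auto)
    moreover have "(\<Sum>j<d. t j *\<^sub>R v j) = (\<lambda>i. \<Sum>j<d. t j * v j i)" by (auto simp: sum_scaleR_apply)
    ultimately show ?thesis by simp
  qed
  show ?case
  proof (intro exI[of _ "\<lambda>t. \<phi> d (t d) (\<Phi> t)"] conjI allI impI)
    fix i assume i: "i < nvars X"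
    obtain P where P: "P \<in> polys (Suc (nvars X))" "\<And>t x. \<phi> d t x i = P (x(nvars X := t))"
      using Ga_poly[OF ad i] by metis
    have "(\<lambda>t. P ((\<Phi> t)(nvars X := t d))) \<in> polys (Suc d)"
    proof (rule polys_subst[OF P(1)])
      fix j assume "j < Suc (nvars X)"
      then show "(\<lambda>t. ((\<Phi> t)(nvars X := t d)) j) \<in> polys (Suc d)"
        using polys_mono[OF \<Phi>(1)[of j], of "Suc d"] polys.var[of d "Suc d"]
        by (cases "j = nvars X") auto
    qed
    then show "(\<lambda>t. \<phi> d (t d) (\<Phi> t) i) \<in> polys (Suc d)" by (simp add: P(2))
  next
    fix t show "\<phi> d (t d) (\<Phi> t) \<in> reg X" by (rule Ga_reg[OF ideal ad \<Phi>(2)])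
  next
    show "\<phi> d 0 (\<Phi> (\<lambda>j. 0)) = x" using Ga_zero[OF ad xp] \<Phi>(3) by simp
  next
    fix t i
    have "((\<lambda>s. \<phi> d (s * t d) (\<Phi> (\<lambda>j. s * t j)) i) has_real_derivative (\<Sum>j<d. t j * v j i) + t d * v d i) (at 0)"
      by (rule Ga_curve_derivative[OF I ad xp Suc.prems(2) w]) (use \<Phi>(3,4) in auto)
    then show "((\<lambda>s. \<phi> d (s * t d) (\<Phi> (\<lambda>j. s * t j)) i) has_real_derivative (\<Sum>j<Suc d. t j * v j i)) (at 0)"
      by simp
  qed
qed

text \<open>A parametrization with Zariski dense image, by regular real points. It embeds the coordinate ring
  into a polynomial ring, and it shows that the ideal consists of all polynomials that vanish at the
  real points.\<close>

definition dominating :: "variety \<Rightarrow> nat \<Rightarrow> (point \<Rightarrow> point) \<Rightarrow> bool"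
  where "dominating X d \<Phi> \<longleftrightarrow> (\<forall>i<nvars X. (\<lambda>t. \<Phi> t i) \<in> polys d) \<and> (\<forall>t. \<Phi> t \<in> reg X) \<and>
    (\<forall>p\<in>polys (nvars X). (\<forall>t. p (\<Phi> t) = 0) \<longrightarrow> p \<in> vanishing X)"

lemma linear_on_affine_space:
  assumes "linear g" "x \<in> affine_space n"
  shows "g x i = (\<Sum>k<n. x k * g (unit_point k) i)"
proof -
  have "g x = g (\<Sum>k<n. x k *\<^sub>R unit_point k)"
    by (rule arg_cong[OF affine_space_expand[OF assms(2)]])
  also have "\<dots> = (\<Sum>k<n. g (x k *\<^sub>R unit_point k))" by (rule linear_sum[OF assms(1)])
  also have "\<dots> = (\<Sum>k<n. x k *\<^sub>R g (unit_point k))"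
    by (intro sum.cong refl linear_scale[OF assms(1)])
  finally show ?thesis by (simp add: sum_scaleR_apply)
qed

text \<open>Velocities forming a basis of the tangent space at a regular point give a map \<open>\<Phi>\<close> with injective
  differential. Let \<open>p\<close> vanish on its image but not lie in the ideal. Affine functions \<open>lam j\<close> dual to
  the velocities and \<open>p\<close> are one function more than the dimension, so they satisfy a relation modulo
  the ideal; dividing it by a power of \<open>p\<close> and restricting to the image leaves a nontrivial relation
  between the \<open>lam j\<close> composed with \<open>\<Phi>\<close>, against \<open>no_relation_first_order\<close>.\<close>

lemma flexible_dominated:
  assumes X: "affine_variety X" and fl: "flexible X" and x: "x \<in> reg X"
  obtains \<Phi> where "dominating X (variety_dim X) \<Phi>"
proof -
  let ?n = "nvars X" and ?D = "variety_dim X"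
  have ideal: "ideal (vanishing X) (poly_ring ?n)" by (rule affine_variety_ideal[OF X])
  have I: "vanishing X \<subseteq> polys ?n" using polys_ideal_facts(1)[OF ideal] by blast
  have xp: "x \<in> points X" using x by (simp add: reg_def)
  have T: "span (orbit_tangents X x) = tangent_space X x" "dim (tangent_space X x) = ?D"
    using fl x by (auto simp: flexible_def flexible_point_def reg_def)
  obtain B where B: "B \<subseteq> orbit_tangents X x" "independent B" "orbit_tangents X x \<subseteq> span B"
    by (rule maximal_independent_subset)
  have sB: "span B = tangent_space X x"
    using B span_mono[OF B(1)] span_minimal[OF B(3) subspace_span] T by auto
  have cB: "card B = ?D" using dim_eqI_basis[OF B(2) sB] T by simp
  have "B \<subseteq> affine_space ?n" using sB span_superset[of B] tangent_space_affine by blast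
  then have fB: "finite B" using independent_affine_space_finite[OF B(2)] by blast
  obtain v where v: "bij_betw v {0..<?D} B" using ex_bij_betw_nat_finite[OF fB] cB by auto
  have vB: "v j \<in> B" if "j < ?D" for j using v that by (auto simp: bij_betw_def)
  have "\<forall>j. \<exists>\<phi>. j < ?D \<longrightarrow> Ga_action X \<phi> \<and> (\<forall>i. ((\<lambda>t. \<phi> t x i) has_real_derivative v j i) (at 0))"
    using vB B(1) by (fastforce simp: orbit_tangents_def effective_Ga_action_def)
  then obtain \<phi> where \<phi>: "\<And>j. j < ?D \<Longrightarrow> Ga_action X (\<phi> j)"
    "\<And>j i. j < ?D \<Longrightarrow> ((\<lambda>t. \<phi> j t x i) has_real_derivative v j i) (at 0)" by metis
  have "\<exists>\<Phi>. (\<forall>i<?n. (\<lambda>t. \<Phi> t i) \<in> polys ?D) \<and> (\<forall>t. \<Phi> t \<in> reg X) \<and> \<Phi> (\<lambda>j. 0) = x \<and>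
    (\<forall>t i. ((\<lambda>s. \<Phi> (\<lambda>j. s * t j) i) has_real_derivative (\<Sum>j<?D. t j * v j i)) (at 0))"
    by (rule orbit_map[OF ideal x]) (use \<phi> in auto)
  then obtain \<Phi> where \<Phi>: "\<And>i. i < ?n \<Longrightarrow> (\<lambda>t. \<Phi> t i) \<in> polys ?D" "\<And>t. \<Phi> t \<in> reg X" "\<Phi> (\<lambda>j. 0) = x"
    "\<And>t i. ((\<lambda>s. \<Phi> (\<lambda>j. s * t j) i) has_real_derivative (\<Sum>j<?D. t j * v j i)) (at 0)"
    by blast
  have \<Phi>A: "\<Phi> t \<in> affine_space ?n" for t using \<Phi>(2)[of t] by (simp add: reg_def points_def)
  obtain g where g: "linear g" "\<And>b. b \<in> B \<Longrightarrow> g b = unit_point (inv_into {0..<?D} v b)"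
    using linear_independent_extend[OF B(2), of "\<lambda>b. unit_point (inv_into {0..<?D} v b)"] by blast
  have gv: "g (v j) = unit_point j" if "j < ?D" for j
    using g(2)[OF vB[OF that]] that v by (simp add: bij_betw_def)
  define lam where "lam i y = (\<Sum>k<?n. y k * g (unit_point k) i) - g x i" for i y
  have lam: "lam i \<in> polys ?n" for i unfolding lam_def[abs_def] by (intro polys_intros) auto
  have lam0: "lam i x = 0" for i
    using linear_on_affine_space[OF g(1) points_affine_space[OF xp]] by (simp add: lam_def)
  have lam\<Phi>: "((\<lambda>s. lam i (\<Phi> (\<lambda>j. s * t j)) / s) \<longlongrightarrow> t i) (at 0)" if "i < ?D" for t i
  proof -
    have "((\<lambda>s. lam i (\<Phi> (\<lambda>j. s * t j))) has_real_derivative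
        (\<Sum>k<?n. (\<Sum>j<?D. t j * v j k) * g (unit_point k) i)) (at 0)"
      unfolding lam_def by (auto intro!: derivative_eq_intros \<Phi>(4))
    moreover have "(\<Sum>k<?n. (\<Sum>j<?D. t j * v j k) * g (unit_point k) i) = t i"
    proof -
      have "(\<Sum>k<?n. (\<Sum>j<?D. t j * v j k) * g (unit_point k) i)
          = (\<Sum>j<?D. t j * (\<Sum>k<?n. v j k * g (unit_point k) i))"
        unfolding sum_distrib_right sum_distrib_left by (subst sum.swap) (simp add: mult.assoc)
      also have "\<dots> = (\<Sum>j<?D. t j * g (v j) i)"
      proof (intro sum.cong refl)
        fix j assume "j \<in> {..<?D}"
        then have "v j \<in> affine_space ?n" using vB \<open>B \<subseteq> affine_space ?n\<close> by auto
        from linear_on_affine_space[OF g(1) this]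
        show "t j * (\<Sum>k<?n. v j k * g (unit_point k) i) = t j * g (v j) i" by simp
      qed
      also have "\<dots> = (\<Sum>j<?D. if j = i then t i else 0)"
        by (intro sum.cong) (auto simp: gv unit_point_def)
      finally show ?thesis using that by simp
    qed
    ultimately show ?thesis by (simp add: DERIV_def \<Phi>(3) lam0)
  qed
  have "p \<in> vanishing X" if p: "p \<in> polys ?n" and p0: "\<And>t. p (\<Phi> t) = 0" for p
  proof (rule ccontr)
    assume np: "p \<notin> vanishing X"
    define h where "h j = (if j < ?D then lam j else p)" for j
    have h: "h j \<in> polys ?n" for j by (simp add: h_def lam p)
    have "\<not> alg_independent X (Suc ?D) h" using alg_independent_le_dim[OF X, of "Suc ?D" h] by auto
    then obtain P where P: "P \<in> polys (Suc ?D)" "(\<lambda>x. P (\<lambda>j. h j x)) \<in> vanishing X" "P \<noteq> 0"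
      using h by (auto simp: alg_independent_def)
    obtain N c where c: "\<And>k. c k \<in> polys ?D" "\<And>x. P x = (\<Sum>k<(N::nat). c k x * x ?D ^ k)"
      using polys_expand_last[OF P(1)] by blast
    have "\<exists>k<N. \<exists>x. c k x \<noteq> 0"
    proof (rule ccontr)
      assume "\<not> ?thesis"
      then have "P = 0" using c(2) by (auto simp: fun_eq_iff)
      with P(3) show False by blast
    qed
    then obtain r where r: "r < N" "\<exists>x. c r x \<noteq> 0" and below: "\<And>k x. k < r \<Longrightarrow> c k x = 0"
      using lowest_nonzero_coefficient[of N c] by blast
    \<comment> \<open>The relation is \<open>p\<^sup>r Q\<close>, and the ideal is prime.\<close>
    define Q where "Q y = (\<Sum>k\<in>{r..<N}. c k (\<lambda>j. h j y) * p y ^ (k - r))" for y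
    have Q: "Q \<in> polys ?n" unfolding Q_def[abs_def]
      by (intro polys_intros p polys_subst[OF c(1)] h)
    have "P (\<lambda>j. h j y) = p y ^ r * Q y" for y
    proof -
      have "P (\<lambda>j. h j y) = (\<Sum>k<N. c k (\<lambda>j. h j y) * p y ^ k)" by (simp add: c(2) h_def)
      also have "\<dots> = (\<Sum>k\<in>{r..<N}. c k (\<lambda>j. h j y) * p y ^ k)"
        by (rule sum.mono_neutral_right) (auto simp: below)
      also have "\<dots> = p y ^ r * Q y" unfolding Q_def
        by (auto simp: sum_distrib_left power_add[symmetric] intro!: sum.cong)
      finally show ?thesis .
    qed
    then have "(\<lambda>y. p y ^ r * Q y) \<in> vanishing X" using P(2) by simp
    then have Qv: "Q \<in> vanishing X"
      using affine_variety_prime[OF X polys_power[OF p] Q] affine_variety_prime_power[OF X p] np by blast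
    have "c r y = 0" for y
    proof (rule no_relation_first_order[OF c(1), of "\<lambda>t s j. h j (\<Phi> (\<lambda>j. s * t j))"])
      show "((\<lambda>s. h i (\<Phi> (\<lambda>j. s * t j)) / s) \<longlongrightarrow> t i) (at 0)" if "i < ?D" for t i
        using lam\<Phi>[OF that] that by (simp add: h_def)
    next
      fix t s
      have "0 = Q (\<Phi> (\<lambda>j. s * t j))"
        using points_vanish[OF _ Qv] \<Phi>(2)[of "\<lambda>j. s * t j"] by (simp add: reg_def)
      also have "\<dots> = (\<Sum>k\<in>{r}. c k (\<lambda>j. h j (\<Phi> (\<lambda>j. s * t j))) * p (\<Phi> (\<lambda>j. s * t j)) ^ (k - r))"
        unfolding Q_def by (rule sum.mono_neutral_right) (use r in \<open>auto simp: p0\<close>)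
      finally show "c r (\<lambda>j. h j (\<Phi> (\<lambda>j. s * t j))) = 0" by simp
    qed
    then show False using r by blast
  qed
  then have "dominating X ?D \<Phi>" using \<Phi> by (simp add: dominating_def)
  then show ?thesis using that by blast
qed

section \<open>The tangent dimension is at least the dimension\<close>

text \<open>The witness is the determinant of the matrix, a polynomial in its entries.\<close>

lemma polynomial_matrix_invertible_locus:
  fixes M :: "nat \<Rightarrow> nat \<Rightarrow> point \<Rightarrow> real"
  assumes M: "\<And>i j. i < n \<Longrightarrow> j < n \<Longrightarrow> M i j \<in> polys m"
    and y: "\<And>i j. i < n \<Longrightarrow> j < n \<Longrightarrow> M i j y = (if i = j then 1 else 0)"
  shows "\<exists>h\<in>polys m. h y \<noteq> 0 \<and>
    (\<forall>x v. h x \<noteq> 0 \<longrightarrow> (\<forall>i<n. (\<Sum>j<n. M i j x * v j) = 0) \<longrightarrow> (\<forall>j<n. v j = 0))"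
proof -
  define A where "A x = Matrix.mat n n (\<lambda>(i, j). M i j x)" for x
  have A: "A x \<in> carrier_mat n n" for x by (simp add: A_def)
  define h where "h = (\<lambda>x. \<Sum>p\<in>{p. p permutes {0..<n}}. signof p * (\<Prod>i = 0..<n. M i (p i) x))"
  have h_det: "h x = Determinant.det (A x)" for x
    unfolding h_def det_def'[OF A]
    by (intro sum.cong refl arg_cong2[of _ _ _ _ "(*)"] prod.cong)
      (auto simp: A_def dest: permutes_in_image)
  have "h \<in> polys m" unfolding h_def
    by (intro polys_intros M) (auto dest: permutes_in_image)
  moreover have "A y = 1\<^sub>m n" by (rule eq_matI) (auto simp: A_def y)
  then have "h y \<noteq> 0" by (simp add: h_det)
  moreover have "v j = 0" if hx: "h x \<noteq> 0" and v: "\<And>i. i < n \<Longrightarrow> (\<Sum>j<n. M i j x * v j) = 0" and j: "j < n"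
    for x v j
  proof -
    have "A x *\<^sub>v Matrix.vec n v = 0\<^sub>v n"
    proof (rule eq_vecI)
      fix i assume "i < dim_vec (0\<^sub>v n :: real Matrix.vec)"
      then have i: "i < n" by simp
      then have "Matrix.vec_index (A x *\<^sub>v Matrix.vec n v) i = (\<Sum>j<n. M i j x * v j)"
        by (simp add: A_def scalar_prod_def atLeast0LessThan)
      then show "Matrix.vec_index (A x *\<^sub>v Matrix.vec n v) i = Matrix.vec_index (0\<^sub>v n) i"
        using v[OF i] i by simp
    qed (simp add: A_def)
    then have "Matrix.vec n v = 0\<^sub>v n"
      using det_0_iff_vec_prod_zero[OF A[of x]] hx vec_carrier[of n v] unfolding h_det by blast
    then have "Matrix.vec_index (Matrix.vec n v) j = Matrix.vec_index (0\<^sub>v n) j" by simp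
    then show ?thesis using j by simp
  qed
  ultimately show ?thesis by blast
qed

definition dot :: "nat \<Rightarrow> point \<Rightarrow> point \<Rightarrow> real"
  where "dot n v w = (\<Sum>i<n. v i * w i)"

lemma dot_linear:
  "dot n (v + v') w = dot n v w + dot n v' w" "dot n v (w + w') = dot n v w + dot n v w'"
  "dot n (v - v') w = dot n v w - dot n v' w"
  "dot n (c *\<^sub>R v) w = c * dot n v w" "dot n v (c *\<^sub>R w) = c * dot n v w"
  "dot n v 0 = 0" "dot n 0 w = 0" "dot n v (\<lambda>i. 0) = 0"
  by (simp_all add: dot_def scaleR_fun_def algebra_simps sum.distrib sum_subtractf sum_distrib_left)

lemma dot_self_zero:
  assumes "dot n v v = 0" "v \<in> affine_space n" shows "v = 0"
proof -
  have "v i * v i = 0" if "i < n" for i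
    using assms(1) that by (simp add: dot_def sum_nonneg_eq_0_iff)
  then show ?thesis using assms(2) by (auto simp: affine_space_def fun_eq_iff not_le[symmetric])
qed

lemma dot_orthogonal_span:
  assumes "\<And>b. b \<in> B \<Longrightarrow> dot n v b = 0" "w \<in> span B" shows "dot n v w = 0"
  using assms(2)
  by (induction rule: span_induct) (auto simp: subspace_def dot_linear assms(1))

text \<open>Gram-Schmidt, adding one vector \<open>b\<close> to the spanning set at a time: \<open>b'\<close> is its component orthogonal
  to the others. If that is zero, the default \<open>c = 0\<close> of the division is the right coefficient.\<close>

lemma orthogonal_projection:
  assumes "finite B" "B \<subseteq> affine_space n"
  shows "\<exists>w\<in>span B. \<forall>b\<in>span B. dot n (v - w) b = 0"
  using assms
proof (induction arbitrary: v rule: finite_induct)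
  case empty
  show ?case by (rule bexI[of _ 0]) (auto simp: dot_linear)
next
  case (insert b B)
  obtain wv where wv: "wv \<in> span B" "\<And>a. a \<in> span B \<Longrightarrow> dot n (v - wv) a = 0"
    using insert by blast
  obtain wb where wb: "wb \<in> span B" "\<And>a. a \<in> span B \<Longrightarrow> dot n (b - wb) a = 0"
    using insert by blast
  define b' where "b' = b - wb"
  have sB: "span B \<subseteq> span (insert b B)" by (rule span_mono) auto
  have b'A: "b' \<in> affine_space n"
  proof -
    have "span B \<subseteq> affine_space n" using insert.prems by (intro span_minimal affine_space_subspace) auto
    then show ?thesis unfolding b'_def using wb(1) insert.prems
      by (intro subspace_diff[OF affine_space_subspace]) auto
  qed
  define c where "c = dot n v b' / dot n b' b'"
  have wvb: "dot n wv b' = 0" using wb(2)[OF wv(1)] by (simp add: dot_def b'_def mult.commute)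
  have c: "dot n v b' = c * dot n b' b'"
  proof (cases "dot n b' b' = 0")
    case True
    then have "b' = 0" by (rule dot_self_zero[OF _ b'A])
    then show ?thesis by (simp add: dot_linear)
  qed (simp add: c_def)
  have o1: "dot n (v - (wv + c *\<^sub>R b')) a = 0" if "a \<in> span B" for a
    using wv(2)[OF that] wb(2)[OF that] by (simp add: dot_linear b'_def)
  have "dot n (v - (wv + c *\<^sub>R b')) b' = 0" using wvb c by (simp add: dot_linear)
  then have o2: "dot n (v - (wv + c *\<^sub>R b')) b = 0"
    using o1[OF wb(1)] dot_linear(2)[of n "v - (wv + c *\<^sub>R b')" b' wb] by (simp add: b'_def)
  show ?case
  proof (intro bexI[of _ "wv + c *\<^sub>R b'"] ballI)
    show "dot n (v - (wv + c *\<^sub>R b')) a = 0" if "a \<in> span (insert b B)" for a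
      by (rule dot_orthogonal_span[OF _ that]) (use o1 o2 span_base[of _ B] in auto)
    show "wv + c *\<^sub>R b' \<in> span (insert b B)" unfolding b'_def
      using sB wv(1) wb(1) span_base[of b "insert b B"] by (intro span_add span_scale span_diff) auto
  qed
qed

text \<open>The conormal space, i.e. the orthogonal complement of the tangent space.\<close>

definition conormals :: "variety \<Rightarrow> point \<Rightarrow> point set"
  where "conormals X y = (\<lambda>p i. if i < nvars X then grad (nvars X) p i y else 0) ` vanishing X"

lemma grad_eq_dpoly: "i < n \<Longrightarrow> grad n p i y = dpoly n p y (unit_point i)"
  by (simp add: dpoly_def unit_point_def mult_delta_left)

lemma conormals_subspace:
  assumes "ideal (vanishing X) (poly_ring (nvars X))" shows "subspace (conormals X y)"
proof -
  note I = polys_ideal_facts[OF assms]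
  let ?g = "\<lambda>p i. if i < nvars X then grad (nvars X) p i y else 0"
  have 0: "(0 :: point) = ?g (\<lambda>x. 0)"
    by (auto simp: fun_eq_iff grad_eq_dpoly dpoly_const)
  have 1: "?g p + ?g q = ?g (\<lambda>x. p x + q x)" if "p \<in> vanishing X" "q \<in> vanishing X" for p q
    using dpoly_add_poly[OF I(1)[OF that(1)] I(1)[OF that(2)]] by (auto simp: fun_eq_iff grad_eq_dpoly)
  have 2: "c *\<^sub>R ?g p = ?g (\<lambda>x. c * p x)" if "p \<in> vanishing X" for c p
    using dpoly_mult_poly[OF polys.const[of c] I(1)[OF that]]
    by (auto simp: fun_eq_iff grad_eq_dpoly scaleR_fun_def dpoly_const)
  show ?thesis unfolding subspace_def conormals_def
  proof (intro conjI ballI allI)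
    show "0 \<in> ?g ` vanishing X" unfolding 0 by (rule imageI[OF I(2)])
  next
    fix v w assume "v \<in> ?g ` vanishing X" "w \<in> ?g ` vanishing X"
    then obtain p q where pq: "p \<in> vanishing X" "q \<in> vanishing X" and e: "v = ?g p" "w = ?g q" by blast
    show "v + w \<in> ?g ` vanishing X" unfolding e 1[OF pq] by (rule imageI[OF I(3)[OF pq]])
  next
    fix c v assume "v \<in> ?g ` vanishing X"
    then obtain p where p: "p \<in> vanishing X" and e: "v = ?g p" by blast
    show "c *\<^sub>R v \<in> ?g ` vanishing X" unfolding e 2[OF p] by (rule imageI[OF I(5)[OF p polys.const]])
  qed
qed

lemma dim_affine_space_le: "dim (affine_space n) \<le> n"
  using dim_le_card[OF affine_space_span[of n]] card_image_le[of "{..<n}" unit_point] by simp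

text \<open>Decompose each unit vector at \<open>y\<close> into a conormal vector, which is the gradient of some element
  \<open>q i\<close> of the ideal, and a tangent vector. Keeping the tangent vectors fixed while the gradients vary
  with \<open>x\<close> gives a matrix that is the identity at \<open>y\<close>. Where it is invertible, a tangent vector at \<open>x\<close>
  that is orthogonal to the tangent space at \<open>y\<close> is zero, so the projection of one tangent space to
  the other is injective.\<close>

lemma tangent_dim_semicontinuous:
  assumes ideal: "ideal (vanishing X) (poly_ring (nvars X))"
  shows "\<exists>h\<in>polys (nvars X). h y \<noteq> 0 \<and>
    (\<forall>x. h x \<noteq> 0 \<longrightarrow> dim (tangent_space X x) \<le> dim (tangent_space X y))"
proof -
  let ?n = "nvars X"
  note I = polys_ideal_facts[OF ideal]
  have Ip: "vanishing X \<subseteq> polys ?n" using I(1) by blast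
  have cA: "conormals X y \<subseteq> affine_space ?n" by (auto simp: conormals_def affine_space_def)
  obtain B where B: "B \<subseteq> conormals X y" "independent B" "span B = conormals X y" "finite B"
    using affine_subspace_basis[OF conormals_subspace[OF ideal] cA] by metis
  have "\<forall>i. \<exists>w\<in>conormals X y. \<forall>b\<in>conormals X y. dot ?n (unit_point i - w) b = 0"
    using orthogonal_projection[OF B(4), of ?n] B(1,3) cA by auto
  then obtain w where w: "\<And>i. w i \<in> conormals X y"
    "\<And>i b. b \<in> conormals X y \<Longrightarrow> dot ?n (unit_point i - w i) b = 0" by metis
  have "\<forall>i. \<exists>q. q \<in> vanishing X \<and> w i = (\<lambda>j. if j < ?n then grad ?n q j y else 0)"
    using w(1) unfolding conormals_def by blast
  then obtain q where q: "\<And>i. q i \<in> vanishing X"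
    "\<And>i. w i = (\<lambda>j. if j < ?n then grad ?n (q i) j y else 0)" by metis
  have wT: "unit_point i - w i \<in> tangent_space X y" if "i < ?n" for i
    unfolding tangent_space_eq[OF Ip]
  proof (intro CollectI conjI ballI)
    show "unit_point i - w i \<in> affine_space ?n"
      using that by (auto simp: affine_space_def unit_point_def q(2))
  next
    fix p assume p: "p \<in> vanishing X"
    then have "dot ?n (unit_point i - w i) (\<lambda>j. if j < ?n then grad ?n p j y else 0) = 0"
      by (intro w(2)) (auto simp: conormals_def)
    then show "dpoly ?n p y (unit_point i - w i) = 0" by (simp add: dot_def dpoly_def)
  qed
  define M where "M i j x = grad ?n (q i) j x + (unit_point i - w i) j" for i j x
  have "\<exists>h\<in>polys ?n. h y \<noteq> 0 \<and>
    (\<forall>x v. h x \<noteq> 0 \<longrightarrow> (\<forall>i<?n. (\<Sum>j<?n. M i j x * v j) = 0) \<longrightarrow> (\<forall>j<?n. v j = 0))"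
    by (rule polynomial_matrix_invertible_locus)
      (use q Ip in \<open>auto simp: M_def[abs_def] unit_point_def intro!: polys_intros grad_polys\<close>)
  then obtain h where h: "h \<in> polys ?n" "h y \<noteq> 0"
    "\<forall>x v. h x \<noteq> 0 \<longrightarrow> (\<forall>i<?n. (\<Sum>j<?n. M i j x * v j) = 0) \<longrightarrow> (\<forall>j<?n. v j = 0)"
    by blast
  obtain C where C: "C \<subseteq> tangent_space X y" "span C = tangent_space X y" "finite C"
    "card C = dim (tangent_space X y)"
    using affine_subspace_basis[OF tangent_space_subspace[OF Ip]] tangent_space_affine[of _ X y] by (metis subsetI)
  let ?d = "card C"
  obtain b where b: "bij_betw b {0..<?d} C" using ex_bij_betw_nat_finite[OF C(3)] by auto
  define L where "L v = (\<lambda>k. if k < ?d then dot ?n v (b k) else 0)" for v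
  have L: "linear L" by (rule linearI) (auto simp: L_def dot_linear scaleR_fun_apply fun_eq_iff)
  have "dim (tangent_space X x) \<le> dim (tangent_space X y)" if hx: "h x \<noteq> 0" for x
  proof -
    have "dim (tangent_space X x) \<le> dim (affine_space ?d)"
    proof (rule dim_le_of_inj[OF tangent_space_subspace[OF Ip] _ L])
      show "tangent_space X x \<subseteq> affine_space ?n" using tangent_space_affine by blast
      show "inj_on L (tangent_space X x)"
      proof (subst linear_injective_on_subspace_0[OF L tangent_space_subspace[OF Ip]], intro ballI impI)
        fix v assume v: "v \<in> tangent_space X x" and Lv: "L v = 0"
        have "dot ?n v c = 0" if "c \<in> C" for c
        proof -
          have "c \<in> b ` {0..<?d}" using b that by (simp add: bij_betw_def)
          then obtain k where k: "k < ?d" "c = b k" by auto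
          have "L v k = 0" by (simp add: Lv)
          then show ?thesis using k by (simp add: L_def)
        qed
        then have o: "dot ?n v t = 0" if "t \<in> tangent_space X y" for t
          using dot_orthogonal_span[of C ?n v t] that C(2) by blast
        have "(\<Sum>j<?n. M i j x * v j) = 0" if i: "i < ?n" for i
        proof -
          have "(\<Sum>j<?n. M i j x * v j) = dpoly ?n (q i) x v + dot ?n v (unit_point i - w i)"
            by (simp add: M_def dpoly_def dot_def sum.distrib[symmetric] algebra_simps)
          also have "\<dots> = 0" using v q(1) o[OF wT[OF i]] unfolding tangent_space_eq[OF Ip] by simp
          finally show ?thesis .
        qed
        then have "\<forall>j<?n. v j = 0" using h(3) hx by blast
        then show "v = 0" using tangent_space_affine[OF v]
          by (auto simp: affine_space_def fun_eq_iff not_le[symmetric])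
      qed
    qed (auto simp: L_def affine_space_def intro: affine_space_subspace[unfolded affine_space_def])
    also have "\<dots> \<le> dim (tangent_space X y)" using dim_affine_space_le[of ?d] C(4) by simp
    finally show ?thesis .
  qed
  then show ?thesis using h(1,2) by blast
qed

text \<open>Semicontinuity compares \<open>y\<close> with some point in the dense set of regular points.\<close>

lemma tangent_dim_ge:
  assumes ideal: "ideal (vanishing X) (poly_ring (nvars X))"
    and d: "dominating X d \<Phi>" and y: "y \<in> points X"
  shows "variety_dim X \<le> dim (tangent_space X y)"
proof -
  obtain h where h: "h \<in> polys (nvars X)" "h y \<noteq> 0"
    "\<And>x. h x \<noteq> 0 \<Longrightarrow> dim (tangent_space X x) \<le> dim (tangent_space X y)"
    using tangent_dim_semicontinuous[OF ideal, of y] by blast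
  have "h \<notin> vanishing X" using points_vanish[OF y] h(2) by blast
  then obtain t where "h (\<Phi> t) \<noteq> 0" using d h(1) unfolding dominating_def by blast
  then have "dim (tangent_space X (\<Phi> t)) \<le> dim (tangent_space X y)" by (rule h(3))
  moreover have "\<Phi> t \<in> reg X" using d by (simp add: dominating_def)
  ultimately show ?thesis by (simp add: reg_def)
qed

section \<open>Suspensions\<close>

lemma dim_kernel_functional:
  assumes W: "subspace W" "W \<subseteq> affine_space m"
    and add: "\<And>v w. \<psi> (v + w) = \<psi> v + \<psi> w" and scale: "\<And>c v. \<psi> (c *\<^sub>R v) = c * \<psi> v"
    and w0: "w0 \<in> W" "\<psi> w0 \<noteq> (0::real)"
  shows "dim W = Suc (dim {v \<in> W. \<psi> v = 0})"
proof -
  let ?K = "{v \<in> W. \<psi> v = 0}"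
  have \<psi>0: "\<psi> 0 = 0" using scale[of 0 0] by simp
  have K: "subspace ?K" using W(1) by (auto simp: subspace_def add scale \<psi>0)
  obtain C where C: "C \<subseteq> ?K" "independent C" "span C = ?K" "finite C" "card C = dim ?K"
    using affine_subspace_basis[OF K, of m] W(2) by blast
  have "w0 \<notin> span C" using C(3) w0 by auto
  then have i: "independent (insert w0 C)" "w0 \<notin> C" using C(2) span_base[of w0 C] by (auto simp: independent_insert)
  have "span (insert w0 C) = W"
  proof
    show "span (insert w0 C) \<subseteq> W" using C(1) w0 by (intro span_minimal W(1)) auto
    show "W \<subseteq> span (insert w0 C)"
    proof
      fix v assume v: "v \<in> W"
      define c where "c = \<psi> v / \<psi> w0"
      have 1: "\<psi> (v + (- c) *\<^sub>R w0) = 0" unfolding add scale using w0(2) by (simp add: c_def)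
      have "v + (- c) *\<^sub>R w0 \<in> W" by (intro subspace_add subspace_scale W(1) v w0)
      then have "v + (- c) *\<^sub>R w0 \<in> span C" using 1 C(3) by blast
      then have "v + (- c) *\<^sub>R w0 \<in> span (insert w0 C)" using span_mono[of C "insert w0 C"] by auto
      moreover have "c *\<^sub>R w0 \<in> span (insert w0 C)" by (intro span_scale span_base) simp
      ultimately have "(v + (- c) *\<^sub>R w0) + c *\<^sub>R w0 \<in> span (insert w0 C)" by (rule span_add)
      then show "v \<in> span (insert w0 C)" by simp
    qed
  qed
  from dim_eqI_basis[OF i(1) this] show ?thesis using C i(2) by simp
qed

lemma polys_idealI:
  assumes J: "J \<subseteq> polys m" "(\<lambda>x. 0) \<in> J" "\<And>p q. p \<in> J \<Longrightarrow> q \<in> J \<Longrightarrow> (\<lambda>x. p x + q x) \<in> J"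
    "\<And>p q. p \<in> J \<Longrightarrow> q \<in> polys m \<Longrightarrow> (\<lambda>x. q x * p x) \<in> J"
  shows "ideal J (poly_ring m)"
proof -
  interpret cring "poly_ring m" by (rule cring_poly_ring)
  have l: "q * p \<in> J" if "p \<in> J" "q \<in> polys m" for p q
    using J(4)[OF that] by (simp add: times_fun_def)
  show ?thesis
  proof (rule idealI)
    show "ring (poly_ring m)" by (rule ring_axioms)
    show "subgroup J (add_monoid (poly_ring m))"
    proof (rule subgroup.intro)
      fix p assume p: "p \<in> J"
      have "\<ominus>\<^bsub>poly_ring m\<^esub> p = (\<lambda>x. - 1 * p x)"
        by (rule minus_equality) (use p J(1) in \<open>auto simp: fun_eq_iff intro!: polys_intros\<close>)
      then show "inv\<^bsub>add_monoid (poly_ring m)\<^esub> p \<in> J"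
        using J(4)[OF p polys.const[of "- 1"]] by (simp add: a_inv_def)
    qed (use J(1-3) in \<open>auto simp: plus_fun_def zero_fun_def\<close>)
    show "p \<otimes>\<^bsub>poly_ring m\<^esub> q \<in> J" if "q \<in> J" "p \<in> carrier (poly_ring m)" for p q
      using l that by simp
    show "q \<otimes>\<^bsub>poly_ring m\<^esub> p \<in> J" if "q \<in> J" "p \<in> carrier (poly_ring m)" for p q
      using l[of q p] that by (simp add: mult.commute)
  qed
qed

text \<open>Evaluation at a tangent vector, i.e. a ring homomorphism to the dual numbers; its kernel is an ideal.
  This reduces claims about all elements of a generated ideal to the generators.\<close>

lemma ideal_point_vector:
  "ideal {p \<in> polys m. p x = 0 \<and> dpoly m p x v = 0} (poly_ring m)"
  by (rule polys_idealI) (auto intro: polys_intros simp: dpoly_const dpoly_add_poly dpoly_mult_poly)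

lemma polys_split_last:
  assumes "P \<in> polys (Suc n)"
  obtains P0 P' where "P0 \<in> polys n" "P' \<in> polys (Suc n)" "\<And>x. P x = P0 x + x n * P' x"
proof -
  obtain N c where c: "\<And>k. c k \<in> polys n" "\<And>x. P x = (\<Sum>k<(N::nat). c k x * x n ^ k)"
    using polys_expand_last[OF assms] by blast
  show ?thesis
  proof (cases N)
    case 0
    then show ?thesis using that[of "\<lambda>x. 0" "\<lambda>x. 0"] c(2) by (simp add: polys.const)
  next
    case (Suc M)
    have "P x = c 0 x + x n * (\<Sum>k<M. c (Suc k) x * x n ^ k)" for x
      unfolding c(2) Suc sum.lessThan_Suc_shift by (simp add: sum_distrib_left mult_ac)
    moreover have "(\<lambda>x. \<Sum>k<M. c (Suc k) x * x n ^ k) \<in> polys (Suc n)"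
      by (intro polys_intros polys_mono[OF c(1)]) auto
    ultimately show ?thesis using that c(1) by blast
  qed
qed

lemma clear_denominators:
  assumes q: "q \<in> polys N"
    and c: "\<And>i. i < m \<Longrightarrow> \<exists>G\<in>polys N. \<forall>x. q x \<noteq> 0 \<longrightarrow> q x * c x i = G x"
    and p: "p \<in> polys m"
  shows "\<exists>e. \<exists>G\<in>polys N. \<forall>x. q x \<noteq> 0 \<longrightarrow> q x ^ e * p (c x) = G x"
  using p
proof (induction rule: polys.induct)
  case (const a)
  show ?case by (rule exI[of _ 0], rule bexI[of _ "\<lambda>x. a"]) (auto intro: polys.const)
next
  case (var i)
  then show ?case using c[OF var] by (intro exI[of _ 1]) simp
next
  case (add p1 p2)
  then obtain e1 G1 e2 G2 where G: "G1 \<in> polys N" "G2 \<in> polys N"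
    "\<And>x. q x \<noteq> 0 \<Longrightarrow> q x ^ e1 * p1 (c x) = G1 x" "\<And>x. q x \<noteq> 0 \<Longrightarrow> q x ^ e2 * p2 (c x) = G2 x" by blast
  show ?case
  proof (intro exI[of _ "e1 + e2"] bexI[of _ "\<lambda>x. q x ^ e2 * G1 x + q x ^ e1 * G2 x"] allI impI)
    fix x assume "q x \<noteq> 0"
    from G(3,4)[OF this, symmetric]
    show "q x ^ (e1 + e2) * (p1 + p2) (c x) = q x ^ e2 * G1 x + q x ^ e1 * G2 x"
      by (simp add: power_add algebra_simps)
  qed (intro polys_intros q G)
next
  case (mult p1 p2)
  then obtain e1 G1 e2 G2 where G: "G1 \<in> polys N" "G2 \<in> polys N"
    "\<And>x. q x \<noteq> 0 \<Longrightarrow> q x ^ e1 * p1 (c x) = G1 x" "\<And>x. q x \<noteq> 0 \<Longrightarrow> q x ^ e2 * p2 (c x) = G2 x" by blast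
  show ?case
  proof (intro exI[of _ "e1 + e2"] bexI[of _ "\<lambda>x. G1 x * G2 x"] allI impI)
    fix x assume "q x \<noteq> 0"
    from G(3,4)[OF this, symmetric]
    show "q x ^ (e1 + e2) * (p1 * p2) (c x) = G1 x * G2 x"
      by (simp add: power_add algebra_simps)
  qed (intro polys_intros q G)
qed

definition trunc :: "nat \<Rightarrow> point \<Rightarrow> point" where "trunc n x = (\<lambda>i. if i < n then x i else 0)"

lemma trunc_affine [simp]: "trunc n x \<in> affine_space n"
  by (simp add: trunc_def affine_space_def)

lemma polys_trunc: "p \<in> polys n \<Longrightarrow> p (trunc n x) = p x"
  by (rule polys_cong) (auto simp: trunc_def)

text \<open>A parametrization of the base is part of the data, so that identities on the suspension become
  identities of polynomials in \<open>variety_dim Y + 1\<close> variables.\<close>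

locale suspension =
  fixes Y :: variety and f :: "point \<Rightarrow> real" and \<Phi> :: "point \<Rightarrow> point"
  assumes Y: "affine_variety Y" and f: "f \<in> polys (nvars Y)"
    and dom: "dominating Y (variety_dim Y) \<Phi>" and f_surj: "f ` reg Y = UNIV"
begin

abbreviation n where "n \<equiv> nvars Y"
abbreviation d where "d \<equiv> variety_dim Y"
abbreviation S where "S \<equiv> Susp Y f"
abbreviation sp where "sp y u v \<equiv> y(n := u, Suc n := v)"

lemma nvars_S [simp]: "nvars S = Suc (Suc n)"
  by (simp add: Susp_def)

lemmas IY = polys_ideal_facts[OF affine_variety_ideal[OF Y]]

lemma f2: "f \<in> polys (Suc n)" "f \<in> polys (Suc (Suc n))"
  using polys_mono[OF f] by auto

lemma IY_sub: "vanishing Y \<subseteq> polys n" using IY(1) by blast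

abbreviation "eqn \<equiv> \<lambda>x. f x - x n * x (Suc n)"

lemma gens_polys: "vanishing Y \<union> {eqn} \<subseteq> polys (Suc (Suc n))"
  using polys_mono[of _ n "Suc (Suc n)"] IY(1) by (auto intro!: polys_intros f2)

lemma vanishing_S: "vanishing S = genideal (poly_ring (Suc (Suc n))) (vanishing Y \<union> {eqn})"
  by (simp add: Susp_def)

lemma ideal_S: "ideal (vanishing S) (poly_ring (nvars S))"
  unfolding vanishing_S nvars_S
  by (rule ring.genideal_ideal[OF cring.axioms(1)[OF cring_poly_ring]]) (use gens_polys in simp)

lemmas IS = polys_ideal_facts[OF ideal_S, unfolded nvars_S]

lemma IS_sub: "vanishing S \<subseteq> polys (Suc (Suc n))" using IS(1) by blast

lemma gens_in: "vanishing Y \<subseteq> vanishing S" "eqn \<in> vanishing S"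
  using ring.genideal_self[OF cring.axioms(1)[OF cring_poly_ring], of "vanishing Y \<union> {eqn}" "Suc (Suc n)"]
    gens_polys by (auto simp: vanishing_S)

lemma vanishing_S_minimal:
  "ideal J (poly_ring (Suc (Suc n))) \<Longrightarrow> vanishing Y \<subseteq> J \<Longrightarrow> eqn \<in> J \<Longrightarrow> vanishing S \<subseteq> J"
  unfolding vanishing_S
  by (rule ring.genideal_minimal[OF cring.axioms(1)[OF cring_poly_ring]]) auto

lemma points_S:
  "x \<in> points S \<longleftrightarrow> x \<in> affine_space (Suc (Suc n)) \<and> trunc n x \<in> points Y \<and> f x = x n * x (Suc n)"
proof
  assume x: "x \<in> points S"
  have "p (trunc n x) = 0" if "p \<in> vanishing Y" for p
  proof -
    have "p x = 0" using points_vanish[OF x] that gens_in(1) by blast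
    then show ?thesis using polys_trunc[OF IY(1)[OF that]] by simp
  qed
  then have "trunc n x \<in> points Y" by (simp add: points_def)
  then show "x \<in> affine_space (Suc (Suc n)) \<and> trunc n x \<in> points Y \<and> f x = x n * x (Suc n)"
    using points_vanish[OF x gens_in(2)] points_affine_space[OF x] by simp
next
  assume x: "x \<in> affine_space (Suc (Suc n)) \<and> trunc n x \<in> points Y \<and> f x = x n * x (Suc n)"
  have "p x = 0" if "p \<in> vanishing Y" for p
    using points_vanish[of "trunc n x" Y p] x that polys_trunc[OF IY(1)[OF that], of x] by simp
  then have "vanishing S \<subseteq> {p \<in> polys (Suc (Suc n)). p x = 0 \<and> dpoly (Suc (Suc n)) p x 0 = 0}"
    by (intro vanishing_S_minimal[OF ideal_point_vector]) (use x gens_polys in \<open>auto simp: dpoly_lin\<close>)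
  then show "x \<in> points S" using x by (auto simp: points_def)
qed

lemma sp_points: "y \<in> affine_space n \<Longrightarrow> sp y u v \<in> points S \<longleftrightarrow> y \<in> points Y \<and> f y = u * v"
proof -
  assume y: "y \<in> affine_space n"
  have "trunc n (sp y u v) = y" using y by (auto simp: trunc_def affine_space_def)
  moreover have "f (sp y u v) = f y" by (rule polys_cong[OF f]) auto
  moreover have "sp y u v \<in> affine_space (Suc (Suc n))" using y by (auto simp: affine_space_def)
  ultimately show ?thesis by (simp add: points_S)
qed

lemma sp_trunc: "x \<in> affine_space (Suc (Suc n)) \<Longrightarrow> sp (trunc n x) (x n) (x (Suc n)) = x"
proof
  fix i assume "x \<in> affine_space (Suc (Suc n))"
  then show "sp (trunc n x) (x n) (x (Suc n)) i = x i"
    by (cases "i < n"; cases "i = n"; cases "i = Suc n") (auto simp: trunc_def affine_space_def)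
qed

lemma \<Phi>_reg: "\<Phi> t \<in> reg Y" using dom by (simp add: dominating_def)
lemma \<Phi>_affine: "\<Phi> t \<in> affine_space n" using \<Phi>_reg[of t] by (simp add: reg_def points_def)
lemma \<Phi>_poly: "i < n \<Longrightarrow> (\<lambda>t. \<Phi> t i) \<in> polys d" using dom by (simp add: dominating_def)
lemma \<Phi>_dense: "p \<in> polys n \<Longrightarrow> (\<And>t. p (\<Phi> t) = 0) \<Longrightarrow> p \<in> vanishing Y"
  using dom by (simp add: dominating_def)

lemma f_not_vanishing: "f \<notin> vanishing Y"
proof
  assume "f \<in> vanishing Y"
  moreover obtain y where "y \<in> reg Y" "f y = 1" using f_surj by (metis UNIV_I imageE)
  ultimately show False using points_vanish[of y Y f] by (simp add: reg_def)
qed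

text \<open>A normal form modulo \<open>f - uv\<close>: mixed monomials reduce since \<open>uv\<close> may be replaced by \<open>f\<close>, which
  leaves a polynomial \<open>A\<close> in \<open>u\<close> and a multiple \<open>v B\<close> of a polynomial in \<open>v\<close>, both over the base. The
  polynomial \<open>B\<close> is stored with \<open>v\<close> in the place of \<open>u\<close>.\<close>

definition separated :: "(point \<Rightarrow> real) \<Rightarrow> bool"
  where "separated p \<longleftrightarrow> (\<exists>A\<in>polys (Suc n). \<exists>B\<in>polys (Suc n).
    (\<lambda>x. p x - (A x + x (Suc n) * B (x(n := x (Suc n))))) \<in> vanishing S)"

lemma subst_v: "B \<in> polys (Suc n) \<Longrightarrow> (\<lambda>x. B (x(n := x (Suc n)))) \<in> polys (Suc (Suc n))"
proof (rule polys_subst[where g = "\<lambda>x. x(n := x (Suc n))"])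
  fix j assume "j < Suc n"
  then show "(\<lambda>x. (x(n := x (Suc n))) j) \<in> polys (Suc (Suc n))"
    by (cases "j = n") (auto simp: polys.var)
qed

lemma separated_add: "separated p \<Longrightarrow> separated q \<Longrightarrow> separated (\<lambda>x. p x + q x)"
proof -
  assume "separated p" "separated q"
  then obtain A B A' B' where 1: "A \<in> polys (Suc n)" "B \<in> polys (Suc n)" "A' \<in> polys (Suc n)" "B' \<in> polys (Suc n)"
    and 2: "(\<lambda>x. p x - (A x + x (Suc n) * B (x(n := x (Suc n))))) \<in> vanishing S"
    "(\<lambda>x. q x - (A' x + x (Suc n) * B' (x(n := x (Suc n))))) \<in> vanishing S"
    unfolding separated_def by blast
  show ?thesis unfolding separated_def
    by (rule bexI[where x = "\<lambda>x. A x + A' x"], rule bexI[where x = "\<lambda>x. B x + B' x"])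
      (use IS(3)[OF 2] in \<open>simp_all add: algebra_simps polys_add 1\<close>)
qed

lemma separated_cong: "separated p \<Longrightarrow> (\<lambda>x. q x - p x) \<in> vanishing S \<Longrightarrow> separated q"
proof -
  assume "separated p" and j: "(\<lambda>x. q x - p x) \<in> vanishing S"
  then obtain A B where 1: "A \<in> polys (Suc n)" "B \<in> polys (Suc n)"
    and 2: "(\<lambda>x. p x - (A x + x (Suc n) * B (x(n := x (Suc n))))) \<in> vanishing S"
    unfolding separated_def by blast
  show ?thesis unfolding separated_def
    by (rule bexI[where x = A], rule bexI[where x = B]) (use IS(3)[OF 2 j] in \<open>simp_all add: algebra_simps 1\<close>)
qed

lemma separated_base: "A \<in> polys (Suc n) \<Longrightarrow> B \<in> polys (Suc n) \<Longrightarrow>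
    separated (\<lambda>x. A x + x (Suc n) * B (x(n := x (Suc n))))"
  unfolding separated_def 
  by (rule bexI[where x = A], rule bexI[where x = B]) (simp_all add: IS(2))

lemma separated_mult_u:
  assumes "A \<in> polys (Suc n)" "B \<in> polys (Suc n)"
  shows "separated (\<lambda>x. x n * (A x + x (Suc n) * B (x(n := x (Suc n)))))"
proof -
  obtain B0 B' where B: "B0 \<in> polys n" "B' \<in> polys (Suc n)" "\<And>x. B x = B0 x + x n * B' x"
    using polys_split_last[OF assms(2)] by metis
  have B0: "B0 (x(n := a)) = B0 x" for x a by (rule polys_cong[OF B(1)]) auto
  have f': "f (x(n := a)) = f x" for x a by (rule polys_cong[OF f]) auto
  have sep: "separated (\<lambda>x. (x n * A x + f x * B0 x) + x (Suc n) * (\<lambda>x. f x * B' x) (x(n := x (Suc n))))"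
    by (rule separated_base) (auto intro!: polys_intros assms B f2 polys_mono[OF B(1)])
  have eq: "(\<lambda>x. - B (x(n := x (Suc n))) * eqn x) \<in> vanishing S"
    by (rule IS(5)[OF gens_in(2)]) (intro polys_uminus subst_v assms)
  show ?thesis by (rule separated_cong[OF sep]) (use eq in \<open>simp add: B(3) B0 f' algebra_simps\<close>)
qed

lemma separated_mult_v:
  assumes "A \<in> polys (Suc n)" "B \<in> polys (Suc n)"
  shows "separated (\<lambda>x. x (Suc n) * (A x + x (Suc n) * B (x(n := x (Suc n)))))"
proof -
  obtain A0 A' where A: "A0 \<in> polys n" "A' \<in> polys (Suc n)" "\<And>x. A x = A0 x + x n * A' x"
    using polys_split_last[OF assms(1)] by metis
  have A0: "A0 (x(n := a)) = A0 x" for x a by (rule polys_cong[OF A(1)]) auto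
  have sep: "separated (\<lambda>x. f x * A' x + x (Suc n) * (\<lambda>x. A0 x + x n * B x) (x(n := x (Suc n))))"
    by (rule separated_base) (auto intro!: polys_intros assms A f2 polys_mono[OF A(1)])
  have eq: "(\<lambda>x. - A' x * eqn x) \<in> vanishing S"
    by (rule IS(5)[OF gens_in(2)]) (intro polys_uminus polys_mono[OF A(2)], simp)
  show ?thesis by (rule separated_cong[OF sep]) (use eq in \<open>simp add: A(3) A0 algebra_simps\<close>)
qed

lemma separated_mult_y:
  assumes "i < n" "A \<in> polys (Suc n)" "B \<in> polys (Suc n)"
  shows "separated (\<lambda>x. x i * (A x + x (Suc n) * B (x(n := x (Suc n)))))"
proof -
  have "separated (\<lambda>x. x i * A x + x (Suc n) * (\<lambda>x. x i * B x) (x(n := x (Suc n))))"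
    by (rule separated_base) (use assms in \<open>auto intro!: polys_intros\<close>)
  then show ?thesis using assms(1) by (simp add: algebra_simps)
qed

lemma separated_mult:
  "p \<in> polys (Suc (Suc n)) \<Longrightarrow> separated q \<Longrightarrow> separated (\<lambda>x. p x * q x)"
proof (induction arbitrary: q rule: polys.induct)
  case (const c)
  then obtain A B where 1: "A \<in> polys (Suc n)" "B \<in> polys (Suc n)"
    and 2: "(\<lambda>x. q x - (A x + x (Suc n) * B (x(n := x (Suc n))))) \<in> vanishing S"
    unfolding separated_def by blast
  show ?case unfolding separated_def
    by (rule bexI[where x = "\<lambda>x. c * A x"], rule bexI[where x = "\<lambda>x. c * B x"])
      (use IS(5)[OF 2 polys.const[of c]] in \<open>simp_all add: algebra_simps polys_intros 1\<close>)
next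
  case (var i)
  then obtain A B where 1: "A \<in> polys (Suc n)" "B \<in> polys (Suc n)"
    and 2: "(\<lambda>x. q x - (A x + x (Suc n) * B (x(n := x (Suc n))))) \<in> vanishing S"
    unfolding separated_def by blast
  have sep: "separated (\<lambda>x. x i * (A x + x (Suc n) * B (x(n := x (Suc n)))))"
    using separated_mult_u[OF 1] separated_mult_v[OF 1] separated_mult_y[OF _ 1, of i] var.hyps
    by (cases "i < n"; cases "i = n"; cases "i = Suc n") auto
  have eq: "(\<lambda>x. x i * (q x - (A x + x (Suc n) * B (x(n := x (Suc n)))))) \<in> vanishing S"
    by (rule IS(5)[OF 2 polys.var[OF var.hyps]])
  show ?case by (rule separated_cong[OF sep]) (use eq in \<open>simp add: algebra_simps\<close>)
next
  case (add p p')
  then show ?case using separated_add by (simp add: distrib_right)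
next
  case (mult p p')
  then show ?case by (simp add: mult.assoc)
qed

lemma separated_all: assumes "p \<in> polys (Suc (Suc n))" shows "separated p"
proof -
  have "separated (\<lambda>x. 1 + x (Suc n) * (\<lambda>x. 0) (x(n := x (Suc n))))"
    by (rule separated_base) (auto intro: polys.const)
  from separated_mult[OF assms this] show ?thesis by simp
qed

abbreviation \<Psi> where "\<Psi> t u \<equiv> sp (\<Phi> t) u (f (\<Phi> t) / u)"

lemma \<Psi>_points: "u \<noteq> 0 \<Longrightarrow> \<Psi> t u \<in> points S"
  using \<Phi>_reg[of t] by (simp add: sp_points[OF \<Phi>_affine] reg_def)

text \<open>Over a point \<open>\<Phi> t\<close> the separated form becomes a Laurent polynomial in \<open>u\<close> in which no two terms have the
  same degree. If it vanishes for all \<open>u \<noteq> 0\<close>, all coefficients vanish; being polynomials on the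
  base, they lie in its ideal because the points \<open>\<Phi> t\<close> are dense there. The coefficients of the powers
  of \<open>v\<close> come with powers of \<open>f\<close>, which can be cancelled since the ideal of the base is prime.\<close>

lemma vanishing_S_iff:
  "p \<in> vanishing S \<longleftrightarrow> p \<in> polys (Suc (Suc n)) \<and> (\<forall>t u. u \<noteq> 0 \<longrightarrow> p (\<Psi> t u) = 0)"
proof
  assume "p \<in> vanishing S"
  then show "p \<in> polys (Suc (Suc n)) \<and> (\<forall>t u. u \<noteq> 0 \<longrightarrow> p (\<Psi> t u) = 0)"
    using IS(1) points_vanish[OF \<Psi>_points] by blast
next
  assume p: "p \<in> polys (Suc (Suc n)) \<and> (\<forall>t u. u \<noteq> 0 \<longrightarrow> p (\<Psi> t u) = 0)"
  obtain A B where AB: "A \<in> polys (Suc n)" "B \<in> polys (Suc n)"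
    and pAB: "(\<lambda>x. p x - (A x + x (Suc n) * B (x(n := x (Suc n))))) \<in> vanishing S"
    using separated_all[of p] p unfolding separated_def by blast
  obtain N a where a: "\<And>k. a k \<in> polys n" "\<And>x. A x = (\<Sum>k<(N::nat). a k x * x n ^ k)"
    using polys_expand_last[OF AB(1)] by blast
  obtain M b where b: "\<And>k. b k \<in> polys n" "\<And>x. B x = (\<Sum>k<(M::nat). b k x * x n ^ k)"
    using polys_expand_last[OF AB(2)] by blast
  have coeffs: "(\<forall>k<N. a k (\<Phi> t) = 0) \<and> (\<forall>k<M. b k (\<Phi> t) * f (\<Phi> t) ^ Suc k = 0)" for t
  proof -
    let ?y = "\<Phi> t"
    \<comment> \<open>The Laurent polynomial times \<open>u\<^sup>M\<close>: the powers \<open>v\<^sup>k\<^sup>+\<^sup>1\<close> occupy the degrees below \<open>M\<close>.\<close>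
    define c where "c e = (if e < M then b (M - Suc e) ?y * f ?y ^ (M - e) else a (e - M) ?y)" for e
    have z: "(\<Sum>e<M + N. c e * u ^ e) = 0" if u: "u \<noteq> 0" for u
    proof -
      have ay: "a k (sp y r s) = a k y" "b k (sp y r s) = b k y" for k y r s
        by (rule polys_cong[OF a(1)], simp, rule polys_cong[OF b(1)], simp)
      have "A (\<Psi> t u) + (\<Psi> t u) (Suc n) * B ((\<Psi> t u)(n := (\<Psi> t u) (Suc n))) = 0"
        using points_vanish[OF \<Psi>_points[OF u] pAB, of t] p u by simp
      moreover have "A (\<Psi> t u) = (\<Sum>k<N. a k ?y * u ^ k)" by (simp add: a(2) ay)
      moreover have "B ((\<Psi> t u)(n := (\<Psi> t u) (Suc n))) = (\<Sum>k<M. b k ?y * (f ?y / u) ^ k)"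
      proof -
        have "b k ((\<Psi> t u)(n := w)) = b k ?y" for k w by (rule polys_cong[OF b(1)]) auto
        then show ?thesis by (simp add: b(2))
      qed
      ultimately have "(\<Sum>k<N. a k ?y * u ^ k) + (f ?y / u) * (\<Sum>k<M. b k ?y * (f ?y / u) ^ k) = 0" by simp
      then have "0 = u ^ M * ((\<Sum>k<N. a k ?y * u ^ k) + (f ?y / u) * (\<Sum>k<M. b k ?y * (f ?y / u) ^ k))" by simp
      also have "\<dots> = (\<Sum>k<M. b k ?y * f ?y ^ Suc k * u ^ (M - Suc k)) + (\<Sum>k<N. a k ?y * u ^ (M + k))"
      proof -
        have "u ^ M * (f ?y / u * (b k ?y * (f ?y / u) ^ k)) = b k ?y * f ?y ^ Suc k * u ^ (M - Suc k)"
          if "k < M" for k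
        proof -
          have "u ^ M = u ^ ((M - Suc k) + Suc k)" using that by simp
          then have "u ^ M = u ^ (M - Suc k) * u ^ Suc k" by (simp only: power_add)
          then show ?thesis using u by (simp add: power_divide)
        qed
        then have "(\<Sum>k<M. u ^ M * (f ?y / u * (b k ?y * (f ?y / u) ^ k)))
            = (\<Sum>k<M. b k ?y * f ?y ^ Suc k * u ^ (M - Suc k))" by (intro sum.cong) auto
        moreover have "(\<Sum>k<N. u ^ M * (a k ?y * u ^ k)) = (\<Sum>k<N. a k ?y * u ^ (M + k))"
          by (simp add: power_add mult_ac)
        ultimately show ?thesis by (simp only: distrib_left sum_distrib_left add.commute)
      qed
      also have "(\<Sum>k<M. b k ?y * f ?y ^ Suc k * u ^ (M - Suc k)) = (\<Sum>e<M. c e * u ^ e)"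
        by (subst sum.nat_diff_reindex[symmetric]) (auto simp: c_def Suc_diff_Suc intro!: sum.cong)
      also have "(\<Sum>k<N. a k ?y * u ^ (M + k)) = (\<Sum>e\<in>{M..<M + N}. c e * u ^ e)"
        by (rule sum.reindex_bij_witness[of _ "\<lambda>e. e - M" "\<lambda>k. M + k"]) (auto simp: c_def)
      also have "(\<Sum>e<M. c e * u ^ e) + (\<Sum>e\<in>{M..<M + N}. c e * u ^ e) = (\<Sum>e<M + N. c e * u ^ e)"
        by (subst sum.union_disjoint[symmetric]) (auto intro!: sum.cong)
      finally show ?thesis by simp
    qed
    have c0: "c e = 0" if "e < M + N" for e
      by (rule upoly_sum_powers_zero[OF infinite_nonzero_reals _ that]) (use z in auto)
    show ?thesis
    proof (intro conjI allI impI)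
      fix k assume "k < N" then show "a k ?y = 0" using c0[of "M + k"] by (simp add: c_def)
    next
      fix k assume "k < M"
      then show "b k ?y * f ?y ^ Suc k = 0" using c0[of "M - Suc k"] by (simp add: c_def Suc_diff_Suc)
    qed
  qed
  have av: "a k \<in> vanishing S" if "k < N" for k
    using \<Phi>_dense[OF a(1)] coeffs that gens_in(1) by blast
  have bv: "b k \<in> vanishing S" if "k < M" for k
  proof -
    have "(\<lambda>x. b k x * f x ^ Suc k) \<in> vanishing Y"
      by (rule \<Phi>_dense[OF polys_mult[OF b(1) polys_power[OF f]]]) (use coeffs that in blast)
    from affine_variety_prime[OF Y b(1) polys_power[OF f] this]
    show ?thesis using affine_variety_prime_power[OF Y f] f_not_vanishing gens_in(1) by blast
  qed
  have "(\<lambda>x. \<Sum>k<N. a k x * x n ^ k) \<in> vanishing S"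
    by (intro IS(7) IS(4) av polys_intros) auto
  then have A: "A \<in> vanishing S" by (simp add: a(2)[abs_def])
  have "(\<lambda>x. x (Suc n) * (\<Sum>k<M. b k x * x (Suc n) ^ k)) \<in> vanishing S"
    by (intro IS(7) IS(5) IS(4) bv polys_intros) auto
  moreover have "b k (x(n := w)) = b k x" for k x w by (rule polys_cong[OF b(1)]) auto
  ultimately have B: "(\<lambda>x. x (Suc n) * B (x(n := x (Suc n)))) \<in> vanishing S" by (simp add: b(2))
  show "p \<in> vanishing S" using IS(3)[OF pAB IS(3)[OF A B]] by simp
qed

end

context suspension
begin

lemma \<Phi>_upd: "d \<le> i \<Longrightarrow> \<Phi> (x(i := a)) = \<Phi> x"
  by (rule affine_space_eqI[OF \<Phi>_affine \<Phi>_affine]) (auto intro: polys_cong[OF \<Phi>_poly])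

lemma polys_\<Phi>: "p \<in> polys n \<Longrightarrow> (\<lambda>t. p (\<Phi> t)) \<in> polys d"
  using polys_subst[of p n \<Phi> d] \<Phi>_poly by simp

text \<open>Pulling back along \<open>(t, u) \<mapsto> (\<Phi> t, u, f (\<Phi> t) / u)\<close> embeds the coordinate ring of the
  suspension into a polynomial ring in \<open>d + 1\<close> variables localized at \<open>u\<close>.\<close>

lemma pullback_ex:
  assumes "p \<in> polys (Suc (Suc n))"
  shows "\<exists>e. \<exists>G\<in>polys (Suc d). \<forall>x. x d \<noteq> 0 \<longrightarrow> x d ^ e * p (\<Psi> x (x d)) = G x"
proof (rule clear_denominators[where q = "\<lambda>x. x d" and c = "\<lambda>x. \<Psi> x (x d)", OF _ _ assms])
  show "(\<lambda>x. x d) \<in> polys (Suc d)" by (rule polys.var) simp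
  fix i assume i: "i < Suc (Suc n)"
  consider "i < n" | "i = n" | "i = Suc n" using i by linarith
  then show "\<exists>G\<in>polys (Suc d). \<forall>x. x d \<noteq> 0 \<longrightarrow> x d * (\<Psi> x (x d)) i = G x"
  proof cases
    case 1
    show ?thesis
      by (rule bexI[of _ "\<lambda>x. x d * \<Phi> x i"])
        (use 1 in \<open>auto intro!: polys_intros polys_mono[OF \<Phi>_poly]\<close>)
  next
    case 2
    show ?thesis
      by (rule bexI[of _ "\<lambda>x. x d * x d"]) (use 2 in \<open>auto intro!: polys_intros\<close>)
  next
    case 3
    show ?thesis
      by (rule bexI[of _ "\<lambda>x. f (\<Phi> x)"]) (use 3 in \<open>auto intro!: polys_mono[OF polys_\<Phi>[OF f]]\<close>)
  qed
qed

lemma vanishing_S_iff_points: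
  "p \<in> vanishing S \<longleftrightarrow> p \<in> polys (Suc (Suc n)) \<and> (\<forall>x\<in>points S. p x = 0)"
  using vanishing_S_iff[of p] \<Psi>_points points_vanish[of _ S p] by blast

lemma vanishing_S_iff':
  "p \<in> vanishing S \<longleftrightarrow> p \<in> polys (Suc (Suc n)) \<and> (\<forall>x. x d \<noteq> 0 \<longrightarrow> p (\<Psi> x (x d)) = 0)"
proof -
  have "(\<forall>x. x d \<noteq> 0 \<longrightarrow> p (\<Psi> x (x d)) = 0) \<longleftrightarrow> (\<forall>t u. u \<noteq> 0 \<longrightarrow> p (\<Psi> t u) = 0)"
  proof (intro iffI allI impI)
    fix t and u :: real
    assume "\<forall>x. x d \<noteq> 0 \<longrightarrow> p (\<Psi> x (x d)) = 0" "u \<noteq> 0"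
    from this(1)[rule_format, of "t(d := u)"] this(2)
    show "p (\<Psi> t u) = 0" by (simp add: \<Phi>_upd)
  qed blast
  then show ?thesis unfolding vanishing_S_iff by blast
qed

lemma affine_variety_S: "affine_variety S"
  unfolding affine_variety_def
proof (rule primeidealI[OF ideal_S cring_poly_ring], unfold poly_ring_simps nvars_S)
  have "(\<lambda>x. 1) \<notin> vanishing S" unfolding vanishing_S_iff by (auto intro!: exI[of _ "1::real"])
  then show "polys (Suc (Suc n)) \<noteq> vanishing S" using polys.const[of 1 "Suc (Suc n)"] by blast
next
  fix p q assume p: "p \<in> polys (Suc (Suc n))" and q: "q \<in> polys (Suc (Suc n))" and pq: "p * q \<in> vanishing S"
  obtain e G where G: "G \<in> polys (Suc d)" "\<And>x. x d \<noteq> 0 \<Longrightarrow> x d ^ e * p (\<Psi> x (x d)) = G x"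
    using pullback_ex[OF p] by blast
  obtain e' G' where G': "G' \<in> polys (Suc d)" "\<And>x. x d \<noteq> 0 \<Longrightarrow> x d ^ e' * q (\<Psi> x (x d)) = G' x"
    using pullback_ex[OF q] by blast
  have "G x * G' x = 0" for x
  proof (rule polys_zero_off_hyperplane[of "\<lambda>x. G x * G' x" "Suc d" d])
    show "(\<lambda>x. G x * G' x) \<in> polys (Suc d)" by (intro polys_mult G G')
    fix x :: point assume x: "x d \<noteq> 0"
    then have "p (\<Psi> x (x d)) * q (\<Psi> x (x d)) = 0" using pq unfolding vanishing_S_iff' by simp
    then show "G x * G' x = 0" using G(2)[of x] G'(2)[of x] x by auto
  qed simp
  then have "(\<forall>x. G x = 0) \<or> (\<forall>x. G' x = 0)" by (rule polys_integral[OF G(1) G'(1)])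
  then show "p \<in> vanishing S \<or> q \<in> vanishing S"
  proof
    assume z: "\<forall>x. G x = 0"
    have "p (\<Psi> x (x d)) = 0" if "x d \<noteq> 0" for x using G(2)[of x] z that by simp
    then show ?thesis using p unfolding vanishing_S_iff' by blast
  next
    assume z: "\<forall>x. G' x = 0"
    have "q (\<Psi> x (x d)) = 0" if "x d \<noteq> 0" for x using G'(2)[of x] z that by simp
    then show ?thesis using q unfolding vanishing_S_iff' by blast
  qed
qed

text \<open>Pulled back, the functions are rational functions in \<open>d + 1\<close> variables with a power of \<open>u\<close> as common
  denominator.\<close>

lemma alg_independent_S_le:
  assumes g: "alg_independent S k g" shows "k \<le> Suc d"
proof (rule ccontr)
  assume "\<not> ?thesis"
  then have k: "Suc d < k" by simp
  have gp: "g j \<in> polys (Suc (Suc n))" if "j < k" for j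
    using g that by (simp add: alg_independent_def)
  have "\<forall>j. \<exists>e G. j < k \<longrightarrow> G \<in> polys (Suc d) \<and> (\<forall>x. x d \<noteq> 0 \<longrightarrow> x d ^ e * g j (\<Psi> x (x d)) = G x)"
    using pullback_ex[OF gp] by blast
  then obtain e G where G: "\<And>j. j < k \<Longrightarrow> G j \<in> polys (Suc d)"
    "\<And>j x. j < k \<Longrightarrow> x d \<noteq> 0 \<Longrightarrow> x d ^ e j * g j (\<Psi> x (x d)) = G j x" by metis
  define E where "E = (\<Sum>j<k. e j)"
  have E: "e j \<le> E" if "j < k" for j unfolding E_def using that by (intro member_le_sum) auto
  have xd: "(\<lambda>x. x d) \<in> polys (Suc d)" by (rule polys.var) simp
  obtain P where P: "P \<in> polys k" "\<exists>x. P x \<noteq> 0"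
    "\<And>x. x d ^ E \<noteq> 0 \<Longrightarrow> P (\<lambda>j. (x d ^ (E - e j) * G j x) / x d ^ E) = 0"
    by (rule algebraic_dependence[of "Suc d" k "\<lambda>j x. x d ^ (E - e j) * G j x" "\<lambda>x. x d ^ E", OF k])
      (use G(1) xd in \<open>auto intro: polys_mult polys_power\<close>)
  have "(\<lambda>x. P (\<lambda>j. g j x)) \<in> vanishing S" unfolding vanishing_S_iff'
  proof (intro conjI allI impI)
    show "(\<lambda>x. P (\<lambda>j. g j x)) \<in> polys (Suc (Suc n))" by (rule polys_subst[OF P(1), of "\<lambda>x j. g j x"]) (rule gp)
    fix x :: point assume x: "x d \<noteq> 0"
    have "P (\<lambda>j. g j (\<Psi> x (x d))) = P (\<lambda>j. (x d ^ (E - e j) * G j x) / x d ^ E)"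
    proof (rule polys_cong[OF P(1)])
      fix j assume j: "j < k"
      have "x d ^ E = x d ^ ((E - e j) + e j)" using E[OF j] by simp
      then have "x d ^ E = x d ^ (E - e j) * x d ^ e j" by (simp only: power_add)
      then show "g j (\<Psi> x (x d)) = (x d ^ (E - e j) * G j x) / x d ^ E"
        using x by (simp add: G(2)[of j x, OF j x, symmetric])
    qed
    then show "P (\<lambda>j. g j (\<Psi> x (x d))) = 0" using P(3)[of x] x by simp
  qed
  then have "P = 0" using g P(1) by (auto simp: alg_independent_def)
  then show False using P(2) by simp
qed

text \<open>A transcendence basis of the base together with \<open>u\<close>: on the suspension \<open>u\<close> takes every nonzero value
  over every point, so a relation can be specialized to any such value.\<close>

lemma alg_independent_S_ex: "\<exists>g. alg_independent S (Suc d) g"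
proof -
  obtain g where g: "alg_independent Y d g" by (rule alg_independent_dim_ex[OF Y])
  define h where "h j = (if j < d then g j else (\<lambda>x. x n))" for j
  have gp: "g j \<in> polys n" if "j < d" for j using g that by (simp add: alg_independent_def)
  have "alg_independent S (Suc d) h" unfolding alg_independent_def nvars_S
  proof (intro conjI allI impI ballI)
    fix j assume "j < Suc d"
    then show "h j \<in> polys (Suc (Suc n))"
      using polys_mono[OF gp, of j "Suc (Suc n)"] by (auto simp: h_def intro: polys.var)
  next
    fix P assume P: "P \<in> polys (Suc d)" and v: "(\<lambda>x. P (\<lambda>j. h j x)) \<in> vanishing S"
    have "P x = 0" for x
    proof (rule polys_zero_off_hyperplane[OF P, of d])
      fix x :: point assume x: "x d \<noteq> 0"
      let ?c = "x d"
      have Pc: "(\<lambda>z. P (z(d := ?c))) \<in> polys d"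
      proof (rule polys_subst[OF P, of "\<lambda>z. z(d := ?c)"])
        fix j assume "j < Suc d"
        then show "(\<lambda>z. (z(d := ?c)) j) \<in> polys d" by (cases "j = d") (auto intro: polys_intros)
      qed
      have "(\<lambda>y. P ((\<lambda>j. g j y)(d := ?c))) \<in> vanishing Y"
      proof (rule \<Phi>_dense)
        show "(\<lambda>y. P ((\<lambda>j. g j y)(d := ?c))) \<in> polys n"
          by (rule polys_subst[OF Pc, of "\<lambda>y j. g j y"]) (rule gp)
        fix t
        have "0 = P (\<lambda>j. h j (\<Psi> t ?c))" using v x unfolding vanishing_S_iff by simp
        also have "\<dots> = P ((\<lambda>j. g j (\<Phi> t))(d := ?c))"
        proof (rule polys_cong[OF P])
          fix j assume j: "j < Suc d"
          show "h j (\<Psi> t ?c) = ((\<lambda>j. g j (\<Phi> t))(d := ?c)) j"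
          proof (cases "j < d")
            case True
            have "g j (\<Psi> t ?c) = g j (\<Phi> t)" by (rule polys_cong[OF gp[OF True]]) auto
            then show ?thesis using True by (simp add: h_def)
          qed (use j in \<open>simp add: h_def\<close>)
        qed
        finally show "P ((\<lambda>j. g j (\<Phi> t))(d := ?c)) = 0" by simp
      qed
      moreover have "\<forall>P\<in>polys d. (\<lambda>x. P (\<lambda>j. g j x)) \<in> vanishing Y \<longrightarrow> P = 0"
        using g by (simp add: alg_independent_def)
      from bspec[OF this Pc]
      have "(\<lambda>y. P ((\<lambda>j. g j y)(d := ?c))) \<in> vanishing Y \<longrightarrow> (\<lambda>z. P (z(d := ?c))) = 0" .
      ultimately have "(\<lambda>z. P (z(d := ?c))) = 0" by blast
      from fun_cong[OF this, of x] have "P (x(d := ?c)) = 0" by simp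
      then show "P x = 0" by simp
    qed simp
    then show "P = 0" by auto
  qed
  then show ?thesis by blast
qed

lemma variety_dim_S: "variety_dim S = Suc d"
  unfolding variety_dim_def[of S]
  by (rule Greatest_equality) (use alg_independent_S_ex alg_independent_S_le in auto)

lemma dpoly_low:
  assumes "p \<in> polys n"
  shows "dpoly (Suc (Suc n)) p x v = dpoly n p (trunc n x) (trunc n v)"
proof -
  have "dpoly (Suc (Suc n)) p x v = dpoly n p x v" by (rule dpoly_mono[OF assms]) simp
  also have "\<dots> = dpoly n p x (trunc n v)" by (rule dpoly_cong) (simp add: trunc_def)
  also have "\<dots> = dpoly n p (trunc n x) (trunc n v)"
    by (rule dpoly_base_cong[OF assms]) (simp add: trunc_def)
  finally show ?thesis .
qed

lemma dpoly_eqn: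
  "dpoly (Suc (Suc n)) eqn x v = dpoly n f (trunc n x) (trunc n v) - (v n * x (Suc n) + x n * v (Suc n))"
  by (subst dpoly_diff_poly)
    (auto simp: dpoly_mult_poly polys.var dpoly_var dpoly_low[OF f] f2 intro!: polys_intros)

lemma tangent_space_S:
  assumes x: "x \<in> points S"
  shows "tangent_space S x = {v \<in> affine_space (Suc (Suc n)). trunc n v \<in> tangent_space Y (trunc n x) \<and>
    dpoly n f (trunc n x) (trunc n v) = v n * x (Suc n) + x n * v (Suc n)}" (is "_ = ?R")
proof -
  have T: "tangent_space S x = {v \<in> affine_space (Suc (Suc n)). \<forall>p\<in>vanishing S. dpoly (Suc (Suc n)) p x v = 0}"
    using tangent_space_eq[of S x] IS_sub by simp
  show ?thesis
  proof
    show "tangent_space S x \<subseteq> ?R"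
    proof
      fix v assume v: "v \<in> tangent_space S x"
      have "dpoly n p (trunc n x) (trunc n v) = 0" if "p \<in> vanishing Y" for p
        using v that gens_in(1) dpoly_low[OF IY(1)[OF that], of x v] unfolding T by auto
      then have "trunc n v \<in> tangent_space Y (trunc n x)" by (simp add: tangent_space_eq[OF IY_sub])
      moreover have "dpoly (Suc (Suc n)) eqn x v = 0" using v gens_in(2) unfolding T by blast
      ultimately show "v \<in> ?R" using v by (simp add: T dpoly_eqn)
    qed
    show "?R \<subseteq> tangent_space S x"
    proof
      fix v assume v: "v \<in> ?R"
      have "vanishing S \<subseteq> {p \<in> polys (Suc (Suc n)). p x = 0 \<and> dpoly (Suc (Suc n)) p x v = 0}"
      proof (rule vanishing_S_minimal[OF ideal_point_vector])
        show "vanishing Y \<subseteq> {p \<in> polys (Suc (Suc n)). p x = 0 \<and> dpoly (Suc (Suc n)) p x v = 0}"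
        proof
          fix p assume p: "p \<in> vanishing Y"
          have "dpoly n p (trunc n x) (trunc n v) = 0"
            using v p unfolding tangent_space_eq[OF IY_sub] by blast
          then have "dpoly (Suc (Suc n)) p x v = 0" by (simp only: dpoly_low[OF IY(1)[OF p]])
          moreover have "p x = 0" using points_vanish[OF x] p gens_in(1) by blast
          ultimately show "p \<in> {p \<in> polys (Suc (Suc n)). p x = 0 \<and> dpoly (Suc (Suc n)) p x v = 0}"
            using p gens_polys by auto
        qed
        show "eqn \<in> {p \<in> polys (Suc (Suc n)). p x = 0 \<and> dpoly (Suc (Suc n)) p x v = 0}"
          using v gens_polys points_vanish[OF x gens_in(2)] by (simp add: dpoly_eqn)
      qed
      then show "v \<in> tangent_space S x" using v unfolding T by auto
    qed
  qed
qed

lemma trunc_linear: "trunc n (v + w) = trunc n v + trunc n w" "trunc n (c *\<^sub>R v) = c *\<^sub>R trunc n v"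
  by (auto simp: trunc_def scaleR_fun_def)

lemma trunc_id: "v \<in> affine_space n \<Longrightarrow> trunc n v = v"
  by (auto simp: trunc_def affine_space_def)

lemma dim_cylinder:
  assumes T: "subspace T" "T \<subseteq> affine_space n"
  defines "W \<equiv> {v \<in> affine_space (Suc (Suc n)). trunc n v \<in> T}"
  shows "dim W = Suc (Suc (dim T))" "subspace W" "W \<subseteq> affine_space (Suc (Suc n))"
proof -
  have t0: "trunc n 0 = 0" "trunc n (unit_point n) = 0" "trunc n (unit_point (Suc n)) = 0"
    by (auto simp: trunc_def unit_point_def)
  show W: "subspace W" unfolding W_def
    using affine_space_subspace[of "Suc (Suc n)"] T(1) by (auto simp: subspace_def trunc_linear t0)
  show W': "W \<subseteq> affine_space (Suc (Suc n))" unfolding W_def by blast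
  have "unit_point (Suc n) \<in> W"
    using subspace_0[OF T(1)] t0 by (simp add: W_def affine_space_def) (simp add: unit_point_def)
  then have 1: "dim W = Suc (dim {v \<in> W. v (Suc n) = 0})"
    by (intro dim_kernel_functional[OF W W']) (auto simp: scaleR_fun_def unit_point_def)
  let ?W = "{v \<in> W. v (Suc n) = 0}"
  have "unit_point n \<in> ?W"
    using subspace_0[OF T(1)] t0 by (simp add: W_def affine_space_def) (simp add: unit_point_def)
  then have 2: "dim ?W = Suc (dim {v \<in> ?W. v n = 0})"
    by (intro dim_kernel_functional[of _ "Suc (Suc n)"])
      (use W W' in \<open>auto simp: scaleR_fun_def unit_point_def subspace_def\<close>)
  have "{v \<in> ?W. v n = 0} = T"
  proof
    show "{v \<in> ?W. v n = 0} \<subseteq> T"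
    proof
      fix v assume v: "v \<in> {v \<in> ?W. v n = 0}"
      have "v i = 0" if "n \<le> i" for i
        using v that by (cases "i = n"; cases "i = Suc n") (auto simp: W_def affine_space_def)
      then have "v \<in> affine_space n" by (simp add: affine_space_def)
      then show "v \<in> T" using v trunc_id[of v] by (simp add: W_def)
    qed
    show "T \<subseteq> {v \<in> ?W. v n = 0}"
    proof
      fix v assume v: "v \<in> T"
      then have "v \<in> affine_space n" using T(2) by blast
      then show "v \<in> {v \<in> ?W. v n = 0}"
        using v trunc_id[of v] by (simp add: W_def) (simp add: affine_space_def)
    qed
  qed
  then show "dim W = Suc (Suc (dim T))" using 1 2 by simp
qed

text \<open>The tangent space is the kernel of the functional \<open>\<psi>\<close>, the differential of \<open>f - uv\<close>, on the
  product of the tangent space of the base with the \<open>uv\<close>-plane. Over singular points of the base the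
  dimension is too large even if \<open>\<psi>\<close> is nonzero, by the lower bound for tangent dimensions.\<close>

lemma reg_S:
  "x \<in> reg S \<longleftrightarrow> x \<in> points S \<and> trunc n x \<in> reg Y \<and>
    (x n \<noteq> 0 \<or> x (Suc n) \<noteq> 0 \<or> (\<exists>w\<in>tangent_space Y (trunc n x). dpoly n f (trunc n x) w \<noteq> 0))"
proof (cases "x \<in> points S")
  case False
  then show ?thesis by (simp add: reg_def)
next
  case x: True
  let ?y = "trunc n x"
  let ?T = "tangent_space Y ?y"
  have y: "?y \<in> points Y" using x by (simp add: points_S)
  have T: "subspace ?T" "?T \<subseteq> affine_space n"
    using tangent_space_subspace[OF IY_sub] tangent_space_affine by blast+
  define W where "W = {v \<in> affine_space (Suc (Suc n)). trunc n v \<in> ?T}"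
  note W = dim_cylinder[OF T, folded W_def]
  define \<psi> where "\<psi> v = dpoly n f ?y (trunc n v) - (v n * x (Suc n) + x n * v (Suc n))" for v
  have add: "\<psi> (v + w) = \<psi> v + \<psi> w" and scale: "\<psi> (c *\<^sub>R v) = c * \<psi> v" for v w c
    by (simp_all add: \<psi>_def trunc_linear dpoly_lin scaleR_fun_apply algebra_simps)
  have TS: "tangent_space S x = {v \<in> W. \<psi> v = 0}"
    unfolding tangent_space_S[OF x] W_def \<psi>_def by auto
  have ge: "d \<le> dim ?T" by (rule tangent_dim_ge[OF affine_variety_ideal[OF Y] dom y])
  have AB: "(\<exists>v\<in>W. \<psi> v \<noteq> 0) \<longleftrightarrow> x n \<noteq> 0 \<or> x (Suc n) \<noteq> 0 \<or> (\<exists>w\<in>?T. dpoly n f ?y w \<noteq> 0)" (is "?A \<longleftrightarrow> ?B")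
  proof
    assume ?A then show ?B by (auto simp: \<psi>_def W_def)
  next
    have t0: "trunc n (unit_point n) = 0" "trunc n (unit_point (Suc n)) = 0"
      by (auto simp: trunc_def unit_point_def)
    assume ?B
    then consider "x n \<noteq> 0" | "x (Suc n) \<noteq> 0" | w where "w \<in> ?T" "dpoly n f ?y w \<noteq> 0" by blast
    then show ?A
    proof cases
      case 1
      have "unit_point (Suc n) \<in> W" using subspace_0[OF T(1)] t0
        by (simp add: W_def affine_space_def unit_point_def)
      moreover have "\<psi> (unit_point (Suc n)) \<noteq> 0" using 1 t0 dpoly_lin(3)[of n f ?y]
        by (simp add: \<psi>_def) (simp add: unit_point_def)
      ultimately show ?thesis by blast
    next
      case 2
      have "unit_point n \<in> W" using subspace_0[OF T(1)] t0
        by (simp add: W_def affine_space_def unit_point_def)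
      moreover have "\<psi> (unit_point n) \<noteq> 0" using 2 t0 dpoly_lin(3)[of n f ?y]
        by (simp add: \<psi>_def) (simp add: unit_point_def)
      ultimately show ?thesis by blast
    next
      case 3
      then have "w \<in> affine_space n" using T(2) by blast
      then have "w \<in> W" "\<psi> w = dpoly n f ?y w" using 3 trunc_id[of w] by (auto simp: W_def \<psi>_def affine_space_def)
      then show ?thesis using 3 by metis
    qed
  qed
  show ?thesis
  proof (cases "\<exists>v\<in>W. \<psi> v \<noteq> 0")
    case True
    then have "dim (tangent_space S x) = Suc (dim ?T)"
      using dim_kernel_functional[of W _ \<psi>, OF W(2,3) add scale] W(1) unfolding TS by auto
    then have "x \<in> reg S \<longleftrightarrow> dim ?T = d" using x by (simp add: reg_def variety_dim_S)
    then show ?thesis using x y True AB by (simp add: reg_def[of Y])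
  next
    case False
    then have "{v \<in> W. \<psi> v = 0} = W" by blast
    then have "dim (tangent_space S x) = Suc (Suc (dim ?T))" using W(1) unfolding TS by simp
    then have "x \<notin> reg S" using ge by (simp add: reg_def variety_dim_S)
    then show ?thesis using False AB by simp
  qed
qed

end

section \<open>Automorphisms of varieties with dense real points\<close>

definition real_variety :: "variety \<Rightarrow> bool"
  where "real_variety X \<longleftrightarrow> vanishing X = {p \<in> polys (nvars X). \<forall>x\<in>points X. p x = 0}"

lemma dominated_real_variety:
  assumes "ideal (vanishing X) (poly_ring (nvars X))" "dominating X d \<Phi>" shows "real_variety X"
  unfolding real_variety_def
proof (intro equalityI subsetI)
  fix p assume "p \<in> vanishing X"
  then show "p \<in> {p \<in> polys (nvars X). \<forall>x\<in>points X. p x = 0}"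
    using polys_ideal_facts(1)[OF assms(1)] points_vanish by blast
next
  fix p assume "p \<in> {p \<in> polys (nvars X). \<forall>x\<in>points X. p x = 0}"
  then show "p \<in> vanishing X" using assms(2) by (auto simp: dominating_def reg_def)
qed

text \<open>The elements of \<open>SAut X\<close> as concrete maps: finite compositions of maps \<open>\<phi> t\<close>. The truncation
  represents the identity, so that all values lie in \<open>affine_space (nvars X)\<close>.\<close>

inductive_set flows :: "variety \<Rightarrow> (point \<Rightarrow> point) set" for X where
  flows_id: "trunc (nvars X) \<in> flows X"
| flows_step: "Ga_action X \<phi> \<Longrightarrow> h \<in> flows X \<Longrightarrow> \<phi> t \<circ> h \<in> flows X"

lemma trunc_points: "x \<in> points X \<Longrightarrow> trunc (nvars X) x = x"
  using points_affine_space[of x X] by (auto simp: trunc_def affine_space_def)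

lemma flows_affine: "h \<in> flows X \<Longrightarrow> h x \<in> affine_space (nvars X)"
  by (induction rule: flows.induct) (auto simp: endos_affine[OF Ga_endos])

lemma flows_points: "h \<in> flows X \<Longrightarrow> x \<in> points X \<Longrightarrow> h x \<in> points X"
  by (induction rule: flows.induct) (auto simp: trunc_points Ga_points)

lemma flows_reg:
  assumes "ideal (vanishing X) (poly_ring (nvars X))"
  shows "h \<in> flows X \<Longrightarrow> x \<in> reg X \<Longrightarrow> h x \<in> reg X"
proof (induction rule: flows.induct)
  case flows_id
  then show ?case using trunc_points[of x X] by (simp add: reg_def)
qed (simp add: Ga_reg[OF assms])

lemma flows_compose: "g \<in> flows X \<Longrightarrow> h \<in> flows X \<Longrightarrow> g \<circ> h \<in> flows X"
proof (induction rule: flows.induct)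
  case flows_id
  have "trunc (nvars X) \<circ> h = h" using flows_affine[OF flows_id]
    by (auto simp: trunc_def affine_space_def fun_eq_iff not_less)
  then show ?case using flows_id by simp
next
  case (flows_step \<phi> h' t)
  then show ?case unfolding comp_assoc using flows.flows_step by blast
qed

lemma flows_Ga: "Ga_action X \<phi> \<Longrightarrow> \<phi> t \<circ> trunc (nvars X) \<in> flows X"
  by (intro flows.intros)

lemma flows_inverse:
  "h \<in> flows X \<Longrightarrow> \<exists>h'\<in>flows X. \<forall>x\<in>points X. h' (h x) = x \<and> h (h' x) = x"
proof (induction rule: flows.induct)
  case flows_id
  then show ?case by (intro bexI[of _ "trunc (nvars X)"]) (auto simp: trunc_points flows.flows_id)
next
  case (flows_step \<phi> h t)
  then obtain h' where h': "h' \<in> flows X" "\<And>x. x \<in> points X \<Longrightarrow> h' (h x) = x \<and> h (h' x) = x" by blast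
  show ?case
  proof (intro bexI[of _ "h' \<circ> (\<phi> (- t) \<circ> trunc (nvars X))"] ballI)
    fix x assume x: "x \<in> points X"
    then show "(h' \<circ> (\<phi> (- t) \<circ> trunc (nvars X))) ((\<phi> t \<circ> h) x) = x \<and>
        (\<phi> t \<circ> h) ((h' \<circ> (\<phi> (- t) \<circ> trunc (nvars X))) x) = x"
      using flows_points[OF flows_step.hyps(2) x] flows_step.hyps h'
      by (simp add: trunc_points Ga_points Ga_inverse Ga_inverse')
  qed (intro flows_compose h' flows_Ga flows_step)
qed

text \<open>Scaling all times by \<open>s\<close> joins a composition of flows to the identity.\<close>

lemma flows_path:
  "h \<in> flows X \<Longrightarrow> \<exists>H. (\<forall>s. H s \<in> flows X) \<and> (\<forall>x\<in>points X. H 0 x = x \<and> H 1 x = h x) \<and>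
    (\<forall>x i. upoly (\<lambda>s. H s x i))"
proof (induction rule: flows.induct)
  case flows_id
  show ?case
    by (rule exI[of _ "\<lambda>s. trunc (nvars X)"]) (auto simp: trunc_points upoly_const flows.flows_id)
next
  case (flows_step \<phi> h t)
  then obtain H where H: "\<And>s. H s \<in> flows X" "\<And>x. x \<in> points X \<Longrightarrow> H 0 x = x \<and> H 1 x = h x"
    "\<And>x i. upoly (\<lambda>s. H s x i)" by blast
  show ?case
  proof (intro exI[of _ "\<lambda>s. \<phi> (s * t) \<circ> H s"] conjI allI ballI)
    show "\<phi> (s * t) \<circ> H s \<in> flows X" for s using flows_step.hyps(1) H(1) by (rule flows.flows_step)
    show "(\<phi> (0 * t) \<circ> H 0) x = x" "(\<phi> (1 * t) \<circ> H 1) x = (\<phi> t \<circ> h) x" if "x \<in> points X" for x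
      using H(2)[OF that] Ga_zero[OF flows_step.hyps(1) that] by simp_all
    show "upoly (\<lambda>s. (\<phi> (s * t) \<circ> H s) x i)" for x i
      using Ga_upoly[OF flows_step.hyps(1), of "\<lambda>s. s * t" "\<lambda>s. H s x" i] H(3)
      by (simp add: upoly_mult upoly_id upoly_const)
  qed
qed

text \<open>The condition \<open>c g \<noteq> 0\<close> on a flow \<open>g\<close> is open in the Zariski sense and can be satisfied.\<close>

definition flow_condition :: "variety \<Rightarrow> ((point \<Rightarrow> point) \<Rightarrow> real) \<Rightarrow> bool"
  where "flow_condition X c \<longleftrightarrow>
    (\<forall>H. (\<forall>x i. upoly (\<lambda>s. H s x i)) \<longrightarrow> upoly (\<lambda>s. c (H s))) \<and>
    (\<forall>h h'. (\<forall>x\<in>points X. h x = h' x) \<longrightarrow> c h = c h') \<and>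
    (\<exists>g\<in>flows X. c g \<noteq> 0)"

text \<open>If \<open>g\<close> satisfies the conditions in \<open>C\<close> and \<open>g0\<close> satisfies \<open>c\<close>, take a polynomial path from the identity
  to \<open>g0 g\<^sup>-\<^sup>1\<close> and compose it with \<open>g\<close>. Along it each condition fails for finitely many parameters
  only, since those in \<open>C\<close> hold at its start and \<open>c\<close> holds at its end.\<close>

lemma generic_flow:
  assumes "finite C" and "\<And>c. c \<in> C \<Longrightarrow> flow_condition X c"
  shows "\<exists>g\<in>flows X. \<forall>c\<in>C. c g \<noteq> 0"
  using assms
proof (induction rule: finite_induct)
  case empty
  show ?case using flows_id[of X] by (intro bexI[of _ "trunc (nvars X)"]) auto
next
  case (insert c C)
  obtain g where g: "g \<in> flows X" "\<And>c. c \<in> C \<Longrightarrow> c g \<noteq> 0" using insert by auto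
  have cond: "flow_condition X b" if "b \<in> insert c C" for b using insert.prems that by simp
  obtain g0 where g0: "g0 \<in> flows X" "c g0 \<noteq> 0" using cond[of c] unfolding flow_condition_def by auto
  obtain g' where g': "g' \<in> flows X" "\<And>x. x \<in> points X \<Longrightarrow> g' (g x) = x"
    using flows_inverse[OF g(1)] by blast
  obtain H where H: "\<And>s. H s \<in> flows X" "\<And>x. x \<in> points X \<Longrightarrow> H 0 x = x \<and> H 1 x = (g0 \<circ> g') x"
    "\<And>x i. upoly (\<lambda>s. H s x i)" using flows_path[OF flows_compose[OF g0(1) g'(1)]] by blast
  have fin: "finite {s. b (H s \<circ> g) = 0}" if b: "b \<in> insert c C" for b
  proof -
    note c = cond[OF b, unfolded flow_condition_def]
    have "(\<forall>x i. upoly (\<lambda>s. (H s \<circ> g) x i)) \<longrightarrow> upoly (\<lambda>s. b (H s \<circ> g))"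
      by (rule spec[OF conjunct1[OF c], of "\<lambda>s. H s \<circ> g"])
    then have up: "upoly (\<lambda>s. b (H s \<circ> g))" using H(3) by simp
    have eq: "b h = b h'" if "\<forall>x\<in>points X. h x = h' x" for h h' using c that by blast
    have gp: "g x \<in> points X" if "x \<in> points X" for x by (rule flows_points[OF g(1) that])
    show ?thesis
    proof (cases "b = c")
      case True
      have "b (H 1 \<circ> g) = b g0" by (rule eq) (simp add: H(2) g'(2) gp)
      then show ?thesis using upoly_finite_zeros[OF up, of 1] g0(2) True by simp
    next
      case False
      have "b (H 0 \<circ> g) = b g" by (rule eq) (simp add: H(2) gp)
      then show ?thesis using upoly_finite_zeros[OF up, of 0] g(2)[of b] False b by simp
    qed
  qed
  have "finite (\<Union>b\<in>insert c C. {s. b (H s \<circ> g) = 0})"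
    using insert.hyps(1) fin by blast
  then have "(\<Union>b\<in>insert c C. {s. b (H s \<circ> g) = 0}) \<noteq> UNIV"
    using infinite_UNIV_char_0[where ?'a = real] by metis
  then obtain s where "\<forall>b\<in>insert c C. b (H s \<circ> g) \<noteq> 0" by blast
  then show ?case by (rule bexI[of _ "H s \<circ> g"]) (rule flows_compose[OF H(1) g(1)])
qed

text \<open>When the ideal is determined by the real points, congruence of morphisms is equality on the points,
  and everything about automorphisms can be checked pointwise.\<close>

locale real_var =
  fixes X :: variety
  assumes ideal_X: "ideal (vanishing X) (poly_ring (nvars X))" and real_X: "real_variety X"
begin

abbreviation n where "n \<equiv> nvars X"

lemma IX: "p \<in> vanishing X \<longleftrightarrow> p \<in> polys n \<and> (\<forall>x\<in>points X. p x = 0)"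
  using real_X unfolding real_variety_def by blast

lemma IX_sub: "vanishing X \<subseteq> polys n" using IX by blast

lemma endosI:
  assumes "\<And>i. i < n \<Longrightarrow> (\<lambda>x. \<phi> x i) \<in> polys n" "\<And>x. \<phi> x \<in> affine_space n"
    "\<And>x. x \<in> points X \<Longrightarrow> \<phi> x \<in> points X"
  shows "\<phi> \<in> endos X"
  unfolding endos_def
proof (intro CollectI conjI ballI allI impI)
  fix p assume p: "p \<in> vanishing X"
  have "(\<lambda>x. p (\<phi> x)) \<in> polys n" by (rule polys_subst[of p n \<phi>]) (use p IX assms(1) in auto)
  then show "p \<circ> \<phi> \<in> vanishing X" using p assms(3) by (simp add: IX comp_def)
qed (use assms in auto)

lemma trunc_endos: "trunc n \<in> endos X"
  by (rule endosI) (auto simp: trunc_points, simp add: trunc_def polys.var)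

lemma flows_endos: "h \<in> flows X \<Longrightarrow> h \<in> endos X"
  by (induction rule: flows.induct) (rule trunc_endos, rule endos_compose[OF IX_sub Ga_endos])

lemma same_morphism_iff:
  assumes "\<phi> \<in> endos X" "\<psi> \<in> endos X"
  shows "same_morphism X \<phi> \<psi> \<longleftrightarrow> (\<forall>x\<in>points X. \<phi> x = \<psi> x)"
proof
  assume "same_morphism X \<phi> \<psi>"
  then show "\<forall>x\<in>points X. \<phi> x = \<psi> x" using same_morphism_points endos_affine assms by blast
next
  assume "\<forall>x\<in>points X. \<phi> x = \<psi> x"
  then show "same_morphism X \<phi> \<psi>" using endos_poly[OF assms(1)] endos_poly[OF assms(2)]
    by (auto simp: same_morphism_def IX intro: polys_diff)
qed

lemma same_morphism_id_iff:
  assumes "\<phi> \<in> endos X" shows "same_morphism X \<phi> id \<longleftrightarrow> (\<forall>x\<in>points X. \<phi> x = x)"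
proof -
  have "same_morphism X \<phi> id \<longleftrightarrow> same_morphism X \<phi> (trunc n)"
    by (simp add: same_morphism_def trunc_def)
  then show ?thesis using same_morphism_iff[OF assms trunc_endos] by (simp add: trunc_points)
qed

lemma Ga_actionI:
  assumes "\<And>i. i < n \<Longrightarrow> \<exists>P\<in>polys (Suc n). \<forall>t x. \<phi> t x i = P (x(n := t))"
    and "\<And>t x. \<phi> t x \<in> affine_space n" and "\<And>t x. x \<in> points X \<Longrightarrow> \<phi> t x \<in> points X"
    and "\<And>x. x \<in> points X \<Longrightarrow> \<phi> 0 x = x"
    and "\<And>s t x. x \<in> points X \<Longrightarrow> \<phi> (s + t) x = \<phi> s (\<phi> t x)"
  shows "Ga_action X \<phi>"
proof -
  have e: "\<phi> t \<in> endos X" for t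
  proof (rule endosI)
    fix i assume "i < n"
    then obtain P where P: "P \<in> polys (Suc n)" "\<And>t x. \<phi> t x i = P (x(n := t))" using assms(1) by blast
    have "(\<lambda>x. P (x(n := t))) \<in> polys n"
    proof (rule polys_subst[OF P(1), of "\<lambda>x. x(n := t)"])
      fix j assume "j < Suc n"
      then show "(\<lambda>x. (x(n := t)) j) \<in> polys n" by (cases "j = n") (auto intro: polys.intros)
    qed
    then show "(\<lambda>x. \<phi> t x i) \<in> polys n" by (simp add: P(2))
  qed (use assms in auto)
  show ?thesis unfolding Ga_action_def
    using assms e same_morphism_id_iff[OF e] same_morphism_iff[OF e endos_compose[OF IX_sub e e]] by simp
qed

text \<open>If \<open>\<phi> t\<close> is the identity for some \<open>t \<noteq> 0\<close>, then it is for all multiples of \<open>t\<close>, thus for all times,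
  as orbits are polynomial in the time. So an action is either effective or trivial on points.\<close>

lemma Ga_trivial:
  assumes a: "Ga_action X \<phi>" and ne: "\<not> effective_Ga_action X \<phi>" and x: "x \<in> points X"
  shows "\<phi> s x = x"
proof -
  obtain t where t: "t \<noteq> 0" "same_morphism X (\<phi> t) id"
    using a ne by (auto simp: effective_Ga_action_def)
  have "\<phi> t x = x" using t(2) same_morphism_id_iff[OF Ga_endos[OF a]] x by blast
  then have k: "\<phi> (real k * t) x = x" for k
  proof (induction k)
    case 0 then show ?case using Ga_zero[OF a x] by simp
  next
    case (Suc k)
    have "\<phi> (real (Suc k) * t) x = \<phi> t (\<phi> (real k * t) x)"
      using Ga_add[OF a x, of t "real k * t"] by (simp add: algebra_simps)
    then show ?case using Suc by simp
  qed
  have inf: "infinite (range (\<lambda>k. real k * t))"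
    by (rule range_inj_infinite) (use t(1) in \<open>auto simp: inj_on_def\<close>)
  show ?thesis
  proof
    fix i
    have "upoly (\<lambda>s. \<phi> s x i - x i)"
      using Ga_upoly[OF a upoly_id, of "\<lambda>s. x"] by (intro upoly_diff upoly_const) (auto intro: upoly_const)
    then have "\<phi> s x i - x i = 0" by (rule upoly_zero[OF _ inf]) (use k in auto)
    then show "\<phi> s x i = x i" by simp
  qed
qed

subsection \<open>The automorphism group\<close>

abbreviation cls where "cls \<equiv> morphism_class X"

lemma cls_def': "\<phi> \<in> endos X \<Longrightarrow> cls \<phi> = {\<psi> \<in> endos X. \<forall>x\<in>points X. \<psi> x = \<phi> x}"
  unfolding morphism_class_def using same_morphism_iff by blast

lemma cls_id: "cls id = cls (trunc n)"
  unfolding morphism_class_def by (simp add: same_morphism_def trunc_def)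

lemma cls_cong: "\<phi> \<in> endos X \<Longrightarrow> \<psi> \<in> endos X \<Longrightarrow> (\<And>x. x \<in> points X \<Longrightarrow> \<phi> x = \<psi> x) \<Longrightarrow> cls \<phi> = cls \<psi>"
  by (simp add: cls_def')

lemma act_cls: "\<phi> \<in> endos X \<Longrightarrow> x \<in> points X \<Longrightarrow> act (cls \<phi>) x = \<phi> x"
  unfolding act_def by (rule the_equality) (auto simp: cls_def')

lemma autos_iff: "\<phi> \<in> autos X \<longleftrightarrow> \<phi> \<in> endos X \<and>
    (\<exists>\<psi>\<in>endos X. \<forall>x\<in>points X. \<phi> (\<psi> x) = x \<and> \<psi> (\<phi> x) = x)"
  unfolding autos_def using same_morphism_id_iff[OF endos_compose[OF IX_sub]] by auto

lemma Aut_carrier: "carrier (Aut X) = cls ` autos X"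
  by (simp add: Aut_def)

lemma Aut_mult: "\<phi> \<in> endos X \<Longrightarrow> \<psi> \<in> endos X \<Longrightarrow> cls \<phi> \<otimes>\<^bsub>Aut X\<^esub> cls \<psi> = cls (\<phi> \<circ> \<psi>)"
proof -
  assume e: "\<phi> \<in> endos X" "\<psi> \<in> endos X"
  have "same_morphism X \<theta> (\<phi>' \<circ> \<psi>') \<longleftrightarrow> (\<forall>x\<in>points X. \<theta> x = \<phi> (\<psi> x))"
    if "\<theta> \<in> endos X" "\<phi>' \<in> cls \<phi>" "\<psi>' \<in> cls \<psi>" for \<theta> \<phi>' \<psi>'
    using that e same_morphism_iff[OF that(1) endos_compose[OF IX_sub, of \<phi>' \<psi>']] endos_points[OF e(2)]
    by (simp add: cls_def')
  moreover have "\<phi> \<in> cls \<phi>" "\<psi> \<in> cls \<psi>" using e by (simp_all add: cls_def')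
  ultimately have "cls \<phi> \<otimes>\<^bsub>Aut X\<^esub> cls \<psi> = {\<theta> \<in> endos X. \<forall>x\<in>points X. \<theta> x = \<phi> (\<psi> x)}"
    unfolding Aut_def monoid.simps by blast
  then show ?thesis using cls_def'[OF endos_compose[OF IX_sub e]] by simp
qed

lemma Aut_one: "\<one>\<^bsub>Aut X\<^esub> = cls (trunc n)"
  by (simp add: Aut_def cls_id)

lemma autos_endos: "\<phi> \<in> autos X \<Longrightarrow> \<phi> \<in> endos X"
  by (simp add: autos_def)

lemma trunc_autos: "trunc n \<in> autos X"
  unfolding autos_iff using trunc_endos trunc_points[of _ X] by (auto intro!: bexI[of _ "trunc n"])

lemma autos_compose: "\<phi> \<in> autos X \<Longrightarrow> \<psi> \<in> autos X \<Longrightarrow> \<phi> \<circ> \<psi> \<in> autos X"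
proof -
  assume "\<phi> \<in> autos X" "\<psi> \<in> autos X"
  then obtain \<phi>' \<psi>' where e: "\<phi> \<in> endos X" "\<psi> \<in> endos X" "\<phi>' \<in> endos X" "\<psi>' \<in> endos X"
    and i: "\<And>x. x \<in> points X \<Longrightarrow> \<phi> (\<phi>' x) = x \<and> \<phi>' (\<phi> x) = x" "\<And>x. x \<in> points X \<Longrightarrow> \<psi> (\<psi>' x) = x \<and> \<psi>' (\<psi> x) = x"
    unfolding autos_iff by blast
  show ?thesis unfolding autos_iff
    using endos_compose[OF IX_sub e(1,2)] endos_compose[OF IX_sub e(4,3)] i endos_points[OF e(2)] endos_points[OF e(3)]
    by (auto intro!: bexI[of _ "\<psi>' \<circ> \<phi>'"])
qed

lemma group_Aut: "group (Aut X)"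
proof (rule groupI)
  fix F G assume "F \<in> carrier (Aut X)" "G \<in> carrier (Aut X)"
  then obtain \<phi> \<psi> where "\<phi> \<in> autos X" "\<psi> \<in> autos X" "F = cls \<phi>" "G = cls \<psi>"
    unfolding Aut_carrier by blast
  then show "F \<otimes>\<^bsub>Aut X\<^esub> G \<in> carrier (Aut X)"
    unfolding Aut_carrier by (simp add: Aut_mult autos_endos autos_compose)
next
  show "\<one>\<^bsub>Aut X\<^esub> \<in> carrier (Aut X)" unfolding Aut_carrier Aut_one using trunc_autos by blast
next
  fix F G H assume "F \<in> carrier (Aut X)" "G \<in> carrier (Aut X)" "H \<in> carrier (Aut X)"
  then obtain \<phi> \<psi> \<theta> where "\<phi> \<in> autos X" "\<psi> \<in> autos X" "\<theta> \<in> autos X" "F = cls \<phi>" "G = cls \<psi>" "H = cls \<theta>"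
    unfolding Aut_carrier by blast
  then show "F \<otimes>\<^bsub>Aut X\<^esub> G \<otimes>\<^bsub>Aut X\<^esub> H = F \<otimes>\<^bsub>Aut X\<^esub> (G \<otimes>\<^bsub>Aut X\<^esub> H)"
    by (simp add: Aut_mult autos_endos endos_compose[OF IX_sub] comp_assoc)
next
  fix F assume "F \<in> carrier (Aut X)"
  then obtain \<phi> where \<phi>: "\<phi> \<in> autos X" "F = cls \<phi>" unfolding Aut_carrier by blast
  then show "\<one>\<^bsub>Aut X\<^esub> \<otimes>\<^bsub>Aut X\<^esub> F = F" unfolding Aut_one
    using cls_cong[OF endos_compose[OF IX_sub trunc_endos autos_endos[OF \<phi>(1)]] autos_endos[OF \<phi>(1)]]
      endos_points[OF autos_endos[OF \<phi>(1)]] trunc_points[of _ X]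
    by (simp add: Aut_mult trunc_endos autos_endos)
  obtain \<psi> where \<psi>: "\<psi> \<in> endos X" "\<And>x. x \<in> points X \<Longrightarrow> \<phi> (\<psi> x) = x \<and> \<psi> (\<phi> x) = x"
    using \<phi>(1) unfolding autos_iff by blast
  have "\<psi> \<in> autos X" unfolding autos_iff using \<psi> autos_endos[OF \<phi>(1)] by blast
  moreover have "cls \<psi> \<otimes>\<^bsub>Aut X\<^esub> F = \<one>\<^bsub>Aut X\<^esub>" unfolding Aut_one \<phi>(2) Aut_mult[OF \<psi>(1) autos_endos[OF \<phi>(1)]]
    by (rule cls_cong[OF endos_compose[OF IX_sub \<psi>(1) autos_endos[OF \<phi>(1)]] trunc_endos])
      (use \<psi>(2) trunc_points[of _ X] in simp)
  ultimately show "\<exists>G\<in>carrier (Aut X). G \<otimes>\<^bsub>Aut X\<^esub> F = \<one>\<^bsub>Aut X\<^esub>" unfolding Aut_carrier by blast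
qed

lemma Ga_autos: "Ga_action X \<phi> \<Longrightarrow> \<phi> t \<in> autos X"
  unfolding autos_iff using Ga_endos Ga_inverse Ga_inverse' by blast

lemma SAut_flow: "g \<in> SAut X \<Longrightarrow> \<exists>h\<in>flows X. g = cls h"
  unfolding SAut_def
proof (induction rule: generate.induct)
  case one
  then show ?case using Aut_one flows_id by blast
next
  case (incl h)
  then obtain \<phi> t where \<phi>: "Ga_action X \<phi>" "h = cls (\<phi> t)"
    by (auto simp: one_param_unipotent_subgroups_def effective_Ga_action_def)
  have "h = cls (\<phi> t \<circ> trunc n)" unfolding \<phi>(2)
    by (rule cls_cong[OF Ga_endos[OF \<phi>(1)] flows_endos[OF flows_Ga[OF \<phi>(1)]]]) (simp add: trunc_points)
  then show ?case using flows_Ga[OF \<phi>(1)] by blast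
next
  case (inv h)
  then obtain \<phi> t where \<phi>: "Ga_action X \<phi>" "h = cls (\<phi> t)"
    by (auto simp: one_param_unipotent_subgroups_def effective_Ga_action_def)
  have "inv\<^bsub>Aut X\<^esub> h = cls (\<phi> (- t))"
  proof (rule group.inv_equality[OF group_Aut])
    show "cls (\<phi> (- t)) \<otimes>\<^bsub>Aut X\<^esub> h = \<one>\<^bsub>Aut X\<^esub>"
      unfolding \<phi>(2) Aut_mult[OF Ga_endos[OF \<phi>(1)] Ga_endos[OF \<phi>(1)]] Aut_one
      by (rule cls_cong[OF endos_compose[OF IX_sub Ga_endos[OF \<phi>(1)] Ga_endos[OF \<phi>(1)]] trunc_endos])
        (simp add: trunc_points Ga_inverse[OF \<phi>(1)])
  qed (use \<phi> Ga_autos Aut_carrier in auto)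
  moreover have "cls (\<phi> (- t)) = cls (\<phi> (- t) \<circ> trunc n)"
    by (rule cls_cong[OF Ga_endos[OF \<phi>(1)] flows_endos[OF flows_Ga[OF \<phi>(1)]]]) (simp add: trunc_points)
  ultimately show ?case using flows_Ga[OF \<phi>(1)] by metis
next
  case (eng g1 g2)
  then obtain h1 h2 where "h1 \<in> flows X" "h2 \<in> flows X" "g1 = cls h1" "g2 = cls h2" by blast
  then show ?case using Aut_mult[OF flows_endos flows_endos] flows_compose by metis
qed

lemma flow_SAut: "h \<in> flows X \<Longrightarrow> cls h \<in> SAut X"
proof (induction rule: flows.induct)
  case flows_id
  then show ?case unfolding SAut_def using generate.one[of "Aut X"] by (simp add: Aut_one)
next
  case (flows_step \<phi> h t)
  note h = flows_endos[OF flows_step.hyps(2)] and \<phi> = Ga_endos[OF flows_step.hyps(1)]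
  show ?case
  proof (cases "effective_Ga_action X \<phi>")
    case True
    then have "cls (\<phi> t) \<in> SAut X" unfolding SAut_def
      by (intro generate.incl) (auto simp: one_param_unipotent_subgroups_def)
    then have "cls (\<phi> t) \<otimes>\<^bsub>Aut X\<^esub> cls h \<in> SAut X"
      using flows_step.IH unfolding SAut_def by (intro generate.eng)
    then show ?thesis by (simp only: Aut_mult[OF \<phi> h])
  next
    case False
    have "cls (\<phi> t \<circ> h) = cls h"
      by (rule cls_cong[OF endos_compose[OF IX_sub \<phi> h] h])
        (simp add: Ga_trivial[OF flows_step.hyps(1) False] flows_points[OF flows_step.hyps(2)])
    then show ?thesis using flows_step.IH by (simp only:)
  qed
qed

text \<open>Translates transitivity of the group of classes into the existence of concrete flows.\<close>

lemma multiply_transitive_iff: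
  assumes "A \<subseteq> points X"
  shows "multiply_transitive m (SAut X) act A \<longleftrightarrow>
    (\<forall>a b. a ` {..<m} \<subseteq> A \<and> inj_on a {..<m} \<and> b ` {..<m} \<subseteq> A \<and> inj_on b {..<m} \<longrightarrow>
      (\<exists>h\<in>flows X. \<forall>j<m. h (a j) = b j))"
proof -
  have "(\<exists>g\<in>SAut X. \<forall>j<m. act g (a j) = b j) \<longleftrightarrow> (\<exists>h\<in>flows X. \<forall>j<m. h (a j) = b j)"
    if "a ` {..<m} \<subseteq> A" for a b
  proof -
    have a: "a j \<in> points X" if "j < m" for j using that \<open>a ` {..<m} \<subseteq> A\<close> assms by auto
    have *: "(\<forall>j<m. act (cls h) (a j) = b j) \<longleftrightarrow> (\<forall>j<m. h (a j) = b j)" if "h \<in> flows X" for h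
      using act_cls[OF flows_endos[OF that] a] by simp
    show ?thesis
    proof
      assume "\<exists>g\<in>SAut X. \<forall>j<m. act g (a j) = b j"
      then show "\<exists>h\<in>flows X. \<forall>j<m. h (a j) = b j" using SAut_flow * by metis
    next
      assume "\<exists>h\<in>flows X. \<forall>j<m. h (a j) = b j"
      then show "\<exists>g\<in>SAut X. \<forall>j<m. act g (a j) = b j" using flow_SAut * by metis
    qed
  qed
  note * = this
  show ?thesis unfolding multiply_transitive_def
    by (intro all_cong1 imp_cong refl *) (elim conjunct1)
qed

subsection \<open>Velocities\<close>

definition velocities :: "point \<Rightarrow> point set"
  where "velocities x = {v. \<exists>\<phi>. Ga_action X \<phi> \<and> (\<forall>i. ((\<lambda>t. \<phi> t x i) has_real_derivative v i) (at 0))}"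

text \<open>Velocities of actions that are not effective are zero.\<close>

lemma span_velocities:
  assumes x: "x \<in> points X" shows "span (orbit_tangents X x) = span (velocities x)"
proof
  show "span (orbit_tangents X x) \<subseteq> span (velocities x)"
    by (rule span_mono) (auto simp: orbit_tangents_def velocities_def effective_Ga_action_def)
  have "v \<in> span (orbit_tangents X x)" if vel: "v \<in> velocities x" for v
  proof -
    obtain \<phi> where \<phi>: "Ga_action X \<phi>" "\<And>i. ((\<lambda>t. \<phi> t x i) has_real_derivative v i) (at 0)"
      using vel unfolding velocities_def by blast
    show ?thesis
    proof (cases "effective_Ga_action X \<phi>")
      case True
      then show ?thesis using \<phi>(2) by (intro span_base) (auto simp: orbit_tangents_def)
    next
      case False
      have "v i = 0" for i
      proof -
        have "((\<lambda>t. x i) has_real_derivative v i) (at 0)"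
          using \<phi>(2)[of i] by (simp add: Ga_trivial[OF \<phi>(1) False x])
        then show ?thesis by (rule DERIV_unique) (rule DERIV_const)
      qed
      then have "v = 0" by auto
      then show ?thesis by (simp add: span_zero)
    qed
  qed
  then show "span (velocities x) \<subseteq> span (orbit_tangents X x)"
    by (intro span_minimal subspace_span) blast
qed

lemma flexible_pointI:
  assumes x: "x \<in> points X" and T: "tangent_space X x \<subseteq> span (velocities x)"
  shows "flexible_point X x"
proof -
  have "velocities x \<subseteq> tangent_space X x"
    using Ga_velocity_tangent[OF IX_sub _ x] by (auto simp: velocities_def)
  then have "span (velocities x) \<subseteq> tangent_space X x"
    by (intro span_minimal tangent_space_subspace[OF IX_sub])
  then show ?thesis using T by (simp add: flexible_point_def span_velocities[OF x])
qed

text \<open>Conjugating an action by a flow transports its velocities.\<close>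

lemma velocities_transport:
  assumes a: "Ga_action X \<phi>" and x: "x \<in> points X" and v: "v \<in> velocities x"
  shows "dmap n (\<phi> t) x v \<in> velocities (\<phi> t x)"
proof -
  obtain \<psi> where \<psi>: "Ga_action X \<psi>" "\<And>i. ((\<lambda>t. \<psi> t x i) has_real_derivative v i) (at 0)"
    using v unfolding velocities_def by blast
  define \<theta> where "\<theta> s = \<phi> t \<circ> \<psi> s \<circ> \<phi> (- t)" for s
  have "Ga_action X \<theta>"
  proof (rule Ga_actionI)
    fix i assume i: "i < n"
    have "(\<lambda>x. \<psi> (x n) (\<phi> (- t) x) k) \<in> polys (Suc n)" if k: "k < n" for k
    proof -
      obtain P where P: "P \<in> polys (Suc n)" "\<And>t x. \<psi> t x k = P (x(n := t))" using Ga_poly[OF \<psi>(1) k] by metis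
      have "(\<lambda>x. P ((\<phi> (- t) x)(n := x n))) \<in> polys (Suc n)"
      proof (rule polys_subst[OF P(1), of "\<lambda>x. (\<phi> (- t) x)(n := x n)"])
        fix j assume "j < Suc n"
        then show "(\<lambda>x. ((\<phi> (- t) x)(n := x n)) j) \<in> polys (Suc n)"
          using polys_mono[OF endos_poly[OF Ga_endos[OF a], of j "- t"], of "Suc n"] polys.var[of n "Suc n"]
          by (cases "j = n") auto
      qed
      then show ?thesis by (simp add: P(2))
    qed
    then have "(\<lambda>x. \<phi> t (\<psi> (x n) (\<phi> (- t) x)) i) \<in> polys (Suc n)"
      by (rule polys_subst[OF endos_poly[OF Ga_endos[OF a] i], of "\<lambda>x. \<psi> (x n) (\<phi> (- t) x)"])
    moreover have "\<phi> (- t) (x(n := s)) = \<phi> (- t) x" for s x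
      by (rule affine_space_eqI[OF endos_affine[OF Ga_endos[OF a]] endos_affine[OF Ga_endos[OF a]]])
        (rule polys_cong[OF endos_poly[OF Ga_endos[OF a]]], auto)
    ultimately show "\<exists>P\<in>polys (Suc n). \<forall>s x. \<theta> s x i = P (x(n := s))"
      by (intro bexI[of _ "\<lambda>x. \<phi> t (\<psi> (x n) (\<phi> (- t) x)) i"]) (auto simp: \<theta>_def)
  qed (use a \<psi>(1) in \<open>auto simp: \<theta>_def endos_affine[OF Ga_endos] Ga_points Ga_zero Ga_inverse Ga_inverse' Ga_add\<close>)
  moreover have "((\<lambda>s. \<theta> s (\<phi> t x) i) has_real_derivative dmap n (\<phi> t) x v i) (at 0)" for i
  proof (cases "i < n")
    case True
    have "((\<lambda>s. \<phi> t (\<psi> s x) i) has_real_derivative dpoly n (\<lambda>x. \<phi> t x i) (\<psi> 0 x) v) (at 0)"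
      by (rule dpoly_chain[OF endos_poly[OF Ga_endos[OF a] True] \<psi>(2)])
    then show ?thesis using True by (simp add: \<theta>_def Ga_inverse[OF a x] Ga_zero[OF \<psi>(1) x] dmap_def)
  next
    case False
    then have "\<theta> s (\<phi> t x) i = 0" for s
      using endos_affine[OF Ga_endos[OF a]] by (simp add: \<theta>_def affine_space_def)
    then show ?thesis using False by (simp add: dmap_def)
  qed
  ultimately show ?thesis unfolding velocities_def by blast
qed

lemma flexible_point_Ga:
  assumes a: "Ga_action X \<phi>" and x: "x \<in> points X" and f: "flexible_point X x"
  shows "flexible_point X (\<phi> t x)"
proof (rule flexible_pointI[OF Ga_points[OF a x]])
  show "tangent_space X (\<phi> t x) \<subseteq> span (velocities (\<phi> t x))"
  proof
    fix w assume w: "w \<in> tangent_space X (\<phi> t x)"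
    let ?w = "dmap n (\<phi> (- t)) (\<phi> t x) w"
    have "?w \<in> tangent_space X (\<phi> (- t) (\<phi> t x))" by (rule dmap_tangent[OF IX_sub Ga_endos[OF a] w])
    then have "?w \<in> span (velocities x)"
      using f by (simp add: Ga_inverse[OF a x] flexible_point_def span_velocities[OF x])
    then have "dmap n (\<phi> t) x ?w \<in> span (dmap n (\<phi> t) x ` velocities x)"
      by (simp add: linear_span_image[OF linear_dmap])
    then have 1: "dmap n (\<phi> t) x ?w \<in> span (velocities (\<phi> t x))"
      using span_mono[of "dmap n (\<phi> t) x ` velocities x" "velocities (\<phi> t x)"] velocities_transport[OF a x] by blast
    have s: "same_morphism X (\<phi> t \<circ> \<phi> (- t)) id"
      using same_morphism_id_iff[OF endos_compose[OF IX_sub Ga_endos[OF a] Ga_endos[OF a]]] Ga_inverse'[OF a] by simp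
    have "dmap n (\<phi> t \<circ> \<phi> (- t)) (\<phi> t x) w = w"
      by (rule dmap_same_morphism_id[OF IX_sub endos_compose[OF IX_sub Ga_endos[OF a] Ga_endos[OF a]] s w])
    moreover have "dmap n (\<phi> t \<circ> \<phi> (- t)) (\<phi> t x) w = dmap n (\<phi> t) (\<phi> (- t) (\<phi> t x)) ?w"
      using dpoly_endo[OF Ga_endos[OF a] endos_poly[OF Ga_endos[OF a]], of _ t "- t" "\<phi> t x" w]
      by (auto simp: dmap_def comp_def)
    ultimately show "w \<in> span (velocities (\<phi> t x))" using 1 Ga_inverse[OF a x] by simp
  qed
qed

lemma flexible_point_flow:
  "h \<in> flows X \<Longrightarrow> x \<in> points X \<Longrightarrow> flexible_point X x \<Longrightarrow> flexible_point X (h x)"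
  by (induction rule: flows.induct) (auto simp: trunc_points flexible_point_Ga flows_points)

end

section \<open>Lifting actions to the suspension\<close>

lemma upoly_polys_compose:
  assumes "upoly r" "p \<in> polys m" shows "(\<lambda>x. r (p x)) \<in> polys m"
proof -
  obtain P where "\<And>s. r s = poly P s" using assms(1) unfolding upoly_def by blast
  then have "r (p x) = (\<Sum>i\<le>degree P. coeff P i * p x ^ i)" for x by (simp add: poly_altdef)
  moreover have "(\<lambda>x. \<Sum>i\<le>degree P. coeff P i * p x ^ i) \<in> polys m" by (intro polys_intros assms)
  ultimately show ?thesis by simp
qed

lemma upoly_has_derivative:
  assumes "upoly h" obtains D where "(h has_real_derivative D) (at s)"
proof -
  obtain P where "h = poly P" using assms unfolding upoly_def by auto
  then show ?thesis using that poly_DERIV[of P s] by blast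
qed

lemma Ga_velocity_ex:
  assumes "Ga_action X \<phi>"
  obtains v where "\<And>i. ((\<lambda>t. \<phi> t x i) has_real_derivative v i) (at 0)"
proof -
  have "upoly (\<lambda>t. \<phi> t x i)" for i
    by (rule Ga_upoly[OF assms upoly_id]) (rule upoly_const)
  then have "\<forall>i. \<exists>D. ((\<lambda>t. \<phi> t x i) has_real_derivative D) (at 0)" using upoly_has_derivative by metis
  then show ?thesis using that by metis
qed

context suspension
begin

sublocale YR: real_var Y
  by (rule real_var.intro, rule affine_variety_ideal[OF Y], rule dominated_real_variety[OF affine_variety_ideal[OF Y] dom])

sublocale SR: real_var S
  by (rule real_var.intro, rule ideal_S) (use vanishing_S_iff_points in \<open>auto simp: real_variety_def\<close>)

lemma Ga_trunc:
  assumes "Ga_action Y \<phi>" shows "\<phi> t (trunc n x) = \<phi> t x"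
  by (rule affine_space_eqI[OF endos_affine[OF Ga_endos[OF assms]] endos_affine[OF Ga_endos[OF assms]]])
    (rule polys_trunc[OF endos_poly[OF Ga_endos[OF assms]]])

text \<open>The quotient of the increment of \<open>f\<close> along an orbit by the elapsed time is polynomial, also at
  time 0, where it is the derivative of \<open>f\<close>. The identity holds only over points of the variety, since
  \<open>\<phi> 0\<close> need not fix other points.\<close>

lemma increment_ex:
  assumes a: "Ga_action Y \<phi>"
  shows "\<exists>E\<in>polys (Suc n). \<forall>y\<in>points Y. \<forall>t. f (\<phi> t y) = f y + t * E (y(n := t))"
proof -
  have "(\<lambda>x. f (\<phi> (x n) x)) \<in> polys (Suc n)"
  proof (rule polys_subst[OF f, of "\<lambda>x. \<phi> (x n) x"])
    fix i assume "i < n"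
    then obtain P where P: "P \<in> polys (Suc n)" "\<And>t x. \<phi> t x i = P (x(n := t))" using Ga_poly[OF a] by metis
    then show "(\<lambda>x. \<phi> (x n) x i) \<in> polys (Suc n)" by simp
  qed
  from polys_split_last[OF this] obtain F0 E where E: "F0 \<in> polys n" "E \<in> polys (Suc n)"
    "\<And>x. f (\<phi> (x n) x) = F0 x + x n * E x" by metis
  have "f (\<phi> t y) = f y + t * E (y(n := t))" if y: "y \<in> points Y" for y t
  proof -
    have *: "f (\<phi> t y) = F0 y + t * E (y(n := t))" for t
    proof -
      have "\<phi> t (y(n := t)) = \<phi> t y"
        using Ga_trunc[OF a, of t y] Ga_trunc[OF a, of t "y(n := t)"] by (simp add: trunc_def cong: if_cong)
      moreover have "F0 (y(n := t)) = F0 y" by (rule polys_cong[OF E(1)]) simp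
      ultimately show ?thesis using E(3)[of "y(n := t)"] by simp
    qed
    from *[of 0] have "f y = F0 y" using Ga_zero[OF a y] by simp
    then show ?thesis using * by simp
  qed
  then show ?thesis using E(2) by blast
qed

definition increment :: "(real \<Rightarrow> point \<Rightarrow> point) \<Rightarrow> point \<Rightarrow> real"
  where "increment \<phi> = (SOME E. E \<in> polys (Suc n) \<and> (\<forall>y\<in>points Y. \<forall>t. f (\<phi> t y) = f y + t * E (y(n := t))))"

lemma increment:
  assumes "Ga_action Y \<phi>"
  shows "increment \<phi> \<in> polys (Suc n)" "y \<in> points Y \<Longrightarrow> f (\<phi> t y) = f y + t * increment \<phi> (y(n := t))"
proof -
  have "\<exists>E. E \<in> polys (Suc n) \<and> (\<forall>y\<in>points Y. \<forall>t. f (\<phi> t y) = f y + t * E (y(n := t)))"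
    using increment_ex[OF assms] by blast
  from someI_ex[OF this]
  show "increment \<phi> \<in> polys (Suc n)" "y \<in> points Y \<Longrightarrow> f (\<phi> t y) = f y + t * increment \<phi> (y(n := t))"
    unfolding increment_def by blast+
qed

text \<open>The action on the suspension that fixes \<open>u\<close>, moves the base point by \<open>\<phi>\<close> at speed \<open>u r u\<close>, and adapts
  \<open>v\<close> so that \<open>f = uv\<close> is preserved. The factor \<open>u\<close> in the speed makes the change of \<open>v\<close>, which is the
  change of \<open>f\<close> divided by \<open>u\<close>, polynomial.\<close>

definition lift :: "(real \<Rightarrow> point \<Rightarrow> point) \<Rightarrow> (real \<Rightarrow> real) \<Rightarrow> real \<Rightarrow> point \<Rightarrow> point"
  where "lift \<phi> r t x = sp (\<phi> (t * x n * r (x n)) x) (x n)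
    (x (Suc n) + t * r (x n) * increment \<phi> (x(n := t * x n * r (x n))))"

lemma lift_coords:
  assumes a: "Ga_action Y \<phi>"
  shows "lift \<phi> r t x n = x n"
    "trunc n (lift \<phi> r t x) = \<phi> (t * x n * r (x n)) (trunc n x)"
    "lift \<phi> r t x (Suc n) = x (Suc n) + t * r (x n) * increment \<phi> ((trunc n x)(n := t * x n * r (x n)))"
    "lift \<phi> r t x \<in> affine_space (Suc (Suc n))"
proof -
  show "lift \<phi> r t x n = x n" by (simp add: lift_def)
  have A: "\<phi> s x \<in> affine_space n" for s using endos_affine[OF Ga_endos[OF a]] by simp
  then show "trunc n (lift \<phi> r t x) = \<phi> (t * x n * r (x n)) (trunc n x)"
    unfolding Ga_trunc[OF a] by (auto simp: lift_def trunc_def affine_space_def fun_eq_iff)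
  have "increment \<phi> (x(n := s)) = increment \<phi> ((trunc n x)(n := s))" for s
    by (rule polys_cong[OF increment(1)[OF a]]) (auto simp: trunc_def)
  then show "lift \<phi> r t x (Suc n) = x (Suc n) + t * r (x n) * increment \<phi> ((trunc n x)(n := t * x n * r (x n)))"
    by (simp add: lift_def)
  show "lift \<phi> r t x \<in> affine_space (Suc (Suc n))" using A by (auto simp: lift_def affine_space_def)
qed

lemma S_eqI:
  assumes "x \<in> affine_space (Suc (Suc n))" "y \<in> affine_space (Suc (Suc n))"
    "trunc n x = trunc n y" "x n = y n" "x (Suc n) = y (Suc n)"
  shows "x = y"
proof -
  have "x = sp (trunc n x) (x n) (x (Suc n))" by (rule sp_trunc[OF assms(1), symmetric])
  also have "\<dots> = sp (trunc n y) (y n) (y (Suc n))" by (simp only: assms(3-5))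
  also have "\<dots> = y" by (rule sp_trunc[OF assms(2)])
  finally show ?thesis .
qed

lemma lift_points:
  assumes a: "Ga_action Y \<phi>" and x: "x \<in> points S"
  shows "lift \<phi> r t x \<in> points S"
proof -
  have y: "trunc n x \<in> points Y" "f (trunc n x) = x n * x (Suc n)"
    using x polys_trunc[OF f] by (simp_all add: points_S)
  have "f (lift \<phi> r t x) = f (trunc n (lift \<phi> r t x))" using polys_trunc[OF f] by simp
  also have "\<dots> = lift \<phi> r t x n * lift \<phi> r t x (Suc n)"
    unfolding lift_coords(1-3)[OF a] increment(2)[OF a y(1)] y(2) by (simp add: algebra_simps)
  finally show ?thesis unfolding points_S
    using lift_coords(2,4)[OF a] Ga_points[OF a y(1)] by simp
qed

lemma Ga_action_lift:
  assumes a: "Ga_action Y \<phi>" and r: "upoly r"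
  shows "Ga_action S (lift \<phi> r)"
proof (rule SR.Ga_actionI, unfold nvars_S)
  let ?m = "Suc (Suc n)"
  fix i assume i: "i < ?m"
  let ?Q = "\<lambda>x. lift \<phi> r (x ?m) x i"
  have cong: "lift \<phi> r t (x(?m := s)) = lift \<phi> r t x" for t s x
    by (rule S_eqI[OF lift_coords(4)[OF a] lift_coords(4)[OF a]]; simp only: lift_coords[OF a])
      (auto simp: trunc_def cong: if_cong)
  have var: "(\<lambda>x. x k) \<in> polys (Suc ?m)" if "k < Suc ?m" for k using that by (rule polys.var)
  have \<tau>: "(\<lambda>x. x ?m * x n * r (x n)) \<in> polys (Suc ?m)" "(\<lambda>x. x ?m * r (x n)) \<in> polys (Suc ?m)"
    by (intro polys_mult var upoly_polys_compose[OF r]; simp)+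
  have sub: "(\<lambda>x. P (x(n := x ?m * x n * r (x n)))) \<in> polys (Suc ?m)" if P: "P \<in> polys (Suc n)" for P
  proof (rule polys_subst[OF P, of "\<lambda>x. x(n := x ?m * x n * r (x n))"])
    fix j assume "j < Suc n"
    then show "(\<lambda>x. (x(n := x ?m * x n * r (x n))) j) \<in> polys (Suc ?m)"
      using \<tau>(1) var by (cases "j = n") auto
  qed
  have "?Q \<in> polys (Suc ?m)"
  proof -
    consider "i < n" | "i = n" | "i = Suc n" using i by linarith
    then show ?thesis
    proof cases
      case 1
      obtain P where P: "P \<in> polys (Suc n)" "\<And>t x. \<phi> t x i = P (x(n := t))" using Ga_poly[OF a 1] by metis
      show ?thesis using sub[OF P(1)] 1 by (simp add: lift_def P(2))
    next
      case 2
      then show ?thesis using var[of n] by (simp add: lift_def)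
    next
      case 3
      have "(\<lambda>x. x (Suc n) + x ?m * r (x n) * increment \<phi> (x(n := x ?m * x n * r (x n)))) \<in> polys (Suc ?m)"
        by (intro polys_add var polys_mult[OF \<tau>(2)] sub increment(1)[OF a]) simp
      then show ?thesis using 3 by (simp add: lift_def)
    qed
  qed
  moreover have "lift \<phi> r t x i = ?Q (x(?m := t))" for t x using cong[of t x t] by simp
  ultimately show "\<exists>P\<in>polys (Suc ?m). \<forall>t x. lift \<phi> r t x i = P (x(?m := t))"
    by (intro bexI[of _ ?Q] allI)
next
  fix t x show "lift \<phi> r t x \<in> affine_space (Suc (Suc n))" by (rule lift_coords(4)[OF a])
next
  fix t x assume "x \<in> points S" then show "lift \<phi> r t x \<in> points S" by (rule lift_points[OF a])
next
  fix x assume x: "x \<in> points S"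
  then have y: "trunc n x \<in> points Y" by (simp add: points_S)
  show "lift \<phi> r 0 x = x"
    by (rule S_eqI[OF lift_coords(4)[OF a]]; (simp only: lift_coords[OF a])?)
      (use x Ga_zero[OF a y] in \<open>auto simp: points_S\<close>)
next
  fix s t x assume x: "x \<in> points S"
  then have y: "trunc n x \<in> points Y" by (simp add: points_S)
  have T: "trunc n (lift \<phi> r (s + t) x) = trunc n (lift \<phi> r s (lift \<phi> r t x))"
    unfolding lift_coords[OF a] using Ga_add[OF a y] by (simp add: algebra_simps)
  have p: "lift \<phi> r (s + t) x \<in> points S" "lift \<phi> r s (lift \<phi> r t x) \<in> points S"
    using lift_points[OF a] x by blast+
  show "lift \<phi> r (s + t) x = lift \<phi> r s (lift \<phi> r t x)"
  proof (rule S_eqI[OF lift_coords(4)[OF a] lift_coords(4)[OF a] T])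
    show "lift \<phi> r (s + t) x n = lift \<phi> r s (lift \<phi> r t x) n" by (simp add: lift_coords[OF a])
    \<comment> \<open>For \<open>u \<noteq> 0\<close> the value of \<open>v\<close> is determined by the other coordinates; for \<open>u = 0\<close> the base point
      does not move and \<open>v\<close> changes at constant speed.\<close>
    show "lift \<phi> r (s + t) x (Suc n) = lift \<phi> r s (lift \<phi> r t x) (Suc n)"
    proof (cases "x n = 0")
      case True
      then show ?thesis by (simp add: lift_coords[OF a] Ga_zero[OF a y] algebra_simps)
    next
      case False
      have "f (lift \<phi> r (s + t) x) = f (lift \<phi> r s (lift \<phi> r t x))"
        using T polys_trunc[OF f] by metis
      then show ?thesis using p False by (simp add: points_S lift_coords(1)[OF a])
    qed
  qed
qed

lemma increment_velocity:
  assumes a: "Ga_action Y \<phi>" and y: "y \<in> points Y"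
    and v: "\<And>i. ((\<lambda>t. \<phi> t y i) has_real_derivative v i) (at 0)"
  shows "increment \<phi> (y(n := 0)) = dpoly n f y v"
proof -
  have "((\<lambda>t. f (\<phi> t y)) has_real_derivative dpoly n f (\<phi> 0 y) v) (at 0)"
    by (rule dpoly_chain[OF f v])
  moreover have "((\<lambda>t. f y + t * increment \<phi> (y(n := t))) has_real_derivative increment \<phi> (y(n := 0))) (at 0)"
  proof -
    obtain D where D: "((\<lambda>t. increment \<phi> (y(n := t))) has_real_derivative D) (at 0)"
    proof (rule upoly_has_derivative)
      show "upoly (\<lambda>t. increment \<phi> (y(n := t)))"
        by (rule upoly_polys[OF increment(1)[OF a]]) (auto simp: less_Suc_eq intro: upoly_const upoly_id)
    qed
    show ?thesis by (auto intro!: derivative_eq_intros D)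
  qed
  ultimately show ?thesis
    using DERIV_unique Ga_zero[OF a y] unfolding increment(2)[OF a y] by metis
qed

text \<open>For \<open>r = 1\<close>: the derivative of \<open>f\<close> along the velocity is the velocity of \<open>v\<close>.\<close>

lemma lift_velocity:
  assumes x: "x \<in> points S" and v: "v \<in> YR.velocities (trunc n x)"
  shows "sp (x n *\<^sub>R v) 0 (dpoly n f (trunc n x) v) \<in> SR.velocities x"
proof -
  have y: "trunc n x \<in> points Y" using x by (simp add: points_S)
  obtain \<phi> where a: "Ga_action Y \<phi>" and \<phi>: "\<And>i. ((\<lambda>t. \<phi> t (trunc n x) i) has_real_derivative v i) (at 0)"
    using v unfolding YR.velocities_def by blast
  let ?r = "\<lambda>s::real. 1::real"
  have "((\<lambda>t. lift \<phi> ?r t x i) has_real_derivative sp (x n *\<^sub>R v) 0 (dpoly n f (trunc n x) v) i) (at 0)" for i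
  proof -
    consider "i = n" | "i = Suc n" | "i \<noteq> n" "i \<noteq> Suc n" by blast
    then show ?thesis
    proof cases
      case 1
      then show ?thesis by (simp add: lift_coords(1)[OF a])
    next
      case 2
      obtain D where D: "((\<lambda>t. increment \<phi> ((trunc n x)(n := t * x n))) has_real_derivative D) (at 0)"
      proof (rule upoly_has_derivative)
        show "upoly (\<lambda>t. increment \<phi> ((trunc n x)(n := t * x n)))"
          by (rule upoly_polys[OF increment(1)[OF a]])
            (auto simp: less_Suc_eq intro: upoly_const upoly_mult[OF upoly_id upoly_const])
      qed
      have "((\<lambda>t. x (Suc n) + t * increment \<phi> ((trunc n x)(n := t * x n))) has_real_derivative
          increment \<phi> ((trunc n x)(n := 0))) (at 0)"
        by (auto intro!: derivative_eq_intros D)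
      then show ?thesis using 2 by (simp add: lift_coords(3)[OF a] increment_velocity[OF a y \<phi>])
    next
      case 3
      have 1: "((\<lambda>t. t * x n) has_real_derivative x n) (at 0)" by (auto intro!: derivative_eq_intros)
      have "((\<lambda>t. \<phi> (t * x n) (trunc n x) i) has_real_derivative v i * x n) (at 0)"
        using DERIV_chain2[of "\<lambda>t. \<phi> t (trunc n x) i" "v i" "\<lambda>t. t * x n" 0 "x n" UNIV] \<phi>[of i] 1 by simp
      moreover have "lift \<phi> ?r t x i = \<phi> (t * x n) (trunc n x) i" for t
        using 3 Ga_trunc[OF a] by (simp add: lift_def)
      ultimately show ?thesis using 3 by (simp add: scaleR_fun_def mult.commute)
    qed
  qed
  then show ?thesis using Ga_action_lift[OF a upoly_const] unfolding SR.velocities_def by blast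
qed

subsection \<open>Exchanging the two suspension coordinates\<close>

definition swap :: "point \<Rightarrow> point" where "swap x = x(n := x (Suc n), Suc n := x n)"

lemma swap_simps [simp]:
  "swap x n = x (Suc n)" "swap x (Suc n) = x n" "trunc n (swap x) = trunc n x" "swap (swap x) = x"
  by (auto simp: swap_def trunc_def cong: if_cong)

lemma swap_affine: "x \<in> affine_space (Suc (Suc n)) \<Longrightarrow> swap x \<in> affine_space (Suc (Suc n))"
  by (auto simp: swap_def affine_space_def)

lemma swap_points: "x \<in> points S \<Longrightarrow> swap x \<in> points S"
  using polys_trunc[OF f, of x] polys_trunc[OF f, of "swap x"]
  by (simp add: points_S swap_affine mult.commute)

lemma Ga_action_swap:
  assumes a: "Ga_action S \<theta>" shows "Ga_action S (\<lambda>t x. swap (\<theta> t (swap x)))"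
proof (rule SR.Ga_actionI, unfold nvars_S)
  let ?m = "Suc (Suc n)"
  fix i assume i: "i < ?m"
  define j where "j = (if i = n then Suc n else if i = Suc n then n else i)"
  have j: "j < ?m" "\<And>z. swap z i = z j" using i by (auto simp: j_def swap_def)
  obtain P where P: "P \<in> polys (Suc ?m)" "\<And>t x. \<theta> t x j = P (x(?m := t))"
    using Ga_poly[OF a, of j] j(1) by (metis nvars_S)
  have "(\<lambda>x. P (swap x)) \<in> polys (Suc ?m)"
  proof (rule polys_subst[OF P(1), of swap])
    fix k assume "k < Suc ?m"
    then show "(\<lambda>x. swap x k) \<in> polys (Suc ?m)"
      by (cases "k = n"; cases "k = Suc n") (auto simp: swap_def intro: polys.var)
  qed
  moreover have "(swap x)(?m := t) = swap (x(?m := t))" for x t by (auto simp: swap_def)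
  ultimately show "\<exists>P\<in>polys (Suc ?m). \<forall>t x. swap (\<theta> t (swap x)) i = P (x(?m := t))"
    by (intro bexI[of _ "\<lambda>x. P (swap x)"]) (auto simp: j(2) P(2))
next
  fix t x show "swap (\<theta> t (swap x)) \<in> affine_space (Suc (Suc n))"
    using swap_affine endos_affine[OF Ga_endos[OF a]] by simp
qed (use a in \<open>auto simp: swap_points Ga_points Ga_zero Ga_add\<close>)

lemma swap_flow: "h \<in> flows S \<Longrightarrow> \<exists>h'\<in>flows S. \<forall>x\<in>points S. h' x = swap (h (swap x))"
proof (induction rule: flows.induct)
  case flows_id
  show ?case
    by (rule bexI[OF _ flows.flows_id]) (auto simp: trunc_points swap_points simp del: nvars_S)
next
  case (flows_step \<theta> h t)
  then obtain h' where h': "h' \<in> flows S" "\<And>x. x \<in> points S \<Longrightarrow> h' x = swap (h (swap x))" by blast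
  show ?case
    by (rule bexI[OF _ flows.flows_step[OF Ga_action_swap[OF flows_step.hyps(1)] h'(1), of t]])
      (simp add: h'(2))
qed

lemma swap_velocities:
  assumes "v \<in> SR.velocities (swap x)" shows "swap v \<in> SR.velocities x"
proof -
  obtain \<theta> where a: "Ga_action S \<theta>" and v: "\<And>i. ((\<lambda>t. \<theta> t (swap x) i) has_real_derivative v i) (at 0)"
    using assms unfolding SR.velocities_def by blast
  have "((\<lambda>t. swap (\<theta> t (swap x)) i) has_real_derivative swap v i) (at 0)" for i
    using v by (cases "i = n"; cases "i = Suc n") (auto simp: swap_def)
  then show ?thesis using Ga_action_swap[OF a] unfolding SR.velocities_def by blast
qed

subsection \<open>Moving points inside a level of a suspension coordinate\<close>

text \<open>Lift the actions that make up \<open>h\<close>, with the speed \<open>u r u\<close> chosen as a polynomial that is 1 at \<open>u = c\<close>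
  and 0 at the levels in \<open>L\<close>.\<close>

lemma level_flow:
  assumes L: "finite L" "c \<notin> L" and c: "c \<noteq> 0"
  shows "h \<in> flows Y \<Longrightarrow> \<exists>g\<in>flows S. \<forall>x\<in>points S.
    (x n = c \<longrightarrow> g x n = c \<and> trunc n (g x) = h (trunc n x)) \<and> (x n \<in> L \<longrightarrow> g x = x)"
proof (induction rule: flows.induct)
  case flows_id
  show ?case
  proof (rule bexI[OF _ flows.flows_id], intro ballI)
    fix x assume x: "x \<in> points S"
    have "trunc n (trunc n x) = trunc n x" by (rule trunc_id) simp
    then show "(x n = c \<longrightarrow> trunc (nvars S) x n = c \<and> trunc n (trunc (nvars S) x) = trunc n (trunc n x)) \<and>
        (x n \<in> L \<longrightarrow> trunc (nvars S) x = x)"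
      by (simp only: trunc_points[OF x]) simp
  qed
next
  case (flows_step \<phi> h t)
  then obtain g where g: "g \<in> flows S" "\<And>x. x \<in> points S \<Longrightarrow>
    (x n = c \<longrightarrow> g x n = c \<and> trunc n (g x) = h (trunc n x)) \<and> (x n \<in> L \<longrightarrow> g x = x)" by blast
  note a = flows_step.hyps(1)
  define r where "r s = inverse (c * (\<Prod>l\<in>L. c - l)) * (\<Prod>l\<in>L. s - l)" for s
  have r: "upoly r" unfolding r_def[abs_def]
    by (intro upoly_mult upoly_prod upoly_diff upoly_const upoly_id)
  have "(\<Prod>l\<in>L. c - l) \<noteq> 0" using L by auto
  then have rc: "c * r c = 1" using c by (simp add: r_def field_simps)
  have rL: "r l = 0" if "l \<in> L" for l using that L(1) by (auto simp: r_def)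
  have fixed: "lift \<phi> r t x = x" if x: "x \<in> points S" "x n \<in> L" for x
  proof -
    have y: "trunc n x \<in> points Y" using x by (simp add: points_S)
    show ?thesis
      by (rule S_eqI[OF lift_coords(4)[OF a]]; (simp only: lift_coords[OF a])?)
        (use x rL Ga_zero[OF a y] in \<open>auto simp: points_S\<close>)
  qed
  show ?case
  proof (rule bexI[OF _ flows.flows_step[OF Ga_action_lift[OF a r] g(1), of t]], intro ballI conjI impI)
    fix x assume x: "x \<in> points S"
    show "(lift \<phi> r t \<circ> g) x = x" if "x n \<in> L" using g(2)[OF x] fixed[OF x] that by simp
    show "(lift \<phi> r t \<circ> g) x n = c" if "x n = c" using g(2)[OF x] that by (simp add: lift_coords(1)[OF a])
    show "trunc n ((lift \<phi> r t \<circ> g) x) = (\<phi> t \<circ> h) (trunc n x)" if "x n = c"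
      using g(2)[OF x] that rc by (simp add: lift_coords(2)[OF a] mult.assoc)
  qed
qed

lemma level_flow':
  assumes L: "finite L" "c \<notin> L" and c: "c \<noteq> 0" and h: "h \<in> flows Y"
  shows "\<exists>g\<in>flows S. \<forall>x\<in>points S.
    (x (Suc n) = c \<longrightarrow> g x (Suc n) = c \<and> trunc n (g x) = h (trunc n x)) \<and> (x (Suc n) \<in> L \<longrightarrow> g x = x)"
proof -
  obtain g where g: "g \<in> flows S" "\<And>x. x \<in> points S \<Longrightarrow>
    (x n = c \<longrightarrow> g x n = c \<and> trunc n (g x) = h (trunc n x)) \<and> (x n \<in> L \<longrightarrow> g x = x)"
    using level_flow[OF L c h] by blast
  obtain g' where g': "g' \<in> flows S" "\<And>x. x \<in> points S \<Longrightarrow> g' x = swap (g (swap x))"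
    using swap_flow[OF g(1)] by blast
  show ?thesis
    by (rule bexI[OF _ g'(1)]) (use g'(2) g(2)[OF swap_points] in auto)
qed

end

section \<open>Flexibility and transitivity of the suspension\<close>

locale suspension_step = suspension +
  assumes flexible_Y: "flexible Y"
    and transitive_Y: "\<And>m. multiply_transitive m (SAut Y) act (reg Y)"
begin

lemma reg_points: "y \<in> reg Y \<Longrightarrow> y \<in> points Y" "x \<in> reg S \<Longrightarrow> x \<in> points S"
  by (simp_all add: reg_def)

lemma move_one:
  assumes "y \<in> reg Y" "z \<in> reg Y" shows "\<exists>h\<in>flows Y. h y = z"
proof -
  have "reg Y \<subseteq> points Y" by (auto simp: reg_def)
  from YR.multiply_transitive_iff[OF this, of 1] transitive_Y[of 1]
  have "\<forall>a b. a ` {..<1} \<subseteq> reg Y \<and> inj_on a {..<1} \<and> b ` {..<1} \<subseteq> reg Y \<and> inj_on b {..<1} \<longrightarrow>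
      (\<exists>h\<in>flows Y. \<forall>j<1. h (a j) = b (j::nat))" by blast
  from this[rule_format, of "\<lambda>_. y" "\<lambda>_. z"] show ?thesis
    using assms by (auto simp: image_subset_iff inj_on_def)
qed

lemma move_two:
  assumes "y \<in> reg Y" "y' \<in> reg Y" "y \<noteq> y'" "z \<in> reg Y" "z' \<in> reg Y" "z \<noteq> z'"
  shows "\<exists>h\<in>flows Y. h y = z \<and> h y' = z'"
proof -
  have "reg Y \<subseteq> points Y" by (auto simp: reg_def)
  from YR.multiply_transitive_iff[OF this, of 2] transitive_Y[of 2]
  have *: "\<forall>a b. a ` {..<2} \<subseteq> reg Y \<and> inj_on a {..<2} \<and> b ` {..<2} \<subseteq> reg Y \<and> inj_on b {..<2} \<longrightarrow>
      (\<exists>h\<in>flows Y. \<forall>j<2. h (a j) = b (j::nat))" by blast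
  define pair where "pair p q = (\<lambda>j::nat. if j = 0 then p else q)" for p q :: point
  have "\<exists>h\<in>flows Y. \<forall>j<2. h (pair y y' j) = pair z z' j"
    by (rule *[rule_format]) (use assms in \<open>auto simp: pair_def inj_on_def\<close>)
  then obtain h where h: "h \<in> flows Y" "\<And>j. j < 2 \<Longrightarrow> h (pair y y' j) = pair z z' j" by blast
  show ?thesis using h(1) h(2)[of 0] h(2)[of 1] by (auto simp: pair_def)
qed

lemma f_value_ex: "\<exists>z. z \<in> reg Y \<and> f z = c"
proof -
  have "c \<in> f ` reg Y" by (simp add: f_surj)
  then show ?thesis by blast
qed

lemma f_value: obtains z where "z \<in> reg Y" "f z = c"
  using f_value_ex[of c] by blast

lemma equation: "x \<in> points S \<Longrightarrow> f (trunc n x) = x n * x (Suc n)"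
  by (simp add: points_S polys_trunc[OF f])

lemma reg_trunc: "x \<in> reg S \<Longrightarrow> trunc n x \<in> reg Y"
  by (simp add: reg_S)

lemma reg_S_flow: "h \<in> flows S \<Longrightarrow> x \<in> reg S \<Longrightarrow> h x \<in> reg S"
  by (rule flows_reg[OF ideal_S])

text \<open>The velocities span the tangent space, so they are not all in the kernel of the differential of \<open>f\<close>.\<close>

lemma velocity_slope:
  assumes y: "y \<in> reg Y" and w: "w \<in> tangent_space Y y" "dpoly n f y w \<noteq> 0"
  obtains v where "v \<in> YR.velocities y" "dpoly n f y v \<noteq> 0"
proof -
  have T: "tangent_space Y y = span (YR.velocities y)"
    using flexible_Y y YR.span_velocities[OF reg_points(1)[OF y]] by (simp add: flexible_def flexible_point_def)
  have "\<exists>v\<in>YR.velocities y. dpoly n f y v \<noteq> 0"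
  proof (rule ccontr)
    assume "\<not> ?thesis"
    then have "span (YR.velocities y) \<subseteq> {v. dpoly n f y v = 0}"
      by (intro span_minimal) (auto simp: subspace_def dpoly_lin)
    then show False using w T by auto
  qed
  then show ?thesis using that by blast
qed

text \<open>The coordinate \<open>u\<close> can be made nonzero: if \<open>v\<close> is nonzero, move inside the level of \<open>v\<close>; if both
  vanish, \<open>f\<close> has nonzero slope at the base point, and a lifted action first makes \<open>v\<close> nonzero.\<close>

lemma make_u_nonzero:
  assumes x: "x \<in> reg S" shows "\<exists>g\<in>flows S. g x n \<noteq> 0"
proof -
  have v_case: "\<exists>g\<in>flows S. g x n \<noteq> 0" if x: "x \<in> reg S" and v: "x (Suc n) \<noteq> 0" for x
  proof -
    obtain z where z: "z \<in> reg Y" "f z = x (Suc n)" by (rule f_value)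
    obtain h where h: "h \<in> flows Y" "h (trunc n x) = z" using move_one[OF reg_trunc[OF x] z(1)] by blast
    obtain g where g: "g \<in> flows S" "\<And>x'. x' \<in> points S \<Longrightarrow>
      (x' (Suc n) = x (Suc n) \<longrightarrow> g x' (Suc n) = x (Suc n) \<and> trunc n (g x') = h (trunc n x'))"
      using level_flow'[OF _ _ v h(1), of "{}"] by auto
    have "g x (Suc n) = x (Suc n)" "trunc n (g x) = z" using g(2)[OF reg_points(2)[OF x]] h(2) by simp_all
    then have "x (Suc n) = g x n * x (Suc n)"
      using equation[OF reg_points(2)[OF reg_S_flow[OF g(1) x]]] z(2) by simp
    then have "g x n \<noteq> 0" using v by auto
    then show ?thesis using g(1) by blast
  qed
  consider "x n \<noteq> 0" | "x (Suc n) \<noteq> 0" | "x n = 0" "x (Suc n) = 0" by blast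
  then show ?thesis
  proof cases
    case 1
    then show ?thesis
      by (intro bexI[OF _ flows.flows_id]) (simp add: trunc_points[OF reg_points(2)[OF x]] del: nvars_S)
  next
    case 2
    then show ?thesis using v_case[OF x] by blast
  next
    case 3
    then obtain w where w: "w \<in> tangent_space Y (trunc n x)" "dpoly n f (trunc n x) w \<noteq> 0"
      using x by (auto simp: reg_S)
    obtain v where v: "v \<in> YR.velocities (trunc n x)" "dpoly n f (trunc n x) v \<noteq> 0"
      by (rule velocity_slope[OF reg_trunc[OF x] w])
    obtain \<phi> where a: "Ga_action Y \<phi>" and \<phi>: "\<And>i. ((\<lambda>t. \<phi> t (trunc n x) i) has_real_derivative v i) (at 0)"
      using v(1) unfolding YR.velocities_def by blast
    have al: "Ga_action S (lift \<phi> (\<lambda>s. 1))" by (rule Ga_action_lift[OF a upoly_const])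
    let ?g = "lift \<phi> (\<lambda>s. 1) 1 \<circ> trunc (nvars S)"
    have g: "?g \<in> flows S" by (rule flows_Ga[OF al])
    have "?g x (Suc n) = dpoly n f (trunc n x) v"
      using 3 increment_velocity[OF a reg_points(1)[OF reg_trunc[OF x]] \<phi>]
      by (simp add: trunc_points[OF reg_points(2)[OF x]] lift_coords(3)[OF a] del: nvars_S)
    then have "?g x (Suc n) \<noteq> 0" using v(2) by simp
    then obtain g' where g': "g' \<in> flows S" "g' (?g x) n \<noteq> 0"
      using v_case[OF reg_S_flow[OF g x]] by blast
    then show ?thesis using flows_compose[OF g'(1) g] by (intro bexI[of _ "g' \<circ> ?g"]) auto
  qed
qed

lemma flow_condition_u: "x \<in> reg S \<Longrightarrow> flow_condition S (\<lambda>g. g x n)"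
  unfolding flow_condition_def using make_u_nonzero[of x] reg_points(2)[of x] by metis

text \<open>After making both values of \<open>u\<close> nonzero, suppose that they agree. Then the base points differ, and
  2-transitivity of the base inside this level makes the values of \<open>v\<close> equal to 1 and 2. Now only the
  point with \<open>v = 1\<close> is moved inside its level, to a different value of \<open>f\<close>, hence of \<open>u\<close>.\<close>

lemma separate_u:
  assumes x: "x \<in> reg S" "x' \<in> reg S" "x \<noteq> x'" shows "\<exists>g\<in>flows S. g x n \<noteq> g x' n"
proof -
  have "\<exists>g\<in>flows S. \<forall>c\<in>{\<lambda>g. g x n, \<lambda>g. g x' n}. c g \<noteq> 0"
    by (rule generic_flow) (use flow_condition_u x in auto)
  then obtain g where g: "g \<in> flows S" "g x n \<noteq> 0" "g x' n \<noteq> 0" by auto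
  show ?thesis
  proof (cases "g x n = g x' n")
    case False
    then show ?thesis using g(1) by blast
  next
    case eq: True
    define c where "c = g x n"
    note r = reg_S_flow[OF g(1) x(1)] reg_S_flow[OF g(1) x(2)]
    note p = reg_points(2)[OF r(1)] reg_points(2)[OF r(2)]
    have c: "g x n = c" "g x' n = c" "c \<noteq> 0" using eq g by (auto simp: c_def)
    have "trunc n (g x) \<noteq> trunc n (g x')"
    proof
      assume t: "trunc n (g x) = trunc n (g x')"
      then have v: "g x (Suc n) = g x' (Suc n)" using equation[OF p(1)] equation[OF p(2)] c by simp
      have A: "g x \<in> affine_space (Suc (Suc n))" "g x' \<in> affine_space (Suc (Suc n))"
        using p by (simp_all only: points_S)
      have "g x = g x'" by (rule S_eqI[OF A t eq v])
      moreover obtain g' where "\<And>z. z \<in> points S \<Longrightarrow> g' (g z) = z" using flows_inverse[OF g(1)] by blast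
      ultimately have "x = x'" using reg_points(2)[OF x(1)] reg_points(2)[OF x(2)] by metis
      then show False using x(3) by blast
    qed
    moreover obtain z where z: "z \<in> reg Y" "f z = c" by (rule f_value)
    moreover obtain z' where z': "z' \<in> reg Y" "f z' = 2 * c" by (rule f_value)
    moreover have "z \<noteq> z'" using z z' c(3) by auto
    ultimately obtain h where h: "h \<in> flows Y" "h (trunc n (g x)) = z" "h (trunc n (g x')) = z'"
      using move_two[OF reg_trunc[OF r(1)] reg_trunc[OF r(2)]] by metis
    obtain g1 where g1: "g1 \<in> flows S" "\<And>x'. x' \<in> points S \<Longrightarrow>
      (x' n = c \<longrightarrow> g1 x' n = c \<and> trunc n (g1 x') = h (trunc n x'))"
      using level_flow[OF _ _ c(3) h(1), of "{}"] by auto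
    note r1 = reg_S_flow[OF g1(1) r(1)] reg_S_flow[OF g1(1) r(2)]
    note p1 = reg_points(2)[OF r1(1)] reg_points(2)[OF r1(2)]
    have t: "trunc n (g1 (g x)) = z" "trunc n (g1 (g x')) = z'" "g1 (g x) n = c" "g1 (g x') n = c"
      using g1(2)[OF p(1)] g1(2)[OF p(2)] c h by simp_all
    have v: "g1 (g x) (Suc n) = 1" "g1 (g x') (Suc n) = 2"
      using equation[OF p1(1)] equation[OF p1(2)] z z' c(3) by (simp_all add: t)
    obtain w where w: "w \<in> reg Y" "f w = c + 1" by (rule f_value)
    obtain h' where h': "h' \<in> flows Y" "h' z = w" using move_one[OF z(1) w(1)] by blast
    obtain g2 where g2: "g2 \<in> flows S" "\<And>x'. x' \<in> points S \<Longrightarrow>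
      (x' (Suc n) = 1 \<longrightarrow> g2 x' (Suc n) = 1 \<and> trunc n (g2 x') = h' (trunc n x')) \<and> (x' (Suc n) \<in> {2} \<longrightarrow> g2 x' = x')"
      using level_flow'[of "{2}" 1, OF _ _ _ h'(1)] by auto
    have "g2 (g1 (g x')) n = c" using g2(2)[OF p1(2)] v t by simp
    moreover have "g2 (g1 (g x)) n = c + 1"
      using equation[OF reg_points(2)[OF reg_S_flow[OF g2(1) r1(1)]]] g2(2)[OF p1(1)] v t h'(2) w(2) by simp
    ultimately have "g2 (g1 (g x)) n \<noteq> g2 (g1 (g x')) n" by simp
    then show ?thesis
      using flows_compose[OF g2(1) flows_compose[OF g1(1) g(1)]] by (intro bexI[of _ "g2 \<circ> (g1 \<circ> g)"]) auto
  qed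
qed

lemma flow_condition_u_diff:
  assumes "x \<in> reg S" "x' \<in> reg S" "x \<noteq> x'" shows "flow_condition S (\<lambda>g. g x n - g x' n)"
  unfolding flow_condition_def
proof (intro conjI allI impI)
  fix H :: "real \<Rightarrow> point \<Rightarrow> point" assume "\<forall>x i. upoly (\<lambda>s. H s x i)"
  then show "upoly (\<lambda>s. H s x n - H s x' n)" by (intro upoly_diff) auto
next
  show "\<exists>g\<in>flows S. g x n - g x' n \<noteq> 0" using separate_u[OF assms] by auto
qed (use assms reg_points(2) in auto)

lemma general_position:
  fixes a :: "nat \<Rightarrow> point"
  assumes a: "\<And>j. j < m \<Longrightarrow> a j \<in> reg S" "inj_on a {..<m}"
  shows "\<exists>g\<in>flows S. (\<forall>j<m. g (a j) n \<noteq> 0) \<and> inj_on (\<lambda>j. g (a j) n) {..<m}"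
proof -
  let ?C = "(\<lambda>j g. g (a j) n) ` {..<m} \<union> (\<lambda>(i, j) g. g (a i) n - g (a j) n) ` {(i, j). i < m \<and> j < m \<and> i \<noteq> j}"
  have "finite {(i, j). i < m \<and> j < m \<and> i \<noteq> j}"
    by (rule finite_subset[of _ "{..<m} \<times> {..<m}"]) auto
  then have fin: "finite ?C" by blast
  have cond: "flow_condition S c" if "c \<in> ?C" for c
    using that
  proof
    assume "c \<in> (\<lambda>j g. g (a j) n) ` {..<m}"
    then show ?thesis using flow_condition_u a(1) by auto
  next
    assume "c \<in> (\<lambda>(i, j) g. g (a i) n - g (a j) n) ` {(i, j). i < m \<and> j < m \<and> i \<noteq> j}"
    then obtain i j where "i < m" "j < m" "i \<noteq> j" and c: "c = (\<lambda>g. g (a i) n - g (a j) n)" by auto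
    moreover from this have "a i \<noteq> a j" using a(2) by (auto simp: inj_on_def)
    ultimately show ?thesis unfolding c using flow_condition_u_diff a(1) by blast
  qed
  have "\<exists>g\<in>flows S. \<forall>c\<in>?C. c g \<noteq> 0" by (rule generic_flow[OF fin cond])
  then obtain g where g: "g \<in> flows S" "\<forall>c\<in>?C. c g \<noteq> 0" by (rule bexE)
  have "g (a j) n \<noteq> 0" if "j < m" for j
    by (rule bspec[OF g(2), of "\<lambda>g. g (a j) n"]) (use that in auto)
  moreover have "inj_on (\<lambda>j. g (a j) n) {..<m}"
  proof (rule inj_onI, rule ccontr)
    fix i j assume ij: "i \<in> {..<m}" "j \<in> {..<m}" "g (a i) n = g (a j) n" "i \<noteq> j"
    have "g (a i) n - g (a j) n \<noteq> 0"
      by (rule bspec[OF g(2), of "\<lambda>g. g (a i) n - g (a j) n"]) (use ij in auto)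
    then show False using ij by simp
  qed
  ultimately show ?thesis using g(1) by blast
qed

text \<open>One point is moved at a time, by a flow that is the identity on the levels of the others.\<close>

lemma move_in_levels:
  fixes a :: "nat \<Rightarrow> point"
  assumes a: "\<And>j. j < m \<Longrightarrow> a j \<in> reg S" "\<And>j. j < m \<Longrightarrow> a j n \<noteq> 0" "inj_on (\<lambda>j. a j n) {..<m}"
    and z: "\<And>j. j < m \<Longrightarrow> z j \<in> reg Y"
  shows "\<exists>g\<in>flows S. \<forall>j<m. g (a j) n = a j n \<and> trunc n (g (a j)) = z j"
proof -
  have "\<exists>g\<in>flows S. \<forall>j<m. g (a j) n = a j n \<and> trunc n (g (a j)) = (if j < k then z j else trunc n (a j))"
    if "k \<le> m" for k
    using that
  proof (induction k)
    case 0
    show ?case by (rule bexI[OF _ flows.flows_id]) (simp add: trunc_points[OF reg_points(2)[OF a(1)]] del: nvars_S)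
  next
    case (Suc k)
    then have km: "k < m" by simp
    obtain g where g: "g \<in> flows S" "\<And>j. j < m \<Longrightarrow> g (a j) n = a j n"
      "\<And>j. j < m \<Longrightarrow> trunc n (g (a j)) = (if j < k then z j else trunc n (a j))" using Suc by auto
    obtain h where h: "h \<in> flows Y" "h (trunc n (a k)) = z k"
      using move_one[OF reg_trunc[OF a(1)[OF km]] z[OF km]] by blast
    define L where "L = (\<lambda>j. a j n) ` ({..<m} - {k})"
    have L: "finite L" "a k n \<notin> L" using a(3) km by (auto simp: L_def inj_on_def)
    obtain g1 where g1: "g1 \<in> flows S" "\<And>x. x \<in> points S \<Longrightarrow>
      (x n = a k n \<longrightarrow> g1 x n = a k n \<and> trunc n (g1 x) = h (trunc n x)) \<and> (x n \<in> L \<longrightarrow> g1 x = x)"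
      using level_flow[OF L a(2)[OF km] h(1)] by blast
    show ?case
    proof (rule bexI[OF _ flows_compose[OF g1(1) g(1)]], intro allI impI)
      fix j assume j: "j < m"
      have p: "g (a j) \<in> points S" by (rule reg_points(2)[OF reg_S_flow[OF g(1) a(1)[OF j]]])
      show "(g1 \<circ> g) (a j) n = a j n \<and> trunc n ((g1 \<circ> g) (a j)) = (if j < Suc k then z j else trunc n (a j))"
      proof (cases "j = k")
        case True
        then show ?thesis using g1(2)[OF p] g(2,3)[OF j] h(2) by simp
      next
        case False
        then have "g (a j) n \<in> L" using g(2)[OF j] j by (auto simp: L_def)
        then have "g1 (g (a j)) = g (a j)" using g1(2)[OF p] by blast
        then show ?thesis using g(2,3)[OF j] False by (auto simp: less_Suc_eq)
      qed
    qed
  qed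
  from this[of m] show ?thesis by auto
qed

lemma swap_reg: "x \<in> reg S \<Longrightarrow> swap x \<in> reg S"
  using swap_points by (auto simp: reg_S)

lemma move_in_levels':
  fixes a :: "nat \<Rightarrow> point"
  assumes a: "\<And>j. j < m \<Longrightarrow> a j \<in> reg S" "\<And>j. j < m \<Longrightarrow> a j (Suc n) \<noteq> 0" "inj_on (\<lambda>j. a j (Suc n)) {..<m}"
    and z: "\<And>j. j < m \<Longrightarrow> z j \<in> reg Y"
  shows "\<exists>g\<in>flows S. \<forall>j<m. g (a j) (Suc n) = a j (Suc n) \<and> trunc n (g (a j)) = z j"
proof -
  obtain g where g: "g \<in> flows S" "\<And>j. j < m \<Longrightarrow> g (swap (a j)) n = a j (Suc n) \<and> trunc n (g (swap (a j))) = z j"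
    using move_in_levels[of m "\<lambda>j. swap (a j)" z] a z swap_reg by auto
  obtain g' where g': "g' \<in> flows S" "\<And>x. x \<in> points S \<Longrightarrow> g' x = swap (g (swap x))"
    using swap_flow[OF g(1)] by blast
  show ?thesis by (rule bexI[OF _ g'(1)]) (use g'(2)[OF reg_points(2)[OF a(1)]] g(2) in simp)
qed

text \<open>Targets with distinct nonzero \<open>v\<close>-coordinates; the value of \<open>f\<close> at the base point is forced by
  \<open>f = uv\<close>.\<close>

definition standard_point :: "nat \<Rightarrow> point"
  where "standard_point j = sp (SOME y. y \<in> reg Y \<and> f y = (real j + 1) * (real j + 1)) (real j + 1) (real j + 1)"

text \<open>First the values of \<open>u\<close> are made distinct and nonzero. Moving inside these levels to base points with
  suitable values of \<open>f\<close> makes \<open>v = j + 1\<close>, as \<open>f\<close> attains every real value at regular points. Moving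
  inside these levels of \<open>v\<close> then brings the base points, and thereby \<open>u\<close>, into standard position.\<close>

lemma move_to_standard:
  fixes a :: "nat \<Rightarrow> point"
  assumes a: "\<And>j. j < m \<Longrightarrow> a j \<in> reg S" "inj_on a {..<m}"
  shows "\<exists>g\<in>flows S. \<forall>j<m. g (a j) = standard_point j"
proof -
  obtain g where g: "g \<in> flows S" "\<And>j. j < m \<Longrightarrow> g (a j) n \<noteq> 0" "inj_on (\<lambda>j. g (a j) n) {..<m}"
    using general_position[of m a] a by blast
  have "\<forall>j. \<exists>z. z \<in> reg Y \<and> f z = g (a j) n * (real j + 1)" using f_value_ex by blast
  then obtain z where z: "\<And>j. z j \<in> reg Y" "\<And>j. f (z j) = g (a j) n * (real j + 1)" by metis
  note r = reg_S_flow[OF g(1) a(1)]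
  have "\<exists>g1\<in>flows S. \<forall>j<m. g1 (g (a j)) n = g (a j) n \<and> trunc n (g1 (g (a j))) = z j"
    by (rule move_in_levels) (use r g(2,3) z(1) in auto)
  then obtain g1 where g1: "g1 \<in> flows S" "\<And>j. j < m \<Longrightarrow> g1 (g (a j)) n = g (a j) n \<and> trunc n (g1 (g (a j))) = z j" by blast
  note r1 = reg_S_flow[OF g1(1) r]
  have v: "g1 (g (a j)) (Suc n) = real j + 1" if j: "j < m" for j
    using equation[OF reg_points(2)[OF r1[OF j]]] g1(2)[OF j] z(2)[of j] g(2)[OF j] by simp
  define y where "y j = (SOME y. y \<in> reg Y \<and> f y = (real j + 1) * (real j + 1))" for j :: nat
  have y: "y j \<in> reg Y \<and> f (y j) = (real j + 1) * (real j + 1)" for j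
    unfolding y_def by (rule someI_ex[OF f_value_ex])
  have "\<exists>g2\<in>flows S. \<forall>j<m. g2 (g1 (g (a j))) (Suc n) = g1 (g (a j)) (Suc n) \<and> trunc n (g2 (g1 (g (a j)))) = y j"
    by (rule move_in_levels') (use r1 v y in \<open>auto simp: inj_on_def add_eq_0_iff\<close>)
  then obtain g2 where g2: "g2 \<in> flows S" "\<And>j. j < m \<Longrightarrow> g2 (g1 (g (a j))) (Suc n) = real j + 1 \<and> trunc n (g2 (g1 (g (a j)))) = y j"
    using v by auto
  have "g2 (g1 (g (a j))) = standard_point j" if j: "j < m" for j
  proof -
    note p = reg_points(2)[OF reg_S_flow[OF g2(1) r1[OF j]]]
    have "g2 (g1 (g (a j))) n * (real j + 1) = (real j + 1) * (real j + 1)"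
      using equation[OF p] g2(2)[OF j] y[of j] by simp
    then have u: "g2 (g1 (g (a j))) n = real j + 1" by simp
    have "g2 (g1 (g (a j))) = sp (trunc n (g2 (g1 (g (a j))))) (g2 (g1 (g (a j))) n) (g2 (g1 (g (a j))) (Suc n))"
      by (rule sp_trunc[symmetric]) (use points_affine_space[OF p] in simp)
    also have "\<dots> = standard_point j" using u g2(2)[OF j] by (simp add: standard_point_def y_def)
    finally show ?thesis .
  qed
  then show ?thesis using flows_compose[OF g2(1) flows_compose[OF g1(1) g(1)]]
    by (intro bexI[of _ "g2 \<circ> (g1 \<circ> g)"]) auto
qed

lemma transitive_S: "multiply_transitive m (SAut S) act (reg S)"
proof -
  have "reg S \<subseteq> points S" by (auto simp: reg_def)
  then show ?thesis
  proof (rule SR.multiply_transitive_iff[THEN iffD2], intro allI impI)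
    fix a b :: "nat \<Rightarrow> point"
    assume ab: "a ` {..<m} \<subseteq> reg S \<and> inj_on a {..<m} \<and> b ` {..<m} \<subseteq> reg S \<and> inj_on b {..<m}"
    obtain g where g: "g \<in> flows S" "\<And>j. j < m \<Longrightarrow> g (a j) = standard_point j"
      using move_to_standard[of m a] ab by blast
    obtain h where h: "h \<in> flows S" "\<And>j. j < m \<Longrightarrow> h (b j) = standard_point j"
      using move_to_standard[of m b] ab by blast
    obtain h' where h': "h' \<in> flows S" "\<And>x. x \<in> points S \<Longrightarrow> h' (h x) = x"
      using flows_inverse[OF h(1)] by blast
    have "h' (g (a j)) = b j" if "j < m" for j
    proof -
      have "b j \<in> points S" using ab that by (auto intro: reg_points(2))
      then show ?thesis using h'(2)[of "b j"] g(2)[OF that] h(2)[OF that] by simp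
    qed
    then show "\<exists>h\<in>flows S. \<forall>j<m. h (a j) = b j"
      using flows_compose[OF h'(1) g(1)] by (intro bexI[of _ "h' \<circ> g"]) auto
  qed
qed

text \<open>Otherwise \<open>f\<close> would be constant along orbits, and then on all regular points by transitivity.\<close>

lemma slope_ex: "\<exists>y\<in>reg Y. \<exists>w\<in>tangent_space Y y. dpoly n f y w \<noteq> 0"
proof (rule ccontr)
  assume "\<not> ?thesis"
  then have 0: "dpoly n f y w = 0" if "y \<in> reg Y" "w \<in> tangent_space Y y" for y w using that by blast
  have const: "f (\<phi> t y) = f y" if a: "Ga_action Y \<phi>" and y: "y \<in> reg Y" for \<phi> t y
  proof -
    have "((\<lambda>t. f (\<phi> t y)) has_real_derivative 0) (at s)" for s
    proof -
      let ?y = "\<phi> s y"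
      have yr: "?y \<in> reg Y" by (rule Ga_reg[OF affine_variety_ideal[OF Y] a y])
      obtain v where v: "\<And>i. ((\<lambda>t. \<phi> t ?y i) has_real_derivative v i) (at 0)" by (rule Ga_velocity_ex[OF a]) blast
      have "((\<lambda>t. f (\<phi> t ?y)) has_real_derivative dpoly n f (\<phi> 0 ?y) v) (at 0)"
        by (rule dpoly_chain[OF f v])
      moreover have "dpoly n f ?y v = 0"
        by (rule 0[OF yr Ga_velocity_tangent[OF IY_sub a reg_points(1)[OF yr] v]])
      ultimately have "((\<lambda>t. f (\<phi> t ?y)) has_real_derivative 0) (at 0)"
        by (simp add: Ga_zero[OF a reg_points(1)[OF yr]])
      then have "((\<lambda>t. f (\<phi> (t + s) y)) has_real_derivative 0) (at 0)"
        by (simp add: Ga_add[OF a reg_points(1)[OF y]])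
      then show ?thesis using DERIV_shift[of "\<lambda>t. f (\<phi> t y)" 0 0 s] by simp
    qed
    then have "f (\<phi> t y) = f (\<phi> 0 y)" by (intro DERIV_isconst_all) blast
    then show ?thesis using Ga_zero[OF a reg_points(1)[OF y]] by simp
  qed
  have flow: "h \<in> flows Y \<Longrightarrow> y \<in> reg Y \<Longrightarrow> f (h y) = f y" for h y
  proof (induction rule: flows.induct)
    case flows_id then show ?case by (simp add: trunc_points reg_points)
  next
    case (flows_step \<phi> h t)
    then show ?case using const flows_reg[OF affine_variety_ideal[OF Y] flows_step.hyps(2)] by simp
  qed
  obtain y z where yz: "y \<in> reg Y" "f y = 0" "z \<in> reg Y" "f z = 1" using f_value_ex[of 0] f_value_ex[of 1] by blast
  then show False using move_one[OF yz(1,3)] flow[OF _ yz(1)] by auto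
qed

text \<open>By transitivity, and since flows transport velocities, one regular point suffices. At a point with
  \<open>u = 1\<close> over a base point where \<open>f\<close> has nonzero slope, the lifted actions give the tangent vectors with
  vanishing \<open>u\<close>-component, and exchanging the roles of \<open>u\<close> and \<open>v\<close> gives one with nonzero
  \<open>u\<close>-component.\<close>

lemma flexible_S: "flexible S"
  unfolding flexible_def
proof
  fix x assume x: "x \<in> reg S"
  obtain y w0 where y: "y \<in> reg Y" and w0: "w0 \<in> tangent_space Y y" "dpoly n f y w0 \<noteq> 0"
    using slope_ex by blast
  have yA: "y \<in> affine_space n" using y by (simp add: reg_def points_def)
  define x0 where "x0 = sp y 1 (f y)"
  have x0: "x0 \<in> points S" unfolding x0_def using sp_points[OF yA] reg_points(1)[OF y] by simp
  have t0: "trunc n x0 = y" "x0 n = 1" "x0 (Suc n) = f y"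
    using yA by (auto simp: x0_def trunc_def affine_space_def)
  have x0r: "x0 \<in> reg S" using x0 y by (simp add: reg_S t0)
  have TY: "tangent_space Y y = span (YR.velocities y)"
    using flexible_Y y YR.span_velocities[OF reg_points(1)[OF y]] by (simp add: flexible_def flexible_point_def)
  have "flexible_point S x0"
  proof (rule SR.flexible_pointI[OF x0], rule subsetI)
    fix v assume v: "v \<in> tangent_space S x0"
    let ?V = "span (SR.velocities x0)"
    define up where "up w = w + dpoly n f y w *\<^sub>R unit_point (Suc n)" for w
    have lin: "linear up" by (rule linearI) (auto simp: up_def dpoly_lin algebra_simps)
    have up: "up w \<in> ?V" if w: "w \<in> tangent_space Y y" for w
    proof -
      have "up b \<in> SR.velocities x0" if b: "b \<in> YR.velocities y" for b
      proof -
        have "b \<in> affine_space n" using b TY span_base tangent_space_affine by blast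
        then have "sp (1 *\<^sub>R b) 0 (dpoly n f y b) = up b"
          by (auto simp: up_def unit_point_def affine_space_def scaleR_fun_apply fun_eq_iff)
        then show ?thesis using lift_velocity[OF x0, of b] b by (simp add: t0)
      qed
      then have "span (up ` YR.velocities y) \<subseteq> ?V" by (intro span_mono) auto
      then show ?thesis using w unfolding TY linear_span_image[OF lin] by blast
    qed
    obtain b where b: "b \<in> YR.velocities y" "dpoly n f y b \<noteq> 0" by (rule velocity_slope[OF y w0])
    have bT: "b \<in> tangent_space Y y" using b(1) TY span_base by blast
    define side where "side = sp (f y *\<^sub>R b) (dpoly n f y b) 0"
    have "sp (f y *\<^sub>R b) 0 (dpoly n f y b) \<in> SR.velocities (swap x0)"
      using lift_velocity[OF swap_points[OF x0], of b] b(1) by (simp add: t0)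
    then have "swap (sp (f y *\<^sub>R b) 0 (dpoly n f y b)) \<in> SR.velocities x0" by (rule swap_velocities)
    moreover have "swap (sp (f y *\<^sub>R b) 0 (dpoly n f y b)) = side"
      by (auto simp: swap_def side_def)
    ultimately have side: "side \<in> ?V" using span_base by metis
    define k where "k = v n / dpoly n f y b"
    define w where "w = trunc n v - (k * f y) *\<^sub>R b"
    have vT: "v \<in> affine_space (Suc (Suc n))" "trunc n v \<in> tangent_space Y y"
      "dpoly n f y (trunc n v) = v n * f y + v (Suc n)"
      using v unfolding tangent_space_S[OF x0] t0 by auto
    have wT: "w \<in> tangent_space Y y" unfolding w_def
      by (intro subspace_diff subspace_scale tangent_space_subspace[OF IY_sub] vT(2) bT)
    have "dpoly n f y (w + (k * f y) *\<^sub>R b) = dpoly n f y (trunc n v)" by (simp add: w_def)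
    then have dw: "dpoly n f y w = v (Suc n)" using b(2) unfolding dpoly_lin vT(3) by (simp add: k_def)
    have bA: "b \<in> affine_space n" by (rule tangent_space_affine[OF bT])
    have up_w: "up w i = w i + v (Suc n) * unit_point (Suc n) i" for i
      by (simp add: up_def dw scaleR_fun_apply)
    have w_i: "w i = (if i < n then v i else 0) - k * f y * b i" for i
      by (simp add: w_def trunc_def scaleR_fun_apply)
    have "v = k *\<^sub>R side + up w"
    proof
      fix i
      consider "i < n" | "i = n" | "i = Suc n" | "i > Suc n" by linarith
      then show "v i = (k *\<^sub>R side + up w) i"
      proof cases
        case 1
        then show ?thesis
          by (simp add: side_def up_w w_i unit_point_def scaleR_fun_apply)
      next
        case 2
        then show ?thesis using b(2) bA
          by (simp add: side_def up_w w_i unit_point_def scaleR_fun_apply affine_space_def k_def)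
      next
        case 3
        then show ?thesis using bA
          by (simp add: side_def up_w w_i unit_point_def scaleR_fun_apply affine_space_def)
      next
        case 4
        then show ?thesis using bA vT(1)
          by (simp add: side_def up_w w_i unit_point_def scaleR_fun_apply affine_space_def)
      qed
    qed
    then show "v \<in> ?V" using side up[OF wT] by (simp add: span_add span_scale)
  qed
  moreover obtain h where h: "h \<in> flows S" "h x0 = x"
  proof -
    have "reg S \<subseteq> points S" by (auto simp: reg_def)
    from SR.multiply_transitive_iff[OF this, of 1] transitive_S[of 1]
    have "\<forall>a b. a ` {..<1} \<subseteq> reg S \<and> inj_on a {..<1} \<and> b ` {..<1} \<subseteq> reg S \<and> inj_on b {..<1} \<longrightarrow>
        (\<exists>h\<in>flows S. \<forall>j<1. h (a j) = b (j::nat))" by blast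
    from this[rule_format, of "\<lambda>_. x0" "\<lambda>_. x"] show ?thesis
      using x0r x that by (auto simp: image_subset_iff inj_on_def)
  qed
  ultimately show "flexible_point S x" using SR.flexible_point_flow[OF h(1) x0] by simp
qed

end

lemma suspension_preserves:
  assumes Y: "affine_variety Y" and fl: "flexible Y"
    and tr: "\<And>m. multiply_transitive m (SAut Y) act (reg Y)"
    and f: "f \<in> polys (nvars Y)" "f ` reg Y = UNIV"
  shows "affine_variety (Susp Y f)" "flexible (Susp Y f)"
    "multiply_transitive m (SAut (Susp Y f)) act (reg (Susp Y f))"
proof -
  have "reg Y \<noteq> {}" using f(2) by auto
  then obtain y where "y \<in> reg Y" by blast
  from flexible_dominated[OF Y fl this] obtain \<Phi> where "dominating Y (variety_dim Y) \<Phi>" .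
  then interpret suspension_step Y f \<Phi>
    using assms by (intro suspension_step.intro suspension.intro suspension_step_axioms.intro)
  show "affine_variety (Susp Y f)" by (rule affine_variety_S)
  show "flexible (Susp Y f)" by (rule flexible_S)
  show "multiply_transitive m (SAut (Susp Y f)) act (reg (Susp Y f))" by (rule transitive_S)
qed

theorem theorem3p3:
  fixes X :: "nat \<Rightarrow> variety" and f :: "nat \<Rightarrow> point \<Rightarrow> real" and l :: nat
  assumes "affine_variety (X 0)"
    and "flexible (X 0)"
    and "connected (reg (X 0))"
    and "\<And>m. multiply_transitive m (SAut (X 0)) act (reg (X 0))"
    and "\<And>i. i \<in> {1..l} \<Longrightarrow> f i \<in> polys (nvars (X (i - 1)))"
    and "\<And>i. i \<in> {1..l} \<Longrightarrow> f i ` reg (X (i - 1)) = UNIV"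
    and "\<And>i. i \<in> {1..l} \<Longrightarrow> X i = Susp (X (i - 1)) (f i)"
  shows "\<forall>i\<in>{1..l}. flexible (X i) \<and>
    (\<forall>m. multiply_transitive m (SAut (X i)) act (reg (X i)))"
proof -
  have "i \<le> l \<Longrightarrow> affine_variety (X i) \<and> flexible (X i) \<and>
    (\<forall>m. multiply_transitive m (SAut (X i)) act (reg (X i)))" for i
  proof (induction i)
    case 0
    then show ?case using assms(1,2,4) by blast
  next
    case (Suc i)
    then have i: "Suc i \<in> {1..l}" and IH: "affine_variety (X i)" "flexible (X i)"
      "\<And>m. multiply_transitive m (SAut (X i)) act (reg (X i))" by auto
    have f: "f (Suc i) \<in> polys (nvars (X i))" "f (Suc i) ` reg (X i) = UNIV"
      using assms(5)[OF i] assms(6)[OF i] by simp_all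
    have "X (Suc i) = Susp (X i) (f (Suc i))" using assms(7)[OF i] by simp
    then show ?case using suspension_preserves[OF IH f] by simp
  qed
  then show ?thesis by simp
qed

end
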